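(* Let $\Phi : C_{\mathrm{ex}}[0,1] \to [0,\infty)$ be a continuous nonnegative functional that is positively homogeneous, i.e. $\Phi(tf) = t\,\Phi(f)$ for all $f \in C_{\mathrm{ex}}[0,1]$ and all real $t \ge 0$, and that is not identically $0$. Let $X := \Phi(B_{\mathrm{ex}})$, where $B_{\mathrm{ex}}$ is a standard Brownian excursion, and let $$\gamma := \max\{\Phi(f) : f \in K_{\mathrm{ex}}\}.$$ Then $0 < \gamma < \infty$ and $$-\ln \mathbb{P}(X > x) \sim \frac{x^2}{2\gamma^2} \quad \text{as } x \to \infty,$$ $$\ln \mathbb{E}\, e^{tX} \sim \frac{\gamma^2}{2}\, t^2 \quad \text{as } t \to \infty,$$ $$\bigl(\mathbb{E} X^r\bigr)^{1/r} \sim \frac{\gamma}{\sqrt{e}}\, r^{1/2} \quad \text{as } r \to \infty.$$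
   Context: $C[0,1]$ is the space of continuous real-valued functions on $[0,1]$ with the supremum metric $\|f-g\|_\infty = \sup_t |f(t)-g(t)|$. $C_{\mathrm{ex}}[0,1] := \{f \in C[0,1] : f(0)=f(1)=0,\ f \ge 0\}$, with the same metric. $B_{\mathrm{ex}}$ is a standard (normalized) Brownian excursion on $[0,1]$, regarded as a random element of $C_{\mathrm{ex}}[0,1]$. $H$ is the Sobolev space of all absolutely continuous $f \in C[0,1]$ with $\|f'\|_2^2 := \int_0^1 |f'(t)|^2\,dt < \infty$. $K := \{f \in H : \|f'\|_2^2 \le 1\}$ and $K_{\mathrm{ex}} := K \cap C_{\mathrm{ex}}[0,1]$. The notation $a \sim b$ means that the ratio $a/b$ tends to $1$ in the indicated limit; $x,t,r$ are real variables. *)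

theory Defs
  imports "HOL-Probability.Probability" "HOL-Library.Landau_Symbols"
begin

text \<open>
  Elements of the function spaces are total functions that are \<^const>\<open>undefined\<close> outside
  \<open>{0..1}\<close>, so that each continuous function on the interval has exactly one representative.
\<close>

definition C01 :: "(real \<Rightarrow> real) metric" where
  "C01 = cfunspace (top_of_set {0..1}) euclidean_metric"

definition Cex :: "(real \<Rightarrow> real) metric" where
  "Cex = submetric C01 {f. f 0 = 0 \<and> f 1 = 0 \<and> (\<forall>s\<in>{0..1}. 0 \<le> f s)}"

lemma mspace_C01: "mspace C01 = {f \<in> extensional {0..1}. continuous_on {0..1} f}"
proof -
  have "bounded (f ` {0..1::real})" if "continuous_on {0..1} f" for f :: "real \<Rightarrow> real"
    using that compact_continuous_image compact_imp_bounded by blast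
  then show ?thesis
    by (auto simp: C01_def Metric_space.mbounded_alt_pos PiE_def
        Met_TC.mbounded_def intro: compactin_subspace)
qed

lemma mspace_Cex:
  "mspace Cex = {f \<in> extensional {0..1}. continuous_on {0..1} f \<and> f 0 = 0 \<and> f 1 = 0 \<and>
                   (\<forall>s\<in>{0..1}. 0 \<le> f s)}"
  by (auto simp: Cex_def mspace_C01)

lemma mdist_Cex:
  assumes "f \<in> mspace Cex" "g \<in> mspace Cex"
  shows "mdist Cex f g = (SUP s\<in>{0..1}. \<bar>f s - g s\<bar>)"
  using assms
  by (auto simp: Cex_def C01_def cfunspace_def Met_TC.fdist_def dist_real_def)

definition Cex_borel :: "(real \<Rightarrow> real) measure" where
  "Cex_borel = sigma (mspace Cex) {U. openin (mtopology_of Cex) U}"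

definition abs_continuous_on :: "real set \<Rightarrow> (real \<Rightarrow> real) \<Rightarrow> bool" where
  "abs_continuous_on S f \<longleftrightarrow>
     (\<forall>\<epsilon>>0. \<exists>\<delta>>0. \<forall>I. finite I \<longrightarrow> (\<forall>(a, b)\<in>I. a < b \<and> {a..b} \<subseteq> S) \<longrightarrow>
        disjoint_family_on (\<lambda>(a, b). {a<..<b}) I \<longrightarrow> (\<Sum>(a, b)\<in>I. b - a) < \<delta> \<longrightarrow>
        (\<Sum>(a, b)\<in>I. \<bar>f b - f a\<bar>) < \<epsilon>)"

text \<open>
  An absolutely continuous function is differentiable almost everywhere, and the (unspecified) value
  of \<^const>\<open>deriv\<close> on the exceptional null set does not affect the integral.
\<close>

definition energy :: "(real \<Rightarrow> real) \<Rightarrow> ennreal" where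
  "energy f = (\<integral>\<^sup>+s\<in>{0..1}. ennreal ((deriv f s)\<^sup>2) \<partial>lebesgue)"

definition Sobolev_H :: "(real \<Rightarrow> real) set" where
  "Sobolev_H = {f \<in> mspace C01. abs_continuous_on {0..1} f \<and> energy f < \<infinity>}"

definition K :: "(real \<Rightarrow> real) set" where
  "K = {f \<in> Sobolev_H. energy f \<le> 1}"

definition Kex :: "(real \<Rightarrow> real) set" where
  "Kex = K \<inter> mspace Cex"

text \<open>
  The normalized Brownian excursion is specified by its classical finite-dimensional densities.
  \<open>killed_kernel t x y\<close> is the transition density of Brownian motion killed at 0 (reflection
  principle), and \<open>hitting_density x t\<close> is the density at time \<open>t\<close> of the first hitting time of 0 by
  Brownian motion started at \<open>x\<close>. For \<open>0 < t 0 < \<dots> < t (n - 1) < 1\<close> the values of the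
  excursion at these times have on \<open>(0,\<infinity>)^n\<close> the joint density \<open>excursion_density n t\<close>.
  For \<open>n = 1\<close> this is \<open>2 x^2 exp (- x^2 / (2 t (1 - t))) / sqrt (2 pi t^3 (1 - t)^3)\<close>.
\<close>

definition killed_kernel :: "real \<Rightarrow> real \<Rightarrow> real \<Rightarrow> real" where
  "killed_kernel t x y = normal_density x (sqrt t) y - normal_density (- x) (sqrt t) y"

definition hitting_density :: "real \<Rightarrow> real \<Rightarrow> real" where
  "hitting_density x t = x / t * normal_density 0 (sqrt t) x"

definition excursion_density :: "nat \<Rightarrow> (nat \<Rightarrow> real) \<Rightarrow> (nat \<Rightarrow> real) \<Rightarrow> real" where
  "excursion_density n t x =
     (if \<forall>i<n. 0 < x i
      then sqrt (8 * pi) * hitting_density (x 0) (t 0) *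
           (\<Prod>i\<in>{1..<n}. killed_kernel (t i - t (i - 1)) (x (i - 1)) (x i)) *
           hitting_density (x (n - 1)) (1 - t (n - 1))
      else 0)"

definition brownian_excursion :: "'w measure \<Rightarrow> ('w \<Rightarrow> real \<Rightarrow> real) \<Rightarrow> bool" where
  "brownian_excursion M B \<longleftrightarrow>
     prob_space M \<and> B \<in> M \<rightarrow>\<^sub>M Cex_borel \<and>
     (\<forall>n\<ge>1. \<forall>t. strict_mono_on {..<n} t \<and> t ` {..<n} \<subseteq> {0<..<1} \<longrightarrow>
        distributed M (\<Pi>\<^sub>M i\<in>{..<n}. lborel) (\<lambda>\<omega>. \<lambda>i\<in>{..<n}. B \<omega> (t i))
          (\<lambda>x. ennreal (excursion_density n t x)))"

lemma excursion_density_one: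
  assumes "0 < t 0" "t 0 < 1" "0 < x 0"
  shows "excursion_density 1 t x =
    2 * (x 0)\<^sup>2 * exp (- (x 0)\<^sup>2 / (2 * t 0 * (1 - t 0))) / sqrt (2 * pi * t 0 ^ 3 * (1 - t 0) ^ 3)"
    (is "?l = ?r")
proof -
  define s y where "s = t 0" and "y = x 0"
  have s: "0 < s" "0 < 1 - s" and y: "0 < y"
    using assms by (auto simp: s_def y_def)
  have e: "exp (- y\<^sup>2 / (2 * s)) * exp (- y\<^sup>2 / (2 * (1 - s))) = exp (- y\<^sup>2 / (2 * s * (1 - s)))"
    unfolding exp_add [symmetric] using s by (simp add: divide_simps) (simp add: algebra_simps)
  have c: "s * u * (sqrt (2 * pi * s) * sqrt (2 * pi * u)) = sqrt (2 * pi) * sqrt (2 * pi * s ^ 3 * u ^ 3)"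
    if "0 < u" for u
    using s that by (simp add: real_sqrt_mult power3_eq_cube)
  have q: "2 * sqrt (2 * pi) / (s * (1 - s) * (sqrt (2 * pi * s) * sqrt (2 * pi * (1 - s)))) =
      2 / sqrt (2 * pi * s ^ 3 * (1 - s) ^ 3)"
    unfolding c [OF s(2)] by simp
  have r: "sqrt (8 * pi) = 2 * sqrt (2 * pi)"
    using real_sqrt_mult [of 4 "2 * pi"] by simp
  have "?l = (2 * sqrt (2 * pi) / (s * (1 - s) * (sqrt (2 * pi * s) * sqrt (2 * pi * (1 - s))))) *
      y\<^sup>2 * (exp (- y\<^sup>2 / (2 * s)) * exp (- y\<^sup>2 / (2 * (1 - s))))"
    using assms s unfolding excursion_density_def hitting_density_def normal_density_def r
    by (simp add: s_def [symmetric] y_def [symmetric] power2_eq_square ac_simps)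
  also have "\<dots> = ?r"
    unfolding e q by (simp add: s_def y_def)
  finally show ?thesis .
qed

end

theory Submission
  imports Defs "HOL-Complex_Analysis.Great_Picard" "HOL-Real_Asymp.Real_Asymp"
begin

text \<open>
  Scaled down by a large factor \<open>x\<close>, the Brownian excursion obeys a large deviation principle whose
  rate is half the energy: following \<open>x * f\<close> has probability about \<open>exp (- x\<^sup>2 * energy f / 2)\<close>.
  By homogeneity, the cheapest way of reaching \<open>\<Phi> > x\<close> is to follow \<open>x / \<gamma> * f\<close>, where \<open>f\<close> maximises
  \<open>\<Phi>\<close> over the functions of energy at most \<open>1\<close>. This costs \<open>exp (- x\<^sup>2 / (2 * \<gamma>\<^sup>2))\<close>, and the
  exponential and power moments follow from that tail by Laplace's method.

  The principle is visible in the finite-dimensional densities. Up to prefactors, the density at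
  finitely many times is \<open>exp (- Q / 2)\<close>, where \<open>Q\<close> is the energy of the polygon through
  the prescribed values (\<open>path_energy\<close>). Giving up an arbitrarily small part of the exponent to absorb
  the prefactors, one finds that the polygon has energy above \<open>q\<close> with probability at most about
  \<open>exp (- q / 2)\<close> (\<open>path_energy_tail\<close>), and that the excursion passes through given boxes of unit
  width with at least the corresponding probability (\<open>box_probability_lower\<close>). Between the points of
  a fine grid, the excursion moves by more than \<open>\<delta> * x\<close> only with a probability below any prescribed
  Gaussian rate; this follows from the one- and two-point densities by chaining
  (\<open>fluctuation_tail\<close>). Hence the excursion may be replaced by its inscribed polygon.

  The passage from polygons to \<open>\<Phi>\<close> rests on the compactness of \<open>Kex\<close> in the uniform metric
  (\<open>Kex_sequentially_compact\<close>): the maximum \<open>\<gamma>\<close> is attained, and \<open>\<Phi>\<close> is hardly larger than \<open>\<gamma>\<close> near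
  \<open>Kex\<close>. Therefore \<open>\<Phi> > x\<close> forces a large energy or a large fluctuation (\<open>tail_upper\<close>), while a
  path near a multiple of a maximiser has \<open>\<Phi> > x\<close> (\<open>tail_lower\<close>).

  Compactness in turn comes from F. Riesz's description of the energy by the sums of
  \<open>(f v - f u)\<^sup>2 / (v - u)\<close> over disjoint intervals, which are continuous in \<open>f\<close>. To compare these sums
  with the integral of \<open>(deriv f)\<^sup>2\<close>, one needs that an absolutely continuous function is differentiable
  almost everywhere and is the integral of its derivative; both are derived from Vitali's covering
  theorem (\<open>abs_continuous_differentiable_ae\<close>, \<open>abs_continuous_deriv_has_integral\<close>).
\<close>

section \<open>Differentiability and energy of absolutely continuous functions\<close>

text \<open>
  Degenerate intervals carry no increment, and once they are removed an indexed family of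
  intervals is determined by its set of endpoint pairs. In this form absolute continuity applies
  directly to sets of intervals and to tagged divisions.
\<close>

lemma abs_continuous_on_indexed:
  assumes "abs_continuous_on S f" "\<epsilon> > 0"
  obtains \<delta> where "\<delta> > 0"
    "\<forall>(T :: 'i set) l r. finite T \<longrightarrow> (\<forall>i\<in>T. l i \<le> r i \<and> {l i..r i} \<subseteq> S) \<longrightarrow>
       (\<forall>i\<in>T. \<forall>j\<in>T. i \<noteq> j \<longrightarrow> {l i<..<r i} \<inter> {l j<..<r j} = {}) \<longrightarrow>
       (\<Sum>i\<in>T. r i - l i) < \<delta> \<longrightarrow> (\<Sum>i\<in>T. \<bar>f (r i) - f (l i)\<bar>) < \<epsilon>"
proof -
  have "\<exists>\<delta>>0. \<forall>I. finite I \<longrightarrow> (\<forall>(a, b)\<in>I. a < b \<and> {a..b} \<subseteq> S) \<longrightarrow>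
        disjoint_family_on (\<lambda>(a, b). {a<..<b}) I \<longrightarrow> (\<Sum>(a, b)\<in>I. b - a) < \<delta> \<longrightarrow>
        (\<Sum>(a, b)\<in>I. \<bar>f b - f a\<bar>) < \<epsilon>"
    by (rule assms(1)[unfolded abs_continuous_on_def, THEN spec, THEN mp, OF assms(2)])
  then obtain \<delta> where \<delta>: "\<delta> > 0"
    and AC: "\<forall>I. finite I \<longrightarrow> (\<forall>(a, b)\<in>I. a < b \<and> {a..b} \<subseteq> S) \<longrightarrow>
        disjoint_family_on (\<lambda>(a, b). {a<..<b}) I \<longrightarrow> (\<Sum>(a, b)\<in>I. b - a) < \<delta> \<longrightarrow>
        (\<Sum>(a, b)\<in>I. \<bar>f b - f a\<bar>) < \<epsilon>" by (elim exE conjE)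
  show ?thesis
  proof
    show "\<delta> > 0" by fact
    show "\<forall>(T :: 'i set) l r. finite T \<longrightarrow> (\<forall>i\<in>T. l i \<le> r i \<and> {l i..r i} \<subseteq> S) \<longrightarrow>
       (\<forall>i\<in>T. \<forall>j\<in>T. i \<noteq> j \<longrightarrow> {l i<..<r i} \<inter> {l j<..<r j} = {}) \<longrightarrow>
       (\<Sum>i\<in>T. r i - l i) < \<delta> \<longrightarrow> (\<Sum>i\<in>T. \<bar>f (r i) - f (l i)\<bar>) < \<epsilon>"
    proof (intro allI impI)
    fix T :: "'i set" and l r :: "'i \<Rightarrow> real"
    assume T: "finite T" and lr: "\<forall>i\<in>T. l i \<le> r i \<and> {l i..r i} \<subseteq> S"
      and disj: "\<forall>i\<in>T. \<forall>j\<in>T. i \<noteq> j \<longrightarrow> {l i<..<r i} \<inter> {l j<..<r j} = {}"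
      and small: "(\<Sum>i\<in>T. r i - l i) < \<delta>"
    define T' where "T' = {i\<in>T. l i < r i}"
    have T': "finite T'" "T' \<subseteq> T" using T by (auto simp: T'_def)
    have inj: "inj_on (\<lambda>i. (l i, r i)) T'"
    proof (rule inj_onI, rule ccontr)
      fix i j assume ij: "i \<in> T'" "j \<in> T'" "(l i, r i) = (l j, r j)" "i \<noteq> j"
      then have "{l i<..<r i} \<inter> {l j<..<r j} = {l i<..<r i}" by auto
      moreover have "{l i<..<r i} \<noteq> {}" using ij by (simp add: T'_def)
      ultimately show False using disj[rule_format, of i j] ij by (simp add: T'_def)
    qed
    have "(\<Sum>(a, b)\<in>(\<lambda>i. (l i, r i)) ` T'. \<bar>f b - f a\<bar>) < \<epsilon>"
    proof (rule AC[THEN spec, THEN mp, THEN mp, THEN mp, THEN mp])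
      show "disjoint_family_on (\<lambda>(a, b). {a<..<b}) ((\<lambda>i. (l i, r i)) ` T')"
        unfolding disjoint_family_on_def
      proof (intro ballI impI)
        fix m n assume mn: "m \<in> (\<lambda>i. (l i, r i)) ` T'" "n \<in> (\<lambda>i. (l i, r i)) ` T'" "m \<noteq> n"
        then obtain i j where ij: "i \<in> T'" "j \<in> T'" "m = (l i, r i)" "n = (l j, r j)" by blast
        then have "i \<noteq> j" using mn by blast
        then show "(case m of (a, b) \<Rightarrow> {a<..<b}) \<inter> (case n of (a, b) \<Rightarrow> {a<..<b}) = {}"
          using ij disj T'(2) by (simp only: prod.case) (meson subsetD)
      qed
      have "(\<Sum>i\<in>T'. r i - l i) \<le> (\<Sum>i\<in>T. r i - l i)"
        using T T' lr by (intro sum_mono2) auto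
      then show "(\<Sum>(a, b)\<in>(\<lambda>i. (l i, r i)) ` T'. b - a) < \<delta>"
        using small by (simp add: sum.reindex[OF inj])
    qed (use T' lr in \<open>auto simp: T'_def\<close>)
    moreover have "(\<Sum>(a, b)\<in>(\<lambda>i. (l i, r i)) ` T'. \<bar>f b - f a\<bar>) = (\<Sum>i\<in>T. \<bar>f (r i) - f (l i)\<bar>)"
      unfolding sum.reindex[OF inj] o_def prod.case
      using T lr by (intro sum.mono_neutral_left) (force simp: T'_def antisym)+
    ultimately show "(\<Sum>i\<in>T. \<bar>f (r i) - f (l i)\<bar>) < \<epsilon>" by simp
    qed
  qed
qed

lemma abs_continuous_on_imp_continuous_on:
  assumes "abs_continuous_on {a..b} f" shows "continuous_on {a..b} f"
  unfolding continuous_on_iff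
proof (intro ballI allI impI)
  fix x e :: real assume x: "x \<in> {a..b}" and e: "e > 0"
  obtain \<delta> where \<delta>: "\<delta> > 0"
    "\<forall>(T :: unit set) l r. finite T \<longrightarrow> (\<forall>i\<in>T. l i \<le> r i \<and> {l i..r i} \<subseteq> {a..b}) \<longrightarrow>
       (\<forall>i\<in>T. \<forall>j\<in>T. i \<noteq> j \<longrightarrow> {l i<..<r i} \<inter> {l j<..<r j} = {}) \<longrightarrow>
       (\<Sum>i\<in>T. r i - l i) < \<delta> \<longrightarrow> (\<Sum>i\<in>T. \<bar>f (r i) - f (l i)\<bar>) < e"
    by (rule abs_continuous_on_indexed[OF assms e, where ?'i = unit]) (rule that)
  show "\<exists>d>0. \<forall>y\<in>{a..b}. dist y x < d \<longrightarrow> dist (f y) (f x) < e"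
  proof (intro exI conjI ballI impI)
    fix y assume "y \<in> {a..b}" "dist y x < \<delta>"
    then show "dist (f y) (f x) < e"
      using \<delta>(2)[THEN spec, THEN spec, THEN spec, of "{()}" "\<lambda>_. min x y" "\<lambda>_. max x y"] x
      by (cases "x \<le> y") (auto simp: dist_real_def abs_minus_commute)
  qed (use \<delta> in auto)
qed

text \<open>
  On the line balls are intervals, parametrised by midpoint and half-length, so the Vitali
  covering theorem for balls exhausts \<open>E\<close> up to a null set by countably many disjoint
  intervals; finitely many of them already capture all but \<open>\<eta>\<close> of its measure.
\<close>

lemma Vitali_finite_intervals:
  fixes E U :: "real set" and R :: "real \<Rightarrow> real \<Rightarrow> bool"
  assumes E: "E \<in> lmeasurable" "E \<subseteq> U" and U: "open U" and "\<eta> > 0"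
    and cov: "\<And>x d. x \<in> E \<Longrightarrow> d > 0 \<Longrightarrow> \<exists>u v. u < x \<and> x < v \<and> v - u < d \<and> R u v"
  obtains J where "finite J" "pairwise disjnt J"
    "\<And>k. k \<in> J \<Longrightarrow> Inf k < Sup k \<and> k = {Inf k..Sup k} \<and> k \<subseteq> U \<and> R (Inf k) (Sup k)"
    "measure lebesgue (E - \<Union>J) < \<eta>"
proof -
  define K where "K = {(u, v). u < v \<and> {u..v} \<subseteq> U \<and> R u v}"
  define m h where "m = (\<lambda>(u, v). (u + v) / 2 :: real)" and "h = (\<lambda>(u, v). (v - u) / 2 :: real)"
  have cb: "cball (m i) (h i) = {fst i..snd i}" for i
    by (cases i) (simp add: m_def h_def cball_eq_atLeastAtMost field_simps)
  obtain C where C: "countable C" "C \<subseteq> K" "pairwise (\<lambda>i j. disjnt (cball (m i) (h i)) (cball (m j) (h j))) C"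
     "negligible (E - (\<Union>i \<in> C. cball (m i) (h i)))"
  proof (rule Vitali_covering_theorem_cballs[of K h E m])
    fix i assume "i \<in> K" then show "0 < h i" by (auto simp: K_def h_def)
  next
    fix x d :: real assume x: "x \<in> E" "0 < d"
    obtain e where e: "e > 0" "ball x e \<subseteq> U" using x E U by (meson openE subsetD)
    obtain u v where uv: "u < x" "x < v" "v - u < min d e" "R u v"
      using cov[of x "min d e"] x e by auto
    have "{u..v} \<subseteq> ball x e" using uv by (auto simp: dist_real_def)
    then show "\<exists>i. i \<in> K \<and> x \<in> cball (m i) (h i) \<and> h i < d"
      using uv e x by (intro exI[of _ "(u, v)"]) (auto simp: K_def cb, auto simp: h_def)
  qed
  define D where "D = (\<lambda>i. E \<inter> {fst i..snd i}) ` C"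
  have D: "countable D" "\<And>d. d \<in> D \<Longrightarrow> d \<in> lmeasurable"
    using C(1) E by (auto simp: D_def intro!: fmeasurable_Int_fmeasurable)
  have B: "measure lebesgue (\<Union>D') \<le> measure lebesgue E" if "D' \<subseteq> D" "finite D'" for D'
  proof (rule measure_mono_fmeasurable)
    show "\<Union>D' \<in> sets lebesgue" using that D(2) by (intro sets.finite_Union) (auto intro: fmeasurableD)
  qed (use that E in \<open>auto simp: D_def\<close>)
  obtain D' where D': "D' \<subseteq> D" "finite D'" "measure lebesgue (\<Union>D) - \<eta> < measure lebesgue (\<Union>D')"
    using measure_countable_Union_approachable[OF D(1) \<open>\<eta> > 0\<close> D(2), of "measure lebesgue E" thesis] B by blast
  obtain C' where C': "C' \<subseteq> C" "finite C'" "D' = (\<lambda>i. E \<inter> {fst i..snd i}) ` C'"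
    using finite_subset_image[OF D'(2) D'(1)[unfolded D_def]] by blast
  have UD: "\<Union>D \<in> lmeasurable"
    by (rule fmeasurable_Union_bound[OF D(1) D(2) B])
  have mE: "measure lebesgue (\<Union>D) = measure lebesgue E"
  proof (rule measure_negligible_symdiff)
    have "(E - \<Union>D) \<union> (\<Union>D - E) = E - (\<Union>i \<in> C. cball (m i) (h i))"
      by (auto simp: D_def cb)
    then show "negligible (E - \<Union>D \<union> (\<Union>D - E))" using C(4) by simp
  qed (use E in auto)
  show ?thesis
  proof
    let ?J = "(\<lambda>i. {fst i..snd i}) ` C'"
    show "finite ?J" using C' by auto
    show "pairwise disjnt ?J"
    proof (rule pairwiseI)
      fix k l assume "k \<in> ?J" "l \<in> ?J" "k \<noteq> l"
      then obtain i j where ij: "i \<in> C'" "j \<in> C'" "k = {fst i..snd i}" "l = {fst j..snd j}" "i \<noteq> j" by blast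
      then have "i \<in> C" "j \<in> C" using C'(1) by blast+
      then show "disjnt k l" using pairwiseD[OF C(3), of i j] ij unfolding cb by simp
    qed
    show "Inf k < Sup k \<and> k = {Inf k..Sup k} \<and> k \<subseteq> U \<and> R (Inf k) (Sup k)" if k: "k \<in> ?J" for k
    proof -
      obtain u v where "(u, v) \<in> C'" "k = {u..v}" using k by auto
      moreover have "u < v" "{u..v} \<subseteq> U" "R u v" using calculation C'(1) C(2) by (auto simp: K_def)
      ultimately show ?thesis by simp
    qed
    have "\<Union>D' = E \<inter> \<Union>?J" using C' by auto
    then have "E - \<Union>?J = E - \<Union>D'" by blast
    moreover have "measure lebesgue (E - \<Union>D') = measure lebesgue E - measure lebesgue (\<Union>D')"
    proof (rule measurable_measure_Diff)
      show "\<Union>D' \<in> sets lebesgue" using D'(1,2) D(2) by (intro sets.finite_Union) (auto intro: fmeasurableD)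
    qed (use E D'(1) in \<open>auto simp: D_def\<close>)
    ultimately have "measure lebesgue (E - \<Union>?J) = measure lebesgue E - measure lebesgue (\<Union>D')"
      by simp
    then show "measure lebesgue (E - \<Union>?J) < \<eta>" using D' mE by simp
  qed
qed

lemma division_of_disjoint_intervals:
  fixes J :: "real set set"
  assumes "finite J" "pairwise disjnt J" "\<And>k. k \<in> J \<Longrightarrow> Inf k < Sup k \<and> k = {Inf k..Sup k}"
  shows "J division_of \<Union>J"
proof (rule division_ofI)
  fix k assume k: "k \<in> J"
  then obtain u v where uv: "u < v" "k = {u..v}" using assms(3) by blast
  show "k \<noteq> {}" using uv by simp
  show "\<exists>a b. k = cbox a b" using uv by auto
next
  fix k l assume "k \<in> J" "l \<in> J" "k \<noteq> l"
  then have "k \<inter> l = {}" using assms(2) by (auto simp: pairwise_def disjnt_def)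
  then show "interior k \<inter> interior l = {}" using interior_subset by blast
qed (use assms in auto)

lemma measure_Union_intervals:
  fixes J :: "real set set"
  assumes "finite J" "pairwise disjnt J" "\<And>k. k \<in> J \<Longrightarrow> Inf k < Sup k \<and> k = {Inf k..Sup k}"
  shows "\<Union>J \<in> lmeasurable" "measure lebesgue (\<Union>J) = (\<Sum>k\<in>J. Sup k - Inf k)"
proof -
  have lm: "k \<in> lmeasurable" "measure lebesgue k = Sup k - Inf k" if "k \<in> J" for k
  proof -
    obtain u v where "u < v" "k = {u..v}" using assms(3) \<open>k \<in> J\<close> by blast
    then show "k \<in> lmeasurable" "measure lebesgue k = Sup k - Inf k" by auto
  qed
  show "\<Union>J \<in> lmeasurable"
    using assms(1) lm(1) by (intro fmeasurable.finite_Union) auto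
  have "measure lebesgue (\<Union>J) = (\<Sum>k\<in>J. measure lebesgue k)"
    using assms(1,2) lm(1) by (intro measure_Union') (auto simp: disjnt_def pairwise_def)
  then show "measure lebesgue (\<Union>J) = (\<Sum>k\<in>J. Sup k - Inf k)"
    using lm(2) by simp
qed

text \<open>
  The increments telescope; tagging every piece by its left endpoint reduces this to the
  corresponding fact for tagged divisions.
\<close>

lemma division_increment_sum:
  fixes f :: "real \<Rightarrow> real"
  assumes "a \<le> b" "d division_of {a..b}"
  shows "(\<Sum>k\<in>d. f (Sup k) - f (Inf k)) = f b - f a"
proof -
  define p where "p = (\<lambda>k. (Inf k, k)) ` d"
  have d: "\<exists>u v. u \<le> v \<and> k = {u..v}" if "k \<in> d" for k
    using division_ofD(3,4)[OF assms(2) that] by (metis atLeastatMost_empty_iff box_real(2))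
  have Inf_in: "Inf k \<in> k" if "k \<in> d" for k using d[OF that] by auto
  have p: "p tagged_division_of {a..b}"
  proof (intro tagged_division_ofI)
    show "finite p" using division_ofD(1)[OF assms(2)] by (simp add: p_def)
    have "{K. \<exists>x. (x, K) \<in> p} = d" by (auto simp: p_def)
    then show "\<Union>{K. \<exists>x. (x, K) \<in> p} = {a..b}"
      using division_ofD(6)[OF assms(2)] by simp
  next
    fix x k assume xk: "(x, k) \<in> p"
    then have k: "k \<in> d" "x = Inf k" by (auto simp: p_def)
    show "x \<in> k" unfolding k(2) by (rule Inf_in[OF k(1)])
    show "k \<subseteq> {a..b}" by (rule division_ofD(2)[OF assms(2) k(1)])
    show "\<exists>a b. k = cbox a b" by (rule division_ofD(4)[OF assms(2) k(1)])
  next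
    fix x1 K1 x2 K2 assume "(x1, K1) \<in> p" "(x2, K2) \<in> p" "(x1, K1) \<noteq> (x2, K2)"
    then show "interior K1 \<inter> interior K2 = {}"
      using division_ofD(5)[OF assms(2)] by (auto simp: p_def)
  qed
  have "inj_on (\<lambda>k. (Inf k, k)) d" by (auto simp: inj_on_def)
  then show ?thesis
    using additive_tagged_division_1[OF assms(1) p, of f] by (simp add: p_def sum.reindex)
qed

text \<open>
  For \<open>R\<close> a bound on the slope of a function over \<open>{u..v}\<close>, this says on which side of the
  bound the upper or lower limit of the slopes over intervals shrinking to \<open>x\<close> lies: a Dini
  derivative, with intervals that straddle the point.
\<close>

definition frequently_around :: "(real \<Rightarrow> real \<Rightarrow> bool) \<Rightarrow> real \<Rightarrow> bool" where
  "frequently_around R x \<longleftrightarrow> (\<forall>d>0. \<exists>u v. u < x \<and> x < v \<and> v - u < d \<and> R u v)"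

text \<open>
  The points straddled by an admissible interval shorter than \<open>d\<close> form a union of open
  intervals, so the set is a countable intersection of open sets.
\<close>

lemma frequently_around_borel: "{x. frequently_around R x} \<in> sets borel"
proof -
  define A where "A d = (\<Union>(u, v)\<in>{(u, v). v - u < d \<and> R u v}. {u<..<v::real})" for d
  have "open (A d)" for d unfolding A_def by (intro open_UN) auto
  moreover have "{x. frequently_around R x} = (\<Inter>n. A (inverse (real (Suc n))))"
  proof safe
    fix x n assume "frequently_around R x"
    then show "x \<in> A (inverse (real (Suc n)))"
      unfolding frequently_around_def A_def by (elim allE[of _ "inverse (real (Suc n))"]) auto
  next
    fix x assume x: "x \<in> (\<Inter>n. A (inverse (real (Suc n))))"
    show "frequently_around R x"
      unfolding frequently_around_def
    proof (intro allI impI)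
      fix d :: real assume "d > 0"
      then obtain n where n: "inverse (real (Suc n)) < d" using reals_Archimedean by blast
      have "x \<in> A (inverse (real (Suc n)))" using x by blast
      then obtain u v where "v - u < inverse (real (Suc n))" "R u v" "x \<in> {u<..<v}"
        unfolding A_def by blast
      then show "\<exists>u v. u < x \<and> x < v \<and> v - u < d \<and> R u v" using n by (intro exI[of _ u] exI[of _ v]) auto
    qed
  qed
  ultimately show ?thesis by auto
qed

text \<open>
  Completing \<open>L\<close> to divisions of the intervals of \<open>J\<close> adds a disjoint family of intervals of
  small total length, and the two sums differ exactly by the increments over this family.
\<close>

lemma abs_continuous_on_gaps:
  assumes AC: "abs_continuous_on {0..1} f" and "\<epsilon> > 0"
  obtains \<delta> where "\<delta> > 0"
    "\<forall>J L. finite J \<longrightarrow> pairwise disjnt J \<longrightarrow> (\<forall>k\<in>J. Inf k < Sup k \<and> k = {Inf k..Sup k} \<and> k \<subseteq> {0..1}) \<longrightarrow>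
       finite L \<longrightarrow> pairwise disjnt L \<longrightarrow> (\<forall>l\<in>L. Inf l < Sup l \<and> l = {Inf l..Sup l} \<and> (\<exists>k\<in>J. l \<subseteq> k)) \<longrightarrow>
       (\<Sum>k\<in>J. Sup k - Inf k) - (\<Sum>l\<in>L. Sup l - Inf l) < \<delta> \<longrightarrow>
       \<bar>(\<Sum>k\<in>J. f (Sup k) - f (Inf k)) - (\<Sum>l\<in>L. f (Sup l) - f (Inf l))\<bar> < \<epsilon>"
proof -
  obtain \<delta> where \<delta>: "\<delta> > 0"
    "\<forall>(T :: (real set \<times> real set) set) l r. finite T \<longrightarrow> (\<forall>i\<in>T. l i \<le> r i \<and> {l i..r i} \<subseteq> {0..1}) \<longrightarrow>
       (\<forall>i\<in>T. \<forall>j\<in>T. i \<noteq> j \<longrightarrow> {l i<..<r i} \<inter> {l j<..<r j} = {}) \<longrightarrow>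
       (\<Sum>i\<in>T. r i - l i) < \<delta> \<longrightarrow> (\<Sum>i\<in>T. \<bar>f (r i) - f (l i)\<bar>) < \<epsilon>"
    by (rule abs_continuous_on_indexed[OF assms, where ?'i = "real set \<times> real set"]) (rule that)
  show ?thesis
  proof (rule that[OF \<delta>(1)], intro allI impI)
    fix J L :: "real set set"
    assume J: "finite J" "pairwise disjnt J" "\<forall>k\<in>J. Inf k < Sup k \<and> k = {Inf k..Sup k} \<and> k \<subseteq> {0..1}"
      and L: "finite L" "pairwise disjnt L" "\<forall>l\<in>L. Inf l < Sup l \<and> l = {Inf l..Sup l} \<and> (\<exists>k\<in>J. l \<subseteq> k)"
      and small: "(\<Sum>k\<in>J. Sup k - Inf k) - (\<Sum>l\<in>L. Sup l - Inf l) < \<delta>"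
    define P where "P k = {l\<in>L. l \<subseteq> k}" for k
    have L': "l \<noteq> {}" if "l \<in> L" for l
    proof -
      obtain u v where "u < v" "l = {u..v}" using L(3) \<open>l \<in> L\<close> by blast
      then show ?thesis by simp
    qed
    have "\<exists>d. P k \<subseteq> d \<and> d division_of k" if k: "k \<in> J" for k
    proof -
      have "P k division_of \<Union>(P k)"
      proof (rule division_of_disjoint_intervals)
        show "finite (P k)" using L(1) by (simp add: P_def)
        show "pairwise disjnt (P k)" using L(2) by (rule pairwise_subset) (auto simp: P_def)
        show "Inf l < Sup l \<and> l = {Inf l..Sup l}" if "l \<in> P k" for l
          using L(3) that unfolding P_def by blast
      qed
      moreover have keq: "k = cbox (Inf k) (Sup k)" using k J(3) unfolding cbox_interval by blast
      then have "\<Union>(P k) \<subseteq> cbox (Inf k) (Sup k)" unfolding P_def by blast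
      ultimately obtain d where "P k \<subseteq> d" "d division_of cbox (Inf k) (Sup k)"
        by (rule partial_division_extend_interval)
      then show ?thesis unfolding keq[symmetric] by blast
    qed
    then have "\<forall>k\<in>J. \<exists>d. P k \<subseteq> d \<and> d division_of k" by blast
    then obtain D where "\<forall>k\<in>J. P k \<subseteq> D k \<and> D k division_of k"
      by (rule bchoice[THEN exE])
    then have D: "\<And>k. k \<in> J \<Longrightarrow> P k \<subseteq> D k" "\<And>k. k \<in> J \<Longrightarrow> D k division_of k"
      by blast+
    have finD: "finite (D k)" if "k \<in> J" for k using D(2)[OF that] by (rule division_ofD)
    have Luniq: "L = \<Union>(P ` J)" using L(3) by (auto simp: P_def)
    have disjP: "P k \<inter> P k' = {}" if "k \<in> J" "k' \<in> J" "k \<noteq> k'" for k k'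
    proof -
      have "k \<inter> k' = {}" using J(2) that by (auto simp: pairwise_def disjnt_def)
      then show ?thesis using L' by (fastforce simp: P_def)
    qed
    have sumL: "(\<Sum>l\<in>L. g l) = (\<Sum>k\<in>J. \<Sum>l\<in>P k. g l)" for g :: "real set \<Rightarrow> real"
      unfolding Luniq using J(1) L(1) disjP by (subst sum.UNION_disjoint) (auto simp: P_def)
    define T where "T = Sigma J (\<lambda>k. D k - P k)"
    have gap: "(\<Sum>k\<in>J. g (Sup k) - g (Inf k)) - (\<Sum>l\<in>L. g (Sup l) - g (Inf l)) =
        (\<Sum>i\<in>T. g (Sup (snd i)) - g (Inf (snd i)))" for g :: "real \<Rightarrow> real"
    proof -
      define w where "w l = g (Sup l) - g (Inf l)" for l
      have "w k = (\<Sum>l\<in>D k. w l)" if "k \<in> J" for k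
      proof -
        have k: "Inf k < Sup k" "{Inf k..Sup k} = k" using J(3) that by blast+
        then have "Inf k \<le> Sup k" "D k division_of {Inf k..Sup k}" using D(2)[OF that] by simp_all
        then show ?thesis unfolding w_def by (rule division_increment_sum[symmetric])
      qed
      then have "(\<Sum>k\<in>J. w k) - (\<Sum>l\<in>L. w l) = (\<Sum>k\<in>J. (\<Sum>l\<in>D k. w l) - (\<Sum>l\<in>P k. w l))"
        unfolding sumL sum_subtractf by simp
      also have "\<dots> = (\<Sum>k\<in>J. \<Sum>l\<in>D k - P k. w l)"
        using D(1) finD by (intro sum.cong refl sum_diff[symmetric]) auto
      also have "\<dots> = (\<Sum>i\<in>T. w (snd i))"
        unfolding T_def using J(1) finD by (subst sum.Sigma) (auto simp: case_prod_unfold)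
      finally show ?thesis unfolding w_def .
    qed
    have box: "\<exists>u v. u \<le> v \<and> l = {u..v} \<and> l \<subseteq> k" if kl: "k \<in> J" "l \<in> D k" for k l
    proof -
      note div = D(2)[OF kl(1)]
      obtain u v where "l = cbox u v" using division_ofD(4)[OF div kl(2)] by blast
      moreover have "l \<noteq> {}" "l \<subseteq> k" using division_ofD(2,3)[OF div kl(2)] by blast+
      ultimately show ?thesis by (intro exI[of _ u] exI[of _ v]) auto
    qed
    have "(\<Sum>i\<in>T. \<bar>f (Sup (snd i)) - f (Inf (snd i))\<bar>) < \<epsilon>"
    proof (rule \<delta>(2)[rule_format])
      show "finite T" using J(1) finD by (auto simp: T_def)
      show "(\<Sum>i\<in>T. Sup (snd i) - Inf (snd i)) < \<delta>" using small gap[of "\<lambda>x. x"] by simp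
    next
      fix i assume "i \<in> T"
      then obtain k l where i: "i = (k, l)" "k \<in> J" "l \<in> D k" by (auto simp: T_def)
      then obtain u v where uv: "u \<le> v" "l = {u..v}" "l \<subseteq> k" using box by blast
      have "k \<subseteq> {0..1}" using J(3) i by blast
      then have "l \<subseteq> {0..1}" using uv(3) by (rule subset_trans[rotated])
      then show "Inf (snd i) \<le> Sup (snd i) \<and> {Inf (snd i)..Sup (snd i)} \<subseteq> {0..1}"
        using uv i(1) by auto
    next
      fix i j assume "i \<in> T" "j \<in> T" "i \<noteq> j"
      moreover obtain k l where i0: "i = (k, l)" by (cases i)
      moreover obtain k' l' where j0: "j = (k', l')" by (cases j)
      ultimately have i: "i = (k, l)" "k \<in> J" "l \<in> D k"
        and j: "j = (k', l')" "k' \<in> J" "l' \<in> D k'" and ne: "(k, l) \<noteq> (k', l')" by (simp_all add: T_def)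
      obtain u v where uv: "u \<le> v" "l = {u..v}" "l \<subseteq> k" using box i by blast
      obtain u' v' where uv': "u' \<le> v'" "l' = {u'..v'}" "l' \<subseteq> k'" using box j by blast
      have "interior l \<inter> interior l' = {}"
      proof (cases "k = k'")
        case True
        then show ?thesis using division_ofD(5)[OF D(2)[of k]] i j ne by blast
      next
        case False
        then have "k \<inter> k' = {}" using J(2) i j by (auto simp: pairwise_def disjnt_def)
        then show ?thesis using uv uv' interior_subset by blast
      qed
      then show "{Inf (snd i)<..<Sup (snd i)} \<inter> {Inf (snd j)<..<Sup (snd j)} = {}"
        using uv uv' i j by simp
    qed
    then show "\<bar>(\<Sum>k\<in>J. f (Sup k) - f (Inf k)) - (\<Sum>l\<in>L. f (Sup l) - f (Inf l))\<bar> < \<epsilon>"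
      unfolding gap using sum_abs[of "\<lambda>i. f (Sup (snd i)) - f (Inf (snd i))" T] by linarith
  qed
qed

text \<open>
  Vitali's argument. Almost all of \<open>E\<close> is covered by disjoint intervals \<open>J\<close> of slope above \<open>q\<close>
  that stay in an open set barely larger than \<open>E\<close>, and almost all of that by disjoint intervals \<open>L\<close>
  of slope below \<open>p\<close> inside those of \<open>J\<close>. The total lengths of \<open>J\<close> and \<open>L\<close> are nearly equal, so by
  absolute continuity the total increments of \<open>f\<close> are nearly equal, too. One is at least
  \<open>q * \<bar>J\<bar>\<close>, the other at most \<open>p * \<bar>L\<bar>\<close>, which leaves no room for \<open>E\<close> to have positive measure.
\<close>

lemma abs_continuous_slopes_null:
  assumes AC: "abs_continuous_on {0..1} f" and pq: "p < q"
    and Elm: "E \<in> lmeasurable" and E01: "E \<subseteq> {0<..<1}"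
    and Q: "\<And>x. x \<in> E \<Longrightarrow> frequently_around (\<lambda>u v. q * (v - u) < f v - f u) x"
    and P: "\<And>x. x \<in> E \<Longrightarrow> frequently_around (\<lambda>u v. f v - f u < p * (v - u)) x"
  shows "measure lebesgue E = 0"
proof -
  have Es: "E \<in> sets lebesgue" using Elm by (rule fmeasurableD)
  define m where "m = measure lebesgue E"
  have "m \<le> 0"
  proof (rule ccontr)
    assume "\<not> m \<le> 0"
    then have m: "m > 0" by simp
    obtain \<delta> where \<delta>: "\<delta> > 0"
      "\<forall>J L. finite J \<longrightarrow> pairwise disjnt J \<longrightarrow> (\<forall>k\<in>J. Inf k < Sup k \<and> k = {Inf k..Sup k} \<and> k \<subseteq> {0..1}) \<longrightarrow>
       finite L \<longrightarrow> pairwise disjnt L \<longrightarrow> (\<forall>l\<in>L. Inf l < Sup l \<and> l = {Inf l..Sup l} \<and> (\<exists>k\<in>J. l \<subseteq> k)) \<longrightarrow>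
       (\<Sum>k\<in>J. Sup k - Inf k) - (\<Sum>l\<in>L. Sup l - Inf l) < \<delta> \<longrightarrow>
       \<bar>(\<Sum>k\<in>J. f (Sup k) - f (Inf k)) - (\<Sum>l\<in>L. f (Sup l) - f (Inf l))\<bar> < (q - p) * m / 4"
      by (rule abs_continuous_on_gaps[OF AC, of "(q - p) * m / 4"]) (use m pq in \<open>auto intro: that\<close>)
    \<comment> \<open>The three bounds leave \<open>L\<close> at least half of the measure \<open>m\<close> of \<open>E\<close>, keep the gap between \<open>J\<close> and
      \<open>L\<close> below \<open>\<delta>\<close>, and make the error \<open>\<bar>q\<bar> * (2 * \<eta>)\<close> of replacing \<open>\<bar>J\<bar>\<close> by \<open>\<bar>L\<bar>\<close> harmless.\<close>
    define \<eta> where "\<eta> = min (m / 6) (min (\<delta> / 3) ((q - p) * m / (8 * (\<bar>q\<bar> + 1))))"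
    have \<eta>: "\<eta> > 0" "\<eta> \<le> m / 6" "2 * \<eta> < \<delta>" "\<eta> \<le> (q - p) * m / (8 * (\<bar>q\<bar> + 1))"
    proof -
      have "(q - p) * m / (8 * (\<bar>q\<bar> + 1)) > 0" using m pq by simp
      then show "\<eta> > 0" using m \<delta>(1) by (simp add: \<eta>_def)
      have "\<eta> \<le> \<delta> / 3" unfolding \<eta>_def by linarith
      then show "2 * \<eta> < \<delta>" using \<delta>(1) by simp
      show "\<eta> \<le> m / 6" "\<eta> \<le> (q - p) * m / (8 * (\<bar>q\<bar> + 1))" unfolding \<eta>_def by linarith+
    qed
    obtain U0 where U0: "open U0" "E \<subseteq> U0" "U0 - E \<in> lmeasurable" "emeasure lebesgue (U0 - E) < ennreal \<eta>"
      using sets_lebesgue_outer_open[OF Es \<eta>(1)] by blast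
    define U where "U = U0 \<inter> {0<..<1}"
    have U: "open U" "E \<subseteq> U" using U0 E01 by (auto simp: U_def)
    have Um: "U - E \<in> lmeasurable" "measure lebesgue (U - E) < \<eta>"
    proof -
      have "U \<in> sets lebesgue" using U(1) by (metis borel_open sets_completionI_sets sets_lborel)
      then show 1: "U - E \<in> lmeasurable" using U0(3) Es
        by (intro fmeasurableI2[OF U0(3)]) (auto simp: U_def)
      have "measure lebesgue (U - E) \<le> measure lebesgue (U0 - E)"
        using 1 U0(3) by (intro measure_mono_fmeasurable) (auto simp: U_def fmeasurableD)
      also have "\<dots> < \<eta>" using U0(3,4) \<eta>(1)
        by (simp add: emeasure_eq_measure2 ennreal_less_iff)
      finally show "measure lebesgue (U - E) < \<eta>" .
    qed
    obtain J where J: "finite J" "pairwise disjnt J"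
      "\<And>k. k \<in> J \<Longrightarrow> Inf k < Sup k \<and> k = {Inf k..Sup k} \<and> k \<subseteq> U \<and> q * (Sup k - Inf k) < f (Sup k) - f (Inf k)"
      "measure lebesgue (E - \<Union>J) < \<eta>"
      by (rule Vitali_finite_intervals[OF Elm U(2,1) \<eta>(1), of "\<lambda>u v. q * (v - u) < f v - f u"])
        (use Q in \<open>auto simp: frequently_around_def intro: that\<close>)
    define W where "W = (\<Union>k\<in>J. {Inf k<..<Sup k})"
    have W: "open W" unfolding W_def by auto
    define E' where "E' = E \<inter> W"
    have E': "E' \<in> lmeasurable" "E' \<subseteq> W"
      using Elm W unfolding E'_def by (auto intro!: fmeasurable_Int_fmeasurable)
    obtain L where L: "finite L" "pairwise disjnt L"
      "\<And>l. l \<in> L \<Longrightarrow> Inf l < Sup l \<and> l = {Inf l..Sup l} \<and> l \<subseteq> W \<and>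
         (f (Sup l) - f (Inf l) < p * (Sup l - Inf l) \<and> (\<exists>k\<in>J. {Inf l..Sup l} \<subseteq> k))"
      "measure lebesgue (E' - \<Union>L) < \<eta>"
    proof (rule Vitali_finite_intervals[OF E' W \<eta>(1), of "\<lambda>u v. f v - f u < p * (v - u) \<and> (\<exists>k\<in>J. {u..v} \<subseteq> k)"])
      fix x d :: real assume x: "x \<in> E'" "d > 0"
      then obtain k where k: "k \<in> J" "x \<in> {Inf k<..<Sup k}" by (auto simp: E'_def W_def)
      have fr: "frequently_around (\<lambda>u v. f v - f u < p * (v - u)) x" using x P by (simp add: E'_def)
      define d' where "d' = min d (min (x - Inf k) (Sup k - x))"
      have "d' > 0" using x k by (simp add: d'_def)
      then obtain u v where uv: "u < x" "x < v" "v - u < d'" "f v - f u < p * (v - u)"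
        using fr unfolding frequently_around_def by blast
      have "{u..v} \<subseteq> {Inf k..Sup k}" using uv by (auto simp: d'_def)
      then have "{u..v} \<subseteq> k" using J(3)[OF k(1)] by blast
      then show "\<exists>u v. u < x \<and> x < v \<and> v - u < d \<and> f v - f u < p * (v - u) \<and> (\<exists>k\<in>J. {u..v} \<subseteq> k)"
        using uv k(1) by (intro exI[of _ u] exI[of _ v]) (auto simp: d'_def)
    qed (auto intro: that)
    have J': "\<Union>J \<in> lmeasurable" "measure lebesgue (\<Union>J) = (\<Sum>k\<in>J. Sup k - Inf k)"
      using J(3) by (intro measure_Union_intervals J; blast)+
    have L': "\<Union>L \<in> lmeasurable" "measure lebesgue (\<Union>L) = (\<Sum>k\<in>L. Sup k - Inf k)"
      using L(3) by (intro measure_Union_intervals L; blast)+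
    have Lk: "\<exists>k\<in>J. l \<subseteq> k" if "l \<in> L" for l using L(3)[OF that] by blast
    then have LJ: "\<Union>L \<subseteq> \<Union>J" by blast
    \<comment> \<open>The endpoints, which \<open>W\<close> leaves out of \<open>\<Union>J\<close>.\<close>
    define F where "F = (\<Union>k\<in>J. {Inf k, Sup k})"
    have F: "finite F" using J(1) by (simp add: F_def)
    have JU: "\<Union>J \<subseteq> U" using J(3) by blast
    have 1: "measure lebesgue (\<Union>J) - measure lebesgue (\<Union>L) < 2 * \<eta>"
    proof -
      have "x \<in> W \<union> F" if xJ: "x \<in> \<Union>J" for x
      proof -
        obtain k where k: "k \<in> J" "x \<in> k" using xJ by blast
        then have "x \<in> {Inf k..Sup k}" using J(3) by blast
        then show ?thesis using k(1) unfolding W_def F_def by force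
      qed
      then have "\<Union>J - \<Union>L \<subseteq> ((U - E) \<union> (E' - \<Union>L)) \<union> F"
        using JU unfolding E'_def by blast
      moreover have lm: "(U - E) \<in> lmeasurable" "(E' - \<Union>L) \<in> lmeasurable" "F \<in> lmeasurable"
        using Um E' L' F by (auto intro: fmeasurable.Diff lmeasurable_compact finite_imp_compact)
      ultimately have "measure lebesgue (\<Union>J - \<Union>L) \<le> measure lebesgue (((U - E) \<union> (E' - \<Union>L)) \<union> F)"
        using J' L' by (intro measure_mono_fmeasurable fmeasurable.Un) (auto intro: fmeasurableD)
      also have "\<dots> \<le> measure lebesgue ((U - E) \<union> (E' - \<Union>L)) + measure lebesgue F"
        using lm by (intro measure_Un_le) (auto intro: fmeasurableD)
      also have "measure lebesgue ((U - E) \<union> (E' - \<Union>L)) \<le> measure lebesgue (U - E) + measure lebesgue (E' - \<Union>L)"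
        using lm by (intro measure_Un_le) (auto intro: fmeasurableD)
      also have "measure lebesgue F = 0" using F by (intro negligible_imp_measure0 negligible_finite)
      finally have "measure lebesgue (\<Union>J - \<Union>L) < 2 * \<eta>" using Um(2) L(4) by linarith
      moreover have "measure lebesgue (\<Union>J - \<Union>L) = measure lebesgue (\<Union>J) - measure lebesgue (\<Union>L)"
        using J' L' LJ by (intro measurable_measure_Diff) (auto intro: fmeasurableD)
      ultimately show ?thesis by simp
    qed
    have 2: "m - \<eta> < measure lebesgue (\<Union>J)"
    proof -
      have "m \<le> measure lebesgue ((E - \<Union>J) \<union> \<Union>J)"
        unfolding m_def using Elm J' by (intro measure_mono_fmeasurable fmeasurable.Un fmeasurable.Diff) (auto intro: fmeasurableD)
      also have "\<dots> \<le> measure lebesgue (E - \<Union>J) + measure lebesgue (\<Union>J)"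
        using Elm J' by (intro measure_Un_le) (auto intro: fmeasurableD)
      finally show ?thesis using J(4) by simp
    qed
    have 3: "measure lebesgue (\<Union>L) \<le> measure lebesgue (\<Union>J)"
      using J' L' LJ by (intro measure_mono_fmeasurable) (auto intro: fmeasurableD)
    have "\<bar>(\<Sum>k\<in>J. f (Sup k) - f (Inf k)) - (\<Sum>l\<in>L. f (Sup l) - f (Inf l))\<bar> < (q - p) * m / 4"
    proof (rule \<delta>(2)[rule_format, OF J(1,2) _ L(1,2)])
      show "Inf k < Sup k \<and> k = {Inf k..Sup k} \<and> k \<subseteq> {0..1}" if "k \<in> J" for k
      proof -
        have "U \<subseteq> {0..1}" by (auto simp: U_def)
        then show ?thesis using J(3)[OF that] by blast
      qed
      show "Inf l < Sup l \<and> l = {Inf l..Sup l} \<and> (\<exists>k\<in>J. l \<subseteq> k)" if "l \<in> L" for l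
        using L(3)[OF that] Lk[OF that] by blast
      show "(\<Sum>k\<in>J. Sup k - Inf k) - (\<Sum>l\<in>L. Sup l - Inf l) < \<delta>"
        using 1 \<eta>(3) J' L' by linarith
    qed
    moreover have "q * measure lebesgue (\<Union>J) \<le> (\<Sum>k\<in>J. f (Sup k) - f (Inf k))"
      unfolding J'(2) sum_distrib_left by (rule sum_mono) (use J(3) in \<open>blast intro: less_imp_le\<close>)
    moreover have "(\<Sum>l\<in>L. f (Sup l) - f (Inf l)) \<le> p * measure lebesgue (\<Union>L)"
      unfolding L'(2) sum_distrib_left by (rule sum_mono) (use L(3) in \<open>blast intro: less_imp_le\<close>)
    ultimately have "q * measure lebesgue (\<Union>J) < p * measure lebesgue (\<Union>L) + (q - p) * m / 4" by linarith
    moreover have "- (\<bar>q\<bar> * (2 * \<eta>)) \<le> q * (measure lebesgue (\<Union>J) - measure lebesgue (\<Union>L))"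
    proof -
      have "\<bar>q * (measure lebesgue (\<Union>J) - measure lebesgue (\<Union>L))\<bar> \<le> \<bar>q\<bar> * (2 * \<eta>)"
        unfolding abs_mult using 1 3 by (intro mult_left_mono) auto
      then show ?thesis by linarith
    qed
    moreover have "\<bar>q\<bar> * (2 * \<eta>) \<le> (q - p) * m / 4"
    proof -
      have "\<bar>q\<bar> * (2 * \<eta>) \<le> 2 * ((\<bar>q\<bar> + 1) * \<eta>)" using \<eta>(1) by (simp add: algebra_simps)
      also have "(\<bar>q\<bar> + 1) * \<eta> \<le> (\<bar>q\<bar> + 1) * ((q - p) * m / (8 * (\<bar>q\<bar> + 1)))"
        using \<eta>(4) by (intro mult_left_mono) auto
      also have "\<dots> = (q - p) * m / 8" by (simp add: field_simps)
      finally show ?thesis by linarith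
    qed
    moreover have "(q - p) * m / 2 \<le> (q - p) * measure lebesgue (\<Union>L)"
      unfolding times_divide_eq_right[symmetric] using 1 2 \<eta>(2) pq by (intro mult_left_mono) auto
    moreover have False if "q * b < p * a + d / 4" "- c \<le> q * (b - a)" "c \<le> d / 4" "d / 2 \<le> (q - p) * a"
      for a b c d :: real using that by (simp add: algebra_simps)
    ultimately show False by blast
  qed
  then show ?thesis using measure_nonneg[of lebesgue E] unfolding m_def by linarith
qed

lemma abs_continuous_on_uminus: "abs_continuous_on S f \<Longrightarrow> abs_continuous_on S (\<lambda>x. - f x)"
  unfolding abs_continuous_on_def by (simp add: abs_minus_commute)

text \<open>
  Were \<open>E\<close> of positive measure, disjoint intervals of slope above \<open>2 / \<bar>E\<bar>\<close> covering half of it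
  would carry a total increment of at least \<open>1\<close>, whereas absolute continuity keeps the increment
  over short sets below \<open>1\<close>.
\<close>

lemma abs_continuous_infinite_slopes_null:
  assumes AC: "abs_continuous_on {0..1} f"
    and Elm: "E \<in> lmeasurable" and E01: "E \<subseteq> {0<..<1}"
    and Q: "\<And>x q. x \<in> E \<Longrightarrow> frequently_around (\<lambda>u v. q * (v - u) < f v - f u) x"
  shows "measure lebesgue E = 0"
proof -
  obtain \<delta> where \<delta>: "\<delta> > 0"
    "\<forall>(T :: real set set) l r. finite T \<longrightarrow> (\<forall>i\<in>T. l i \<le> r i \<and> {l i..r i} \<subseteq> {0..1}) \<longrightarrow>
       (\<forall>i\<in>T. \<forall>j\<in>T. i \<noteq> j \<longrightarrow> {l i<..<r i} \<inter> {l j<..<r j} = {}) \<longrightarrow>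
       (\<Sum>i\<in>T. r i - l i) < \<delta> \<longrightarrow> (\<Sum>i\<in>T. \<bar>f (r i) - f (l i)\<bar>) < 1"
    by (rule abs_continuous_on_indexed[OF AC zero_less_one, where ?'i = "real set"]) (rule that)
  \<comment> \<open>It suffices to look at pieces of \<open>E\<close> in intervals so short that \<open>f\<close> varies by less than \<open>1\<close> there.\<close>
  have piece: "measure lebesgue (E \<inter> {a<..<a + \<delta> / 2}) = 0" for a
  proof -
    define G where "G = E \<inter> {a<..<a + \<delta> / 2}"
    have G: "G \<in> lmeasurable" "G \<subseteq> {0<..<1} \<inter> {a<..<a + \<delta> / 2}"
      using Elm E01 by (auto simp: G_def intro!: fmeasurable_Int_fmeasurable)
    have "measure lebesgue G \<le> 0"
    proof (rule ccontr)
      assume "\<not> measure lebesgue G \<le> 0"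
      then have m: "measure lebesgue G > 0" by simp
      define q where "q = 2 / measure lebesgue G"
      have q: "q > 0" using m by (simp add: q_def)
      obtain J where J: "finite J" "pairwise disjnt J"
        "\<And>k. k \<in> J \<Longrightarrow> Inf k < Sup k \<and> k = {Inf k..Sup k} \<and> k \<subseteq> {0<..<1} \<inter> {a<..<a + \<delta> / 2} \<and>
           q * (Sup k - Inf k) < f (Sup k) - f (Inf k)"
        "measure lebesgue (G - \<Union>J) < measure lebesgue G / 2"
        by (rule Vitali_finite_intervals[OF G, of "measure lebesgue G / 2" "\<lambda>u v. q * (v - u) < f v - f u"])
          (use Q m in \<open>auto simp: frequently_around_def G_def intro: that\<close>)
      have J': "\<Union>J \<in> lmeasurable" "measure lebesgue (\<Union>J) = (\<Sum>k\<in>J. Sup k - Inf k)"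
        using J(3) by (intro measure_Union_intervals J; blast)+
      have "measure lebesgue G \<le> measure lebesgue ((G - \<Union>J) \<union> \<Union>J)"
        using G J' by (intro measure_mono_fmeasurable fmeasurable.Un fmeasurable.Diff) (auto intro: fmeasurableD)
      also have "\<dots> \<le> measure lebesgue (G - \<Union>J) + measure lebesgue (\<Union>J)"
        using G J' by (intro measure_Un_le) (auto intro: fmeasurableD)
      finally have "measure lebesgue G / 2 \<le> measure lebesgue (\<Union>J)" using J(4) by linarith
      then have "q * (measure lebesgue G / 2) \<le> q * measure lebesgue (\<Union>J)"
        using q by (intro mult_left_mono) auto
      then have "1 \<le> q * measure lebesgue (\<Union>J)" using m by (simp add: q_def)
      also have "\<dots> \<le> (\<Sum>k\<in>J. \<bar>f (Sup k) - f (Inf k)\<bar>)"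
        unfolding J'(2) sum_distrib_left
      proof (rule sum_mono)
        fix k assume "k \<in> J"
        then have "q * (Sup k - Inf k) < f (Sup k) - f (Inf k)" using J(3) by blast
        then show "q * (Sup k - Inf k) \<le> \<bar>f (Sup k) - f (Inf k)\<bar>" by linarith
      qed
      also have "\<dots> < 1"
      proof (rule \<delta>(2)[rule_format, OF J(1)])
        fix k assume "k \<in> J"
        then have "Inf k < Sup k" "k = {Inf k..Sup k}" "k \<subseteq> {0<..<1}" using J(3) by blast+
        moreover have "{0<..<1::real} \<subseteq> {0..1}" by auto
        ultimately show "Inf k \<le> Sup k \<and> {Inf k..Sup k} \<subseteq> {0..1}" by (metis less_imp_le subset_trans)
      next
        fix k l assume kl: "k \<in> J" "l \<in> J" "k \<noteq> l"
        then have "k \<inter> l = {}" using J(2) by (auto simp: pairwise_def disjnt_def)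
        moreover have "{Inf k..Sup k} = k" "{Inf l..Sup l} = l" using J(3) kl by blast+
        moreover have "{Inf k<..<Sup k} \<subseteq> {Inf k..Sup k}" "{Inf l<..<Sup l} \<subseteq> {Inf l..Sup l}" by auto
        ultimately show "{Inf k<..<Sup k} \<inter> {Inf l<..<Sup l} = {}" by blast
      next
        have "\<Union>J \<subseteq> {a<..<a + \<delta> / 2}" using J(3) by blast
        then have "measure lebesgue (\<Union>J) \<le> measure lebesgue {a<..<a + \<delta> / 2}"
          using J' by (intro measure_mono_fmeasurable) (auto intro: fmeasurableD)
        then show "(\<Sum>k\<in>J. Sup k - Inf k) < \<delta>" using J'(2) \<delta>(1) by simp
      qed
      finally show False by simp
    qed
    then show ?thesis using measure_nonneg[of lebesgue G] unfolding G_def by linarith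
  qed
  have neg: "negligible (E \<inter> {a<..<a + \<delta> / 2})" for a
    using piece[of a] Elm by (subst negligible_iff_measure) (auto intro!: fmeasurable_Int_fmeasurable)
  have "E \<subseteq> (\<Union>n::nat. E \<inter> {(real n - 1) * (\<delta> / 4)<..<(real n - 1) * (\<delta> / 4) + \<delta> / 2})"
  proof
    fix x assume x: "x \<in> E"
    then have "x > 0" using E01 by auto
    define n where "n = nat \<lfloor>x / (\<delta> / 4)\<rfloor>"
    have "real n = of_int \<lfloor>x / (\<delta> / 4)\<rfloor>" using \<open>x > 0\<close> \<delta>(1) by (simp add: n_def)
    then have "real n \<le> x / (\<delta> / 4)" "x / (\<delta> / 4) < real n + 1" by linarith+
    then have "real n * (\<delta> / 4) \<le> x" "x < (real n + 1) * (\<delta> / 4)"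
      using \<delta>(1) by (simp_all add: field_simps)
    then have "x \<in> {(real n - 1) * (\<delta> / 4)<..<(real n - 1) * (\<delta> / 4) + \<delta> / 2}"
    proof -
      have "(real n - 1) * (\<delta> / 4) = real n * (\<delta> / 4) - \<delta> / 4"
        "(real n + 1) * (\<delta> / 4) = real n * (\<delta> / 4) + \<delta> / 4" by (simp_all add: field_simps)
      then show ?thesis using \<delta>(1) \<open>real n * (\<delta> / 4) \<le> x\<close> \<open>x < (real n + 1) * (\<delta> / 4)\<close>
        unfolding greaterThanLessThan_iff by linarith
    qed
    then show "x \<in> (\<Union>n::nat. E \<inter> {(real n - 1) * (\<delta> / 4)<..<(real n - 1) * (\<delta> / 4) + \<delta> / 2})"
      using x by blast
  qed
  moreover have "negligible (\<Union>n::nat. E \<inter> {(real n - 1) * (\<delta> / 4)<..<(real n - 1) * (\<delta> / 4) + \<delta> / 2})"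
    using neg by (intro negligible_countable_Union) auto
  ultimately have "negligible E" by (rule negligible_subset[rotated])
  then show ?thesis by (rule negligible_imp_measure0)
qed

text \<open>
  Equivalent to having derivative \<open>L\<close> at \<open>x\<close>, but phrased with the intervals containing \<open>x\<close>: these
  are what the Vitali theorem provides, and what tagged divisions and dyadic cells call for.
\<close>

definition straddle_deriv :: "(real \<Rightarrow> real) \<Rightarrow> real \<Rightarrow> real \<Rightarrow> bool" where
  "straddle_deriv f x L \<longleftrightarrow> (\<forall>\<epsilon>>0. \<exists>d>0. \<forall>u v. u \<le> x \<longrightarrow> x \<le> v \<longrightarrow> v - u < d \<longrightarrow>
     \<bar>f v - f u - L * (v - u)\<bar> \<le> \<epsilon> * (v - u))"

text \<open>
  The derivative is the upper limit of the slopes over straddling intervals. A strictly smaller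
  lower limit would be separated from it by two rational numbers.
\<close>

lemma straddle_deriv_exists:
  assumes cont: "continuous_on {0<..<1} f" and x: "x \<in> {0<..<1}"
    and fin: "\<exists>q. \<not> frequently_around (\<lambda>u v. q * (v - u) < f v - f u) x"
      "\<exists>q. \<not> frequently_around (\<lambda>u v. f v - f u < q * (v - u)) x"
    and rat: "\<And>p q. p \<in> \<rat> \<Longrightarrow> q \<in> \<rat> \<Longrightarrow> p < q \<Longrightarrow> \<not> (frequently_around (\<lambda>u v. q * (v - u) < f v - f u) x \<and>
                frequently_around (\<lambda>u v. f v - f u < p * (v - u)) x)"
  shows "\<exists>L. straddle_deriv f x L"
proof -
  \<comment> \<open>The numbers that bound the slopes over short intervals from above, and from below.\<close>
  define S where "S = {q. \<not> frequently_around (\<lambda>u v. q * (v - u) < f v - f u) x}"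
  define S' where "S' = {q. \<not> frequently_around (\<lambda>u v. f v - f u < q * (v - u)) x}"
  define L where "L = Inf S"
  have up: "q' \<in> S" if "q \<in> S" "q \<le> q'" for q q'
  proof -
    obtain d where d: "d > 0" "\<And>u v. u < x \<Longrightarrow> x < v \<Longrightarrow> v - u < d \<Longrightarrow> f v - f u \<le> q * (v - u)"
      using \<open>q \<in> S\<close> unfolding S_def frequently_around_def mem_Collect_eq by (simp only: not_less[symmetric]) blast
    have "\<not> (u < x \<and> x < v \<and> v - u < d \<and> q' * (v - u) < f v - f u)" for u v
    proof
      assume *: "u < x \<and> x < v \<and> v - u < d \<and> q' * (v - u) < f v - f u"
      then have "q * (v - u) \<le> q' * (v - u)" using \<open>q \<le> q'\<close> by (intro mult_right_mono) auto
      then show False using d(2)[of u v] * by linarith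
    qed
    then show ?thesis using d(1) unfolding S_def frequently_around_def by blast
  qed
  have S: "S \<noteq> {}" "S' \<noteq> {}" using fin by (auto simp: S_def S'_def)
  have sep: "p \<le> q" if "p \<in> S'" "q \<in> S" for p q
  proof (rule ccontr)
    assume "\<not> p \<le> q"
    obtain d where d: "d > 0" "\<And>u v. u < x \<Longrightarrow> x < v \<Longrightarrow> v - u < d \<Longrightarrow> f v - f u \<le> q * (v - u)"
      using \<open>q \<in> S\<close> unfolding S_def frequently_around_def mem_Collect_eq by (simp only: not_less[symmetric]) blast
    obtain e where e: "e > 0" "\<And>u v. u < x \<Longrightarrow> x < v \<Longrightarrow> v - u < e \<Longrightarrow> p * (v - u) \<le> f v - f u"
      using \<open>p \<in> S'\<close> unfolding S'_def frequently_around_def mem_Collect_eq by (simp only: not_less[symmetric]) blast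
    define h where "h = min d e / 3"
    have h: "h > 0" "2 * h < d" "2 * h < e" using d e by (auto simp: h_def min_def)
    have "f (x + h) - f (x - h) \<le> q * (2 * h)" using d(2)[of "x - h" "x + h"] h by simp
    moreover have "p * (2 * h) \<le> f (x + h) - f (x - h)" using e(2)[of "x - h" "x + h"] h by simp
    ultimately have "p * (2 * h) \<le> q * (2 * h)" by (rule order_trans[rotated])
    then show False using h \<open>\<not> p \<le> q\<close> by simp
  qed
  obtain p0 where "p0 \<in> S'" using S(2) by blast
  then have bdd: "bdd_below S" using sep by (intro bdd_belowI[of S p0]) blast
  have upper: "q \<in> S" if "L < q" for q
  proof -
    obtain q0 where "q0 \<in> S" "q0 < q" using \<open>L < q\<close> cInf_less_iff[OF S(1) bdd] by (auto simp: L_def)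
    then show ?thesis using up by simp
  qed
  have lower: "p \<in> S'" if "p < L" for p
  proof -
    obtain p' where p': "p' \<in> \<rat>" "p < p'" "p' < L" using Rats_dense_in_real[OF \<open>p < L\<close>] by blast
    obtain q' where q': "q' \<in> \<rat>" "p' < q'" "q' < L" using Rats_dense_in_real[OF \<open>p' < L\<close>] by blast
    have "q' \<notin> S" using q'(3) cInf_lower[OF _ bdd, of q'] unfolding L_def by fastforce
    then have "p' \<in> S'" using rat[OF p'(1) q'(1,2)] by (auto simp: S_def S'_def)
    then obtain e where e: "e > 0" "\<And>u v. u < x \<Longrightarrow> x < v \<Longrightarrow> v - u < e \<Longrightarrow> p' * (v - u) \<le> f v - f u"
      unfolding S'_def frequently_around_def mem_Collect_eq by (simp only: not_less[symmetric]) blast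
    have "\<not> (u < x \<and> x < v \<and> v - u < e \<and> f v - f u < p * (v - u))" for u v
    proof
      assume *: "u < x \<and> x < v \<and> v - u < e \<and> f v - f u < p * (v - u)"
      then have "p * (v - u) \<le> p' * (v - u)" using p' by (intro mult_right_mono) auto
      then show False using e(2)[of u v] * by linarith
    qed
    then show ?thesis using e(1) unfolding S'_def frequently_around_def by blast
  qed
  have "straddle_deriv f x L"
    unfolding straddle_deriv_def
  proof (intro allI impI)
    fix \<epsilon> :: real assume \<epsilon>: "\<epsilon> > 0"
    have "L + \<epsilon> \<in> S" "L - \<epsilon> \<in> S'" using upper lower \<epsilon> by simp_all
    obtain d where d: "d > 0" "\<And>u v. u < x \<Longrightarrow> x < v \<Longrightarrow> v - u < d \<Longrightarrow> f v - f u \<le> (L + \<epsilon>) * (v - u)"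
      using \<open>L + \<epsilon> \<in> S\<close> unfolding S_def frequently_around_def mem_Collect_eq by (simp only: not_less[symmetric]) blast
    obtain e where e: "e > 0" "\<And>u v. u < x \<Longrightarrow> x < v \<Longrightarrow> v - u < e \<Longrightarrow> (L - \<epsilon>) * (v - u) \<le> f v - f u"
      using \<open>L - \<epsilon> \<in> S'\<close> unfolding S'_def frequently_around_def mem_Collect_eq by (simp only: not_less[symmetric]) blast
    define d' where "d' = min (min d e) (min x (1 - x))"
    have d': "d' > 0" "d' \<le> d" "d' \<le> e" "d' \<le> x" "d' \<le> 1 - x" using d(1) e(1) x by (auto simp: d'_def)
    have strict: "\<bar>f v - f u - L * (v - u)\<bar> \<le> \<epsilon> * (v - u)" if "u < x" "x < v" "v - u < d'" for u v
      using d(2)[of u v] e(2)[of u v] d' that by (auto simp: algebra_simps abs_le_iff)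
    show "\<exists>d>0. \<forall>u v. u \<le> x \<longrightarrow> x \<le> v \<longrightarrow> v - u < d \<longrightarrow> \<bar>f v - f u - L * (v - u)\<bar> \<le> \<epsilon> * (v - u)"
    proof (intro exI[of _ d'] conjI allI impI d'(1))
      fix u v assume uv: "u \<le> x" "x \<le> v" "v - u < d'"
      \<comment> \<open>Move both endpoints slightly outwards and use continuity.\<close>
      define U where "U n = u - (d' - (v - u)) / 3 / real (Suc n)" for n
      define V where "V n = v + (d' - (v - u)) / 3 / real (Suc n)" for n
      define c where "c = (d' - (v - u)) / 3"
      have c: "c > 0" "v - u = d' - 3 * c" using uv by (auto simp: c_def field_simps)
      have cn: "0 < c / real (Suc n)" "c / real (Suc n) \<le> c" for n
        using c(1) by (auto simp: field_simps)
      have UV: "U n < x" "x < V n" "V n - U n < d'" for n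
        using cn[of n] uv c unfolding U_def V_def c_def[symmetric] by linarith+
      have lim0: "(\<lambda>n. c / real (Suc n)) \<longlonglongrightarrow> 0"
        using tendsto_mult_left[OF LIMSEQ_inverse_real_of_nat, of c] by (simp add: divide_inverse)
      have U: "U \<longlonglongrightarrow> u" unfolding U_def c_def[symmetric] using tendsto_diff[OF tendsto_const lim0] by simp
      have V: "V \<longlonglongrightarrow> v" unfolding V_def c_def[symmetric] using tendsto_add[OF tendsto_const lim0] by simp
      have iu: "isCont f u" "isCont f v"
        using cont uv d' x by (auto intro!: continuous_on_interior[OF cont])
      have "(\<lambda>n. \<bar>f (V n) - f (U n) - L * (V n - U n)\<bar>) \<longlonglongrightarrow> \<bar>f v - f u - L * (v - u)\<bar>"
        using U V isCont_tendsto_compose[OF iu(1) U] isCont_tendsto_compose[OF iu(2) V] by (intro tendsto_intros)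
      moreover have "(\<lambda>n. \<epsilon> * (V n - U n)) \<longlonglongrightarrow> \<epsilon> * (v - u)" using U V by (intro tendsto_intros)
      ultimately show "\<bar>f v - f u - L * (v - u)\<bar> \<le> \<epsilon> * (v - u)"
        using strict[OF UV] by (intro LIMSEQ_le) auto
    qed
  qed
  then show ?thesis by blast
qed

lemma frequently_around_lmeasurable:
  "{x\<in>{0<..<1}. frequently_around R x} \<in> lmeasurable"
proof -
  have "{x\<in>{0<..<1}. frequently_around R x} = {0<..<1} \<inter> {x. frequently_around R x}" by auto
  then show ?thesis using frequently_around_borel[of R]
    by (simp only:) (intro fmeasurable_Int_fmeasurable, auto)
qed

lemma frequently_around_mono:
  assumes "frequently_around R x" "\<And>u v. u < v \<Longrightarrow> R u v \<Longrightarrow> R' u v"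
  shows "frequently_around R' x"
  using assms unfolding frequently_around_def by (meson less_trans)

lemma straddle_deriv_imp_DERIV:
  assumes "straddle_deriv f x L" shows "(f has_field_derivative L) (at x)"
  unfolding DERIV_def LIM_def
proof (intro allI impI)
  fix \<epsilon> :: real assume "\<epsilon> > 0"
  then obtain d where d: "d > 0" "\<And>u v. u \<le> x \<Longrightarrow> x \<le> v \<Longrightarrow> v - u < d \<Longrightarrow> \<bar>f v - f u - L * (v - u)\<bar> \<le> \<epsilon> / 2 * (v - u)"
    using assms unfolding straddle_deriv_def by (meson half_gt_zero)
  have "\<bar>(f (x + h) - f x) / h - L\<bar> \<le> \<epsilon> / 2" if h: "h \<noteq> 0" "\<bar>h\<bar> < d" for h
  proof -
    have "\<bar>f (x + h) - f x - L * h\<bar> \<le> \<epsilon> / 2 * \<bar>h\<bar>"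
    proof (cases "h > 0")
      case True then show ?thesis using d(2)[of x "x + h"] h by simp
    next
      case False
      then have "\<bar>f x - f (x + h) - L * (- h)\<bar> \<le> \<epsilon> / 2 * (- h)" using d(2)[of "x + h" x] h by simp
      moreover have "\<bar>f (x + h) - f x - L * h\<bar> = \<bar>f x - f (x + h) - L * (- h)\<bar>" by simp
      ultimately show ?thesis using False by simp
    qed
    moreover have "(f (x + h) - f x) / h - L = (f (x + h) - f x - L * h) / h" using h by (simp add: field_simps)
    ultimately show ?thesis using h by (simp add: divide_le_eq)
  qed
  then show "\<exists>s>0. \<forall>h. h \<noteq> 0 \<and> dist h 0 < s \<longrightarrow> dist ((f (x + h) - f x) / h) L < \<epsilon>"
    using d(1) \<open>\<epsilon> > 0\<close> by (intro exI[of _ d]) (force simp: dist_real_def)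
qed

text \<open>
  The exceptional points form a countable union of null sets: one for each pair of rational
  numbers separating the extreme slopes, and those where the slopes of \<open>f\<close> or of \<open>- f\<close> are
  unbounded.
\<close>

theorem abs_continuous_differentiable_ae:
  assumes AC: "abs_continuous_on {0..1} f"
  obtains N where "negligible N" "\<And>x. x \<in> {0<..<1} - N \<Longrightarrow> straddle_deriv f x (deriv f x)"
proof -
  define E where "E = (\<lambda>(p, q). {x\<in>{0<..<1}. frequently_around (\<lambda>u v. q * (v - u) < f v - f u) x} \<inter>
       {x\<in>{0<..<1}. frequently_around (\<lambda>u v. f v - f u < p * (v - u)) x})"
  define PQ where "PQ = {(p, q) \<in> \<rat> \<times> \<rat>. p < (q::real)}"
  define I where "I g = (\<Inter>n. {x\<in>{0<..<1}. frequently_around (\<lambda>u v. real n * (v - u) < g v - g u) x})"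
    for g :: "real \<Rightarrow> real"
  define N where "N = \<Union>(E ` PQ) \<union> (I f \<union> I (\<lambda>x. - f x))"
  have "negligible (E i)" if "i \<in> PQ" for i
  proof -
    obtain p q where i: "i = (p, q)" "p < q" using \<open>i \<in> PQ\<close> by (auto simp: PQ_def)
    have "E i \<in> lmeasurable" unfolding E_def i prod.case
      using frequently_around_lmeasurable by (intro fmeasurable.Int) auto
    moreover have "measure lebesgue (E i) = 0"
      by (rule abs_continuous_slopes_null[OF AC i(2) \<open>E i \<in> lmeasurable\<close>]) (auto simp: E_def i)
    ultimately show ?thesis by (simp add: negligible_iff_measure)
  qed
  moreover have "countable PQ" unfolding PQ_def
    by (rule countable_subset[of _ "\<rat> \<times> \<rat>"]) (auto intro: countable_SIGMA countable_rat)
  moreover have "negligible (I g)" if g: "abs_continuous_on {0..1} g" for g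
  proof -
    have "{x\<in>{0<..<1}. frequently_around (\<lambda>u v. real n * (v - u) < g v - g u) x} \<in> sets lebesgue" for n
      using frequently_around_lmeasurable by (rule fmeasurableD)
    then have "I g \<in> sets lebesgue" unfolding I_def by (intro sets.countable_INT) auto
    then have Im: "I g \<in> lmeasurable"
      by (rule fmeasurableI2[of "{0<..<1}", rotated 2]) (auto simp: I_def)
    have "measure lebesgue (I g) = 0"
    proof (rule abs_continuous_infinite_slopes_null[OF g Im])
      show "I g \<subseteq> {0<..<1}" by (auto simp: I_def)
      fix x q assume x: "x \<in> I g"
      obtain n where n: "q \<le> real n" using real_arch_simple by blast
      have "frequently_around (\<lambda>u v. real n * (v - u) < g v - g u) x" using x by (auto simp: I_def)
      then show "frequently_around (\<lambda>u v. q * (v - u) < g v - g u) x"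
      proof (rule frequently_around_mono)
        fix u v :: real assume "u < v" "real n * (v - u) < g v - g u"
        moreover have "q * (v - u) \<le> real n * (v - u)" using n \<open>u < v\<close> by (intro mult_right_mono) auto
        ultimately show "q * (v - u) < g v - g u" by linarith
      qed
    qed
    then show ?thesis using Im by (simp add: negligible_iff_measure)
  qed
  ultimately have "negligible N" unfolding N_def
    using AC abs_continuous_on_uminus[OF AC]
    by (intro negligible_Un negligible_countable_Union) auto
  moreover have "straddle_deriv f x (deriv f x)" if x: "x \<in> {0<..<1} - N" for x
  proof -
    have "\<exists>L. straddle_deriv f x L"
    proof (rule straddle_deriv_exists)
      show "continuous_on {0<..<1} f"
        by (rule continuous_on_subset[OF abs_continuous_on_imp_continuous_on[OF AC]]) auto
      show "x \<in> {0<..<1}" using x by blast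
      have "x \<notin> I f" "x \<notin> I (\<lambda>x. - f x)" using x by (auto simp: N_def)
      then obtain n m where n: "\<not> frequently_around (\<lambda>u v. real n * (v - u) < f v - f u) x"
        and m: "\<not> frequently_around (\<lambda>u v. real m * (v - u) < (- f v) - (- f u)) x"
        using x unfolding I_def by blast
      show "\<exists>q. \<not> frequently_around (\<lambda>u v. q * (v - u) < f v - f u) x" using n by blast
      have "\<not> frequently_around (\<lambda>u v. f v - f u < (- real m) * (v - u)) x"
        using m by (rule contrapos_nn) (erule frequently_around_mono, simp)
      then show "\<exists>q. \<not> frequently_around (\<lambda>u v. f v - f u < q * (v - u)) x" by blast
    next
      fix p q :: real assume "p \<in> \<rat>" "q \<in> \<rat>" "p < q"
      then have "(p, q) \<in> PQ" by (simp add: PQ_def)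
      then have "x \<notin> E (p, q)" using x by (auto simp: N_def)
      then show "\<not> (frequently_around (\<lambda>u v. q * (v - u) < f v - f u) x \<and>
                frequently_around (\<lambda>u v. f v - f u < p * (v - u)) x)"
        using x by (simp add: E_def)
    qed
    then obtain L where L: "straddle_deriv f x L" by blast
    then have "deriv f x = L" by (intro DERIV_imp_deriv straddle_deriv_imp_DERIV)
    then show ?thesis using L by simp
  qed
  ultimately show ?thesis by (rule that)
qed

text \<open>
  The fundamental theorem of calculus becomes elementary for the gauge integral. At points of
  differentiability the gauge is chosen so that derivative times length approximates the
  increment of \<open>f\<close>. At the points of the exceptional null set the gauge is an open set so small
  that absolute continuity makes all increments over intervals tagged there negligible.
\<close>

theorem abs_continuous_deriv_has_integral:
  assumes AC: "abs_continuous_on {0..1} f" and ab: "0 \<le> a" "a \<le> b" "b \<le> 1"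
  shows "(deriv f has_integral (f b - f a)) {a..b}"
proof -
  obtain N0 where N0: "negligible N0" "\<And>x. x \<in> {0<..<1} - N0 \<Longrightarrow> straddle_deriv f x (deriv f x)"
    by (rule abs_continuous_differentiable_ae[OF AC]) (rule that)
  define N where "N = N0 \<union> {0, 1}"
  have N: "negligible N" using N0(1) by (auto simp: N_def intro: negligible_Un)
  have sd: "straddle_deriv f x (deriv f x)" if "x \<in> {a..b} - N" for x
    using N0(2)[of x] that ab by (auto simp: N_def)
  define g where "g x = (if x \<in> N then 0 else deriv f x)" for x
  have "(g has_integral (f b - f a)) (cbox a b)"
    unfolding has_integral
  proof (intro allI impI)
    fix e :: real assume e: "e > 0"
    obtain \<delta> where \<delta>: "\<delta> > 0"
      "\<forall>(T :: (real \<times> real set) set) l r. finite T \<longrightarrow> (\<forall>i\<in>T. l i \<le> r i \<and> {l i..r i} \<subseteq> {0..1}) \<longrightarrow>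
       (\<forall>i\<in>T. \<forall>j\<in>T. i \<noteq> j \<longrightarrow> {l i<..<r i} \<inter> {l j<..<r j} = {}) \<longrightarrow>
       (\<Sum>i\<in>T. r i - l i) < \<delta> \<longrightarrow> (\<Sum>i\<in>T. \<bar>f (r i) - f (l i)\<bar>) < e / 2"
      by (rule abs_continuous_on_indexed[OF AC half_gt_zero[OF e], where ?'i = "real \<times> real set"]) (rule that)
    obtain U where U: "open U" "N \<subseteq> U" "U - N \<in> lmeasurable" "emeasure lebesgue (U - N) < ennreal \<delta>"
      using sets_lebesgue_outer_open[OF negligible_imp_sets[OF N] \<delta>(1)] by blast
    have Ulm: "U \<in> lmeasurable" "measure lebesgue U < \<delta>"
    proof -
      have "(U - N) \<union> N \<in> lmeasurable" by (rule fmeasurable.Un[OF U(3) negligible_imp_measurable[OF N]])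
      moreover have "(U - N) \<union> N = U" using U(2) by blast
      ultimately have *: "U \<in> lmeasurable" by simp
      have "measure lebesgue U = measure lebesgue (U - N)"
      proof (rule measure_negligible_symdiff[OF U(3)])
        show "negligible (U - N - U \<union> (U - (U - N)))" by (rule negligible_subset[OF N]) auto
      qed
      then show "U \<in> lmeasurable" "measure lebesgue U < \<delta>"
        using U(3,4) \<delta>(1) * by (auto simp: emeasure_eq_measure2 ennreal_less_iff)
    qed
    define \<epsilon> where "\<epsilon> = e / (2 * (b - a + 1))"
    have \<epsilon>: "\<epsilon> > 0" "\<epsilon> * (b - a) \<le> e / 2" using e ab by (auto simp: \<epsilon>_def field_simps)
    have "\<exists>d>0. x \<in> {a..b} - N \<longrightarrow> (\<forall>u v. u \<le> x \<longrightarrow> x \<le> v \<longrightarrow> v - u < d \<longrightarrow>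
       \<bar>f v - f u - deriv f x * (v - u)\<bar> \<le> \<epsilon> * (v - u))" for x
      using sd[of x] \<epsilon>(1) zero_less_one unfolding straddle_deriv_def by blast
    then obtain d where d: "\<And>x. d x > 0" "\<And>x u v. x \<in> {a..b} - N \<Longrightarrow> u \<le> x \<Longrightarrow> x \<le> v \<Longrightarrow> v - u < d x \<Longrightarrow>
       \<bar>f v - f u - deriv f x * (v - u)\<bar> \<le> \<epsilon> * (v - u)" by metis
    define \<gamma> where "\<gamma> x = (if x \<in> N then U else ball x (d x / 2))" for x
    have "gauge \<gamma>" using U d(1) by (auto simp: gauge_def \<gamma>_def)
    moreover have "norm ((\<Sum>(x, k)\<in>p. measure lborel k *\<^sub>R g x) - (f b - f a)) < e"
      if p: "p tagged_division_of cbox a b" "\<gamma> fine p" for p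
    proof -
      have pD: "\<exists>u v. u \<le> x \<and> x \<le> v \<and> k = {u..v} \<and> a \<le> u \<and> v \<le> b \<and> k \<subseteq> \<gamma> x" if xk: "(x, k) \<in> p" for x k
      proof -
        obtain u v where "k = cbox u v" using tagged_division_ofD(4)[OF p(1) xk] by blast
        moreover have "x \<in> k" "k \<subseteq> {a..b}" using tagged_division_ofD(2,3)[OF p(1) xk] by auto
        moreover have "k \<subseteq> \<gamma> x" using fineD[OF p(2) xk] .
        ultimately show ?thesis by (intro exI[of _ u] exI[of _ v]) auto
      qed
      have finp: "finite p" using p(1) by blast
      define w where "w = (\<lambda>(x, k). measure lborel k *\<^sub>R g x - (f (Sup k) - f (Inf k)))"
      have "(\<Sum>(x, k)\<in>p. f (Sup k) - f (Inf k)) = f b - f a"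
        using additive_tagged_division_1[OF ab(2), of p f] p(1) by simp
      then have eq: "(\<Sum>(x, k)\<in>p. measure lborel k *\<^sub>R g x) - (f b - f a) = sum w p"
        by (simp add: w_def case_prod_unfold sum_subtractf)
      define pN where "pN = {(x, k)\<in>p. x \<in> N}"
      have pN: "pN \<subseteq> p" "finite pN" using finp by (auto simp: pN_def intro: finite_subset)
      have good: "\<bar>w i\<bar> \<le> \<epsilon> * (Sup (snd i) - Inf (snd i))" if i: "i \<in> p - pN" for i
      proof -
        obtain x k where xk: "i = (x, k)" by (cases i)
        then have xk': "(x, k) \<in> p" "x \<notin> N" using i by (auto simp: pN_def)
        obtain u v where uv: "u \<le> x" "x \<le> v" "k = {u..v}" "a \<le> u" "v \<le> b" "k \<subseteq> ball x (d x / 2)"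
          using pD[OF xk'(1)] xk'(2) by (auto simp: \<gamma>_def)
        have "u \<in> k" "v \<in> k" using uv(1-3) by auto
        then have "u \<in> ball x (d x / 2)" "v \<in> ball x (d x / 2)" using uv(6) by blast+
        then have "\<bar>x - u\<bar> < d x / 2" "\<bar>x - v\<bar> < d x / 2" by (simp_all add: dist_real_def)
        then have "v - u < d x" by linarith
        then have "\<bar>f v - f u - deriv f x * (v - u)\<bar> \<le> \<epsilon> * (v - u)"
          using uv xk' by (intro d(2)) auto
        then show ?thesis using uv xk'(2) by (simp add: w_def xk g_def abs_minus_commute mult.commute)
      qed
      have "\<bar>sum w (p - pN)\<bar> \<le> (\<Sum>i\<in>p - pN. \<epsilon> * (Sup (snd i) - Inf (snd i)))"
        using good by (intro order_trans[OF sum_abs sum_mono])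
      also have "\<dots> \<le> (\<Sum>i\<in>p. \<epsilon> * (Sup (snd i) - Inf (snd i)))"
      proof (rule sum_mono2[OF finp])
        fix i assume "i \<in> p - (p - pN)"
        then obtain x k where i: "i = (x, k)" "(x, k) \<in> p" by (cases i) auto
        then obtain u v where "u \<le> x" "x \<le> v" "k = {u..v}" using pD by blast
        then show "0 \<le> \<epsilon> * (Sup (snd i) - Inf (snd i))" using i \<epsilon>(1) by simp
      qed auto
      also have "\<dots> = \<epsilon> * (b - a)"
        using additive_tagged_division_1[OF ab(2), of p "\<lambda>x. x"] p(1)
        by (simp add: sum_distrib_left[symmetric] case_prod_unfold)
      finally have 1: "\<bar>sum w (p - pN)\<bar> \<le> e / 2" using \<epsilon>(2) by simp
      have box: "\<exists>u v. u \<le> v \<and> snd i = {u..v} \<and> snd i \<subseteq> U \<and> {u..v} \<subseteq> {0..1}" if i: "i \<in> pN" for i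
      proof -
        obtain x k where xk: "i = (x, k)" "(x, k) \<in> p" "x \<in> N" using i by (auto simp: pN_def)
        then obtain u v where "u \<le> x" "x \<le> v" "k = {u..v}" "a \<le> u" "v \<le> b" "k \<subseteq> \<gamma> x" using pD by blast
        then show ?thesis using xk ab by (intro exI[of _ u] exI[of _ v]) (auto simp: \<gamma>_def)
      qed
      have lr: "Inf (snd i) \<le> Sup (snd i)" "snd i = {Inf (snd i)..Sup (snd i)}" "snd i \<subseteq> U" "snd i \<subseteq> {0..1}"
        "interior (snd i) = {Inf (snd i)<..<Sup (snd i)}" if i: "i \<in> pN" for i
        using box[OF i] by auto
      have disj: "{Inf (snd i)<..<Sup (snd i)} \<inter> {Inf (snd j)<..<Sup (snd j)} = {}"
        if ij: "i \<in> pN" "j \<in> pN" "i \<noteq> j" for i j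
      proof -
        have "i \<in> p" "j \<in> p" using ij pN by auto
        then have "interior (snd i) \<inter> interior (snd j) = {}"
          using tagged_division_ofD(5)[OF p(1), of "fst i" "snd i" "fst j" "snd j"] ij(3) by auto
        then show ?thesis using lr(5) ij by simp
      qed
      have "(\<Sum>i\<in>pN. Sup (snd i) - Inf (snd i)) = (\<Sum>i\<in>pN. measure lebesgue {Inf (snd i)<..<Sup (snd i)})"
        using lr(1) by (intro sum.cong) auto
      also have "\<dots> = measure lebesgue (\<Union>i\<in>pN. {Inf (snd i)<..<Sup (snd i)})"
        using pN(2) disj lr(1) by (intro measure_finite_Union[symmetric]) (auto simp: disjoint_family_on_def)
      also have "\<dots> \<le> measure lebesgue U"
      proof (rule measure_mono_fmeasurable)
        have "{Inf (snd i)<..<Sup (snd i)} \<subseteq> U" if i: "i \<in> pN" for i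
          using lr(3)[OF i] interior_subset[of "snd i"] unfolding lr(5)[OF i] by (rule subset_trans[rotated])
        then show "(\<Union>i\<in>pN. {Inf (snd i)<..<Sup (snd i)}) \<subseteq> U" by blast
        show "(\<Union>i\<in>pN. {Inf (snd i)<..<Sup (snd i)}) \<in> sets lebesgue" using pN(2) by (intro sets.finite_UN) auto
      qed (rule Ulm)
      also have "\<dots> < \<delta>" by (rule Ulm)
      finally have small: "(\<Sum>i\<in>pN. Sup (snd i) - Inf (snd i)) < \<delta>" .
      have "(\<Sum>i\<in>pN. \<bar>f (Sup (snd i)) - f (Inf (snd i))\<bar>) < e / 2"
      proof (rule \<delta>(2)[rule_format, OF pN(2) _ _ small])
        show "Inf (snd i) \<le> Sup (snd i) \<and> {Inf (snd i)..Sup (snd i)} \<subseteq> {0..1}" if "i \<in> pN" for i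
          using lr(1)[OF that] lr(2)[OF that, symmetric] lr(4)[OF that] by simp
      qed (rule disj)
      moreover have "\<bar>sum w pN\<bar> \<le> (\<Sum>i\<in>pN. \<bar>f (Sup (snd i)) - f (Inf (snd i))\<bar>)"
        by (intro order_trans[OF sum_abs sum_mono]) (auto simp: pN_def w_def g_def)
      ultimately have 2: "\<bar>sum w pN\<bar> < e / 2" by linarith
      have "sum w p = sum w (p - pN) + sum w pN" using sum.subset_diff[OF pN(1) finp] .
      then show ?thesis unfolding eq using 1 2 by simp
    qed
    ultimately show "\<exists>\<gamma>. gauge \<gamma> \<and> (\<forall>p. p tagged_division_of cbox a b \<and> \<gamma> fine p \<longrightarrow>
        norm ((\<Sum>(x, k)\<in>p. measure lborel k *\<^sub>R g x) - (f b - f a)) < e)" by (intro exI[of _ \<gamma>]) simp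
  qed
  then have "(g has_integral (f b - f a)) {a..b}" by simp
  then show ?thesis by (rule has_integral_spike[OF N, rotated]) (simp add: g_def)
qed

text \<open>
  If \<open>f\<close> has mean slope \<open>k\<close> on an interval of length \<open>h\<close>, then integrating the tangent inequality
  \<open>2 * k * f' - k\<^sup>2 \<le> f'\<^sup>2\<close> over that interval gives \<open>k\<^sup>2 * h\<close> on the left, which is the summand.
\<close>

lemma Riesz_sum_le_energy:
  fixes l r :: "'i \<Rightarrow> real"
  assumes AC: "abs_continuous_on {0..1} f" and c: "energy f \<le> ennreal c" "0 \<le> c"
    and T: "finite T" "\<And>i. i \<in> T \<Longrightarrow> 0 \<le> l i \<and> l i < r i \<and> r i \<le> 1"
      "\<And>i j. i \<in> T \<Longrightarrow> j \<in> T \<Longrightarrow> i \<noteq> j \<Longrightarrow> {l i<..<r i} \<inter> {l j<..<r j} = {}"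
  shows "(\<Sum>i\<in>T. (f (r i) - f (l i))\<^sup>2 / (r i - l i)) \<le> c"
proof -
  let ?g = "deriv f" and ?M = "lebesgue_on {0..1::real}"
  have g01: "?g \<in> borel_measurable ?M"
    using abs_continuous_deriv_has_integral[OF AC, of 0 1]
    by (intro integrable_imp_measurable) (auto simp: integrable_on_def)
  have nn: "energy f = (\<integral>\<^sup>+x. ennreal ((?g x)\<^sup>2) \<partial>?M)"
    unfolding energy_def by (subst nn_integral_restrict_space) auto
  have int: "integrable ?M (\<lambda>x. (?g x)\<^sup>2)"
  proof (rule integrableI_bounded)
    show "(\<lambda>x. (?g x)\<^sup>2) \<in> borel_measurable ?M" using g01 by measurable
    show "(\<integral>\<^sup>+x. ennreal (norm ((?g x)\<^sup>2)) \<partial>?M) < \<infinity>"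
      using c nn by (simp add: order.strict_trans1)
  qed
  define A where "A = integral\<^sup>L ?M (\<lambda>x. (?g x)\<^sup>2)"
  have A: "((\<lambda>x. (?g x)\<^sup>2) has_integral A) {0..1}"
    unfolding A_def by (intro has_integral_integral_lebesgue_on int) auto
  have "ennreal A = energy f" unfolding nn A_def using int by (intro nn_integral_eq_integral[symmetric]) auto
  then have "A \<le> c" using c by (metis ennreal_le_iff)
  define k where "k i = (f (r i) - f (l i)) / (r i - l i)" for i
  define h where "h i x = (if x \<in> {l i<..<r i} then 2 * k i * ?g x - (k i)\<^sup>2 else 0)" for i x
  have h: "(h i has_integral (f (r i) - f (l i))\<^sup>2 / (r i - l i)) {0..1}" if i: "i \<in> T" for i
  proof -
    note li = T(2)[OF i]
    have "(?g has_integral (f (r i) - f (l i))) {l i..r i}"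
      using li by (intro abs_continuous_deriv_has_integral[OF AC]) auto
    then have "((\<lambda>x. 2 * k i * ?g x - (k i)\<^sup>2) has_integral (2 * k i * (f (r i) - f (l i)) - (k i)\<^sup>2 * (r i - l i))) {l i..r i}"
      using has_integral_const_real[of "(k i)\<^sup>2" "l i" "r i"] li
      by (intro has_integral_diff has_integral_mult_right) (auto simp: mult.commute)
    also have "2 * k i * (f (r i) - f (l i)) - (k i)\<^sup>2 * (r i - l i) = (f (r i) - f (l i))\<^sup>2 / (r i - l i)"
      using li by (simp add: k_def power2_eq_square divide_simps)
    finally have "((\<lambda>x. 2 * k i * ?g x - (k i)\<^sup>2) has_integral (f (r i) - f (l i))\<^sup>2 / (r i - l i)) {l i<..<r i}"
      by (simp add: has_integral_Icc_iff_Ioo)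
    moreover have "{l i<..<r i} \<subseteq> {0..1}" using li by auto
    ultimately show ?thesis unfolding h_def by (subst has_integral_restrict)
  qed
  have hs: "((\<lambda>x. \<Sum>i\<in>T. h i x) has_integral (\<Sum>i\<in>T. (f (r i) - f (l i))\<^sup>2 / (r i - l i))) {0..1}"
    using T(1) h by (rule has_integral_sum)
  have hg: "(\<Sum>i\<in>T. h i x) \<le> (?g x)\<^sup>2" for x
  proof (cases "\<exists>i\<in>T. x \<in> {l i<..<r i}")
    case True
    then obtain i where i: "i \<in> T" "x \<in> {l i<..<r i}" by blast
    have "h j x = 0" if "j \<in> T - {i}" for j
    proof -
      have "x \<notin> {l j<..<r j}" using T(3)[of i j] i that by blast
      then show ?thesis by (auto simp: h_def)
    qed
    then have "(\<Sum>i\<in>T. h i x) = h i x" using i(1) T(1) by (simp add: sum.remove)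
    also have "\<dots> \<le> (?g x)\<^sup>2"
      using i(2) zero_le_power2[of "?g x - k i"] by (simp add: h_def power2_eq_square algebra_simps)
    finally show ?thesis .
  next
    case False
    then have "(\<Sum>i\<in>T. h i x) = 0" by (intro sum.neutral) (auto simp: h_def)
    then show ?thesis by simp
  qed
  have "(\<Sum>i\<in>T. (f (r i) - f (l i))\<^sup>2 / (r i - l i)) \<le> A"
    by (rule has_integral_le[OF hs A hg])
  then show ?thesis using \<open>A \<le> c\<close> by simp
qed

text \<open>
  The sums are the integrals of the squared slopes of the dyadic polygons inscribed in \<open>f\<close>. These
  slopes converge to the derivative almost everywhere, so Fatou's lemma applies.
\<close>

lemma energy_le_of_dyadic_sums:
  assumes AC: "abs_continuous_on {0..1} f" and "0 \<le> c"
    and sums: "\<And>m::nat. 2 ^ m * (\<Sum>k<2 ^ m. (f ((real k + 1) / 2 ^ m) - f (real k / 2 ^ m))\<^sup>2) \<le> c"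
  shows "energy f \<le> ennreal c"
proof -
  define D where "D m k = (2 ^ m * (f ((real k + 1) / 2 ^ m) - f (real k / 2 ^ m)))\<^sup>2" for m k :: nat
  define G where "G m x = (\<Sum>k<2 ^ m. ennreal (D m k) * indicator {real k / 2 ^ m..<(real k + 1) / 2 ^ m} x)"
    for m :: nat and x :: real
  have meas: "(\<lambda>x. ennreal w * indicator {a..<b} x) \<in> borel_measurable lebesgue" for w a b :: real
    by (intro borel_measurable_times_ennreal borel_measurable_const borel_measurable_indicator) simp
  have Gint: "(\<integral>\<^sup>+x. G m x \<partial>lebesgue) \<le> ennreal c" for m
  proof -
    have "(\<integral>\<^sup>+x. G m x \<partial>lebesgue) = (\<Sum>k<2 ^ m. \<integral>\<^sup>+x. ennreal (D m k) * indicator {real k / 2 ^ m..<(real k + 1) / 2 ^ m} x \<partial>lebesgue)"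
      unfolding G_def by (rule nn_integral_sum) (rule meas)
    also have "\<dots> = (\<Sum>k<2 ^ m. ennreal (D m k * (1 / 2 ^ m)))"
    proof (rule sum.cong[OF refl])
      fix k
      have "(\<integral>\<^sup>+x. ennreal (D m k) * indicator {real k / 2 ^ m..<(real k + 1) / 2 ^ m} x \<partial>lebesgue) =
         ennreal (D m k) * emeasure lebesgue {real k / 2 ^ m..<(real k + 1) / 2 ^ m}"
        by (rule nn_integral_cmult_indicator) simp
      also have "emeasure lebesgue {real k / 2 ^ m..<(real k + 1) / 2 ^ m} = emeasure lborel {real k / 2 ^ m..<(real k + 1) / 2 ^ m}"
        by simp
      also have "\<dots> = ennreal ((real k + 1) / 2 ^ m - real k / 2 ^ m)"
        by (rule emeasure_lborel_Ico) (simp add: divide_right_mono)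
      also have "(real k + 1) / 2 ^ m - real k / 2 ^ m = 1 / 2 ^ m" by (simp add: add_divide_distrib)
      finally show "(\<integral>\<^sup>+x. ennreal (D m k) * indicator {real k / 2 ^ m..<(real k + 1) / 2 ^ m} x \<partial>lebesgue) =
         ennreal (D m k * (1 / 2 ^ m))" by (simp add: D_def ennreal_mult[symmetric])
    qed
    also have "\<dots> = ennreal (\<Sum>k<2 ^ m. D m k * (1 / 2 ^ m))"
      by (rule sum_ennreal) (simp add: D_def)
    also have "(\<Sum>k<2 ^ m. D m k * (1 / 2 ^ m)) = 2 ^ m * (\<Sum>k<2 ^ m. (f ((real k + 1) / 2 ^ m) - f (real k / 2 ^ m))\<^sup>2)"
      by (simp add: D_def sum_distrib_left power2_eq_square mult_ac)
    finally show ?thesis using sums[of m] by (simp add: ennreal_leI)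
  qed
  obtain N where N: "negligible N" "\<And>x. x \<in> {0<..<1} - N \<Longrightarrow> straddle_deriv f x (deriv f x)"
    by (rule abs_continuous_differentiable_ae[OF AC]) (rule that)
  have lim: "(\<lambda>m. G m x) \<longlonglongrightarrow> ennreal ((deriv f x)\<^sup>2)" if x: "x \<in> {0<..<1} - N" for x
  proof -
    define j where "j m = nat \<lfloor>2 ^ m * x\<rfloor>" for m :: nat
    have jx: "real (j m) = of_int \<lfloor>2 ^ m * x\<rfloor>" for m using x by (simp add: j_def)
    have j: "real (j m) \<le> 2 ^ m * x" "2 ^ m * x < real (j m) + 1" for m
      unfolding jx by linarith+
    then have j': "real (j m) / 2 ^ m \<le> x" "x < (real (j m) + 1) / 2 ^ m" for m
      by (auto simp: field_simps)
    have jl: "j m < 2 ^ m" for m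
    proof -
      have "2 ^ m * x < 2 ^ m * 1" using x by (intro mult_strict_left_mono) auto
      then have "real (j m) < 2 ^ m" using j(1)[of m] by linarith
      then have "real (j m) < real (2 ^ m)" by (simp only: of_nat_power of_nat_numeral)
      then show ?thesis by (simp only: of_nat_less_iff)
    qed
    have GD: "G m x = ennreal (D m (j m))" for m
    proof -
      have "indicator {real k / 2 ^ m..<(real k + 1) / 2 ^ m} x = (if k = j m then 1 else 0 :: ennreal)" for k
      proof (cases "k = j m")
        case False
        then have "real k + 1 \<le> real (j m) \<or> real (j m) + 1 \<le> real k" by linarith
        then have "(real k + 1) / 2 ^ m \<le> real (j m) / 2 ^ m \<or> (real (j m) + 1) / 2 ^ m \<le> real k / 2 ^ m"
          by (auto intro: divide_right_mono)
        then show ?thesis using j'[of m] False by (auto simp: indicator_def)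
      qed (use j'[of m] in auto)
      then have "G m x = (\<Sum>k<2 ^ m. if k = j m then ennreal (D m k) else 0)"
        unfolding G_def by (intro sum.cong) auto
      then show ?thesis using jl[of m] by simp
    qed
    have "(\<lambda>m. 2 ^ m * (f ((real (j m) + 1) / 2 ^ m) - f (real (j m) / 2 ^ m))) \<longlonglongrightarrow> deriv f x"
    proof (rule LIMSEQ_I)
      fix e :: real assume "e > 0"
      then obtain d where d: "d > 0" "\<And>u v. u \<le> x \<Longrightarrow> x \<le> v \<Longrightarrow> v - u < d \<Longrightarrow> \<bar>f v - f u - deriv f x * (v - u)\<bar> \<le> e / 2 * (v - u)"
        using N(2)[OF x] half_gt_zero[OF \<open>e > 0\<close>] unfolding straddle_deriv_def by blast
      obtain m0 where m0: "(1 / 2 :: real) ^ m0 < d" using real_arch_pow_inv[OF d(1), of "1/2"] by auto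
      show "\<exists>m0. \<forall>m\<ge>m0. norm (2 ^ m * (f ((real (j m) + 1) / 2 ^ m) - f (real (j m) / 2 ^ m)) - deriv f x) < e"
      proof (intro exI[of _ m0] allI impI)
        fix m assume "m \<ge> m0"
        then have "(1 / 2 :: real) ^ m \<le> (1 / 2) ^ m0" by (intro power_decreasing) auto
        then have h: "1 / 2 ^ m < d" using m0 by (simp add: power_one_over)
        define u v where "u = real (j m) / 2 ^ m" and "v = (real (j m) + 1) / 2 ^ m"
        have uv: "v - u = 1 / 2 ^ m" by (simp add: u_def v_def add_divide_distrib)
        have "\<bar>f v - f u - deriv f x * (v - u)\<bar> \<le> e / 2 * (v - u)"
          using j'[of m] uv h by (intro d(2)) (auto simp: u_def v_def)
        then have "2 ^ m * \<bar>f v - f u - deriv f x * (v - u)\<bar> \<le> 2 ^ m * (e / 2 * (v - u))"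
          by (intro mult_left_mono) auto
        also have "\<dots> = e / 2" by (simp add: uv)
        also have "2 ^ m * \<bar>f v - f u - deriv f x * (v - u)\<bar> = \<bar>2 ^ m * (f v - f u) - deriv f x\<bar>"
        proof -
          have "2 ^ m * (f v - f u - deriv f x * (v - u)) = 2 ^ m * (f v - f u) - deriv f x"
            by (simp add: uv right_diff_distrib)
          moreover have "2 ^ m * \<bar>f v - f u - deriv f x * (v - u)\<bar> = \<bar>2 ^ m * (f v - f u - deriv f x * (v - u))\<bar>"
            by (simp add: abs_mult)
          ultimately show ?thesis by simp
        qed
        finally show "norm (2 ^ m * (f ((real (j m) + 1) / 2 ^ m) - f (real (j m) / 2 ^ m)) - deriv f x) < e"
          using \<open>e > 0\<close> by (simp add: u_def v_def)
      qed
    qed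
    then have "(\<lambda>m. D m (j m)) \<longlonglongrightarrow> (deriv f x)\<^sup>2" unfolding D_def by (intro tendsto_power)
    then show ?thesis unfolding GD by (rule tendsto_ennrealI)
  qed
  have "energy f \<le> (\<integral>\<^sup>+x. liminf (\<lambda>m. G m x) \<partial>lebesgue)"
    unfolding energy_def
  proof (rule nn_integral_mono_AE)
    have "N \<union> {0, 1} \<in> null_sets lebesgue"
      using N(1) by (auto simp: negligible_iff_null_sets[symmetric] intro: negligible_Un)
    then have "AE x in lebesgue. x \<notin> N \<union> {0, 1}" by (rule AE_not_in)
    then show "AE x in lebesgue. ennreal ((deriv f x)\<^sup>2) * indicator {0..1} x \<le> liminf (\<lambda>m. G m x)"
    proof (rule eventually_mono)
      fix x assume x: "x \<notin> N \<union> {0, 1}"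
      show "ennreal ((deriv f x)\<^sup>2) * indicator {0..1} x \<le> liminf (\<lambda>m. G m x)"
      proof (cases "x \<in> {0..1}")
        case True
        then have "x \<in> {0<..<1} - N" using x by auto
        then have "liminf (\<lambda>m. G m x) = ennreal ((deriv f x)\<^sup>2)"
          by (intro lim_imp_Liminf lim) simp_all
        then show ?thesis using True by simp
      qed simp
    qed
  qed
  also have "\<dots> \<le> liminf (\<lambda>m. \<integral>\<^sup>+x. G m x \<partial>lebesgue)"
    unfolding G_def by (intro nn_integral_liminf borel_measurable_sum meas)
  also have "\<dots> \<le> liminf (\<lambda>m. ennreal c)"
    using Gint by (intro Liminf_mono always_eventually) auto
  finally show ?thesis by (simp add: Liminf_const)
qed

section \<open>Compactness of the energy ball\<close>

lemma Kex_iff: "f \<in> Kex \<longleftrightarrow> f \<in> mspace Cex \<and> abs_continuous_on {0..1} f \<and> energy f \<le> 1"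
proof -
  have "energy f < \<infinity>" if "energy f \<le> 1" using that by (simp add: order.strict_trans1)
  then show ?thesis by (auto simp: Kex_def K_def Sobolev_H_def mspace_C01 mspace_Cex)
qed

lemma Riesz_sum_le_1:
  fixes l r :: "'i \<Rightarrow> real"
  assumes "f \<in> Kex" "finite T" "\<And>i. i \<in> T \<Longrightarrow> 0 \<le> l i \<and> l i < r i \<and> r i \<le> 1"
      "\<And>i j. i \<in> T \<Longrightarrow> j \<in> T \<Longrightarrow> i \<noteq> j \<Longrightarrow> {l i<..<r i} \<inter> {l j<..<r j} = {}"
  shows "(\<Sum>i\<in>T. (f (r i) - f (l i))\<^sup>2 / (r i - l i)) \<le> 1"
  using assms by (intro Riesz_sum_le_energy) (auto simp: Kex_iff)

lemma Kex_Holder: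
  assumes f: "f \<in> Kex" and xy: "x \<in> {0..1}" "y \<in> {0..1}"
  shows "(f x - f y)\<^sup>2 \<le> \<bar>x - y\<bar>"
proof -
  have *: "(f y - f x)\<^sup>2 \<le> y - x" if "0 \<le> x" "x < y" "y \<le> 1" for x y
    using Riesz_sum_le_1[OF f, of "{()}" "\<lambda>_. x" "\<lambda>_. y"] that by (simp add: divide_le_eq)
  show ?thesis
    using *[of x y] *[of y x] xy by (cases x y rule: linorder_cases) (auto simp: power2_commute)
qed

lemma grid_cells_disjoint:
  assumes "i \<noteq> j"
  shows "{real i / real N<..<(real i + 1) / real N} \<inter> {real j / real N<..<(real j + 1) / real N} = {}"
proof -
  have "real i + 1 \<le> real j \<or> real j + 1 \<le> real i" using assms by linarith
  then have "(real i + 1) / real N \<le> real j / real N \<or> (real j + 1) / real N \<le> real i / real N"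
    by (auto intro: divide_right_mono)
  then show ?thesis by auto
qed

text \<open>
  With \<open>Riesz_sum_le_1\<close> this describes \<open>Kex\<close> inside \<open>Cex\<close> by inequalities that involve finitely
  many values of \<open>f\<close> each, hence by conditions that survive pointwise limits. Absolute continuity
  follows from the Cauchy--Schwarz inequality, with \<open>\<delta> = \<epsilon>\<^sup>2\<close>.
\<close>

lemma Riesz_sums_imp_Kex:
  assumes f: "f \<in> mspace Cex"
    and R: "\<And>I. finite I \<Longrightarrow> (\<And>i. i \<in> I \<Longrightarrow> 0 \<le> fst i \<and> fst i < snd i \<and> snd i \<le> 1) \<Longrightarrow>
      (\<And>i j. i \<in> I \<Longrightarrow> j \<in> I \<Longrightarrow> i \<noteq> j \<Longrightarrow> {fst i<..<snd i} \<inter> {fst j<..<snd j} = {}) \<Longrightarrow>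
      (\<Sum>i\<in>I. (f (snd i) - f (fst i))\<^sup>2 / (snd i - fst i)) \<le> 1"
  shows "f \<in> Kex"
proof -
  have AC: "abs_continuous_on {0..1} f"
    unfolding abs_continuous_on_def
  proof (intro allI impI, rule exI[of _ "_\<^sup>2"], intro conjI allI impI)
    fix \<epsilon> :: real assume "\<epsilon> > 0"
    then show "\<epsilon>\<^sup>2 > 0" by simp
  next
    fix \<epsilon> :: real and I assume \<epsilon>: "\<epsilon> > 0" and I: "finite I" "\<forall>(a, b)\<in>I. a < b \<and> {a..b} \<subseteq> {0..1}"
      "disjoint_family_on (\<lambda>(a, b). {a<..<b}) I" "(\<Sum>(a, b)\<in>I. b - a) < \<epsilon>\<^sup>2"
    have I': "0 \<le> fst i \<and> fst i < snd i \<and> snd i \<le> 1" if "i \<in> I" for i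
      using I(2) that by (cases i) fastforce
    have le1: "(\<Sum>i\<in>I. (f (snd i) - f (fst i))\<^sup>2 / (snd i - fst i)) \<le> 1"
      using I' I(3) by (intro R I(1)) (auto simp: disjoint_family_on_def case_prod_unfold)
    \<comment> \<open>Cauchy--Schwarz in additive form; the weight \<open>\<epsilon>\<close> balances the two sums.\<close>
    have "\<bar>d\<bar> \<le> (\<epsilon> * (d\<^sup>2 / h) + h / \<epsilon>) / 2" if "h > 0" for d h :: real
    proof -
      have "0 \<le> (\<epsilon> * \<bar>d\<bar> - h)\<^sup>2" by simp
      then have "2 * (\<epsilon> * h * \<bar>d\<bar>) \<le> (\<epsilon> * d)\<^sup>2 + h\<^sup>2" by (simp add: power2_eq_square algebra_simps)
      then show ?thesis using that \<epsilon> by (simp add: field_simps power2_eq_square)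
    qed
    then have "(\<Sum>i\<in>I. \<bar>f (snd i) - f (fst i)\<bar>) \<le>
        (\<Sum>i\<in>I. (\<epsilon> * ((f (snd i) - f (fst i))\<^sup>2 / (snd i - fst i)) + (snd i - fst i) / \<epsilon>) / 2)"
      using I' by (intro sum_mono) auto
    also have "\<dots> = (\<epsilon> * (\<Sum>i\<in>I. (f (snd i) - f (fst i))\<^sup>2 / (snd i - fst i)) + (\<Sum>i\<in>I. snd i - fst i) / \<epsilon>) / 2"
      by (simp only: sum_divide_distrib[symmetric] sum.distrib sum_distrib_left[symmetric])
    also have "\<dots> < \<epsilon>"
    proof -
      have "\<epsilon> * (\<Sum>i\<in>I. (f (snd i) - f (fst i))\<^sup>2 / (snd i - fst i)) \<le> \<epsilon>" using le1 \<epsilon> by simp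
      moreover have "(\<Sum>i\<in>I. snd i - fst i) / \<epsilon> < \<epsilon>"
        using I(4) \<epsilon> by (simp add: case_prod_unfold divide_less_eq power2_eq_square)
      moreover have "(x + y) / 2 < \<epsilon>" if "x \<le> \<epsilon>" "y < \<epsilon>" for x y using that by simp
      ultimately show ?thesis by blast
    qed
    finally show "(\<Sum>(a, b)\<in>I. \<bar>f b - f a\<bar>) < \<epsilon>" by (simp add: case_prod_unfold)
  qed
  have "energy f \<le> ennreal 1"
  proof (rule energy_le_of_dyadic_sums[OF AC])
    fix m :: nat
    define c where "c k = (real k / 2 ^ m, (real k + 1) / 2 ^ m)" for k :: nat
    have inj: "inj_on c {..<2 ^ m}" by (auto simp: inj_on_def c_def)
    have "(\<Sum>i\<in>c ` {..<2 ^ m}. (f (snd i) - f (fst i))\<^sup>2 / (snd i - fst i)) \<le> 1"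
    proof (rule R)
      fix i assume "i \<in> c ` {..<2 ^ m}"
      then obtain k where k: "k < 2 ^ m" "i = c k" by auto
      have "real k + 1 \<le> real (2 ^ m)" using k(1) by linarith
      then show "0 \<le> fst i \<and> fst i < snd i \<and> snd i \<le> 1" using k(2) by (auto simp: c_def divide_strict_right_mono)
    next
      fix i j assume "i \<in> c ` {..<2 ^ m}" "j \<in> c ` {..<2 ^ m}" "i \<noteq> j"
      then obtain k k' where k: "i = c k" "j = c k'" "k \<noteq> k'" by auto
      show "{fst i<..<snd i} \<inter> {fst j<..<snd j} = {}"
        using grid_cells_disjoint[OF k(3), of "2 ^ m"] k(1,2) by (simp add: c_def)
    qed simp
    then show "2 ^ m * (\<Sum>k<2 ^ m. (f ((real k + 1) / 2 ^ m) - f (real k / 2 ^ m))\<^sup>2) \<le> 1"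
      unfolding sum.reindex[OF inj] o_def
      by (simp add: c_def add_divide_distrib sum_distrib_left mult.commute)
  qed simp
  then show ?thesis using f AC by (simp add: Kex_iff)
qed

text \<open>
  \<open>Kex_Holder\<close> makes the functions in \<open>Kex\<close> uniformly bounded and equicontinuous, so the theorem
  of Arzela and Ascoli gives a uniformly convergent subsequence, and the limit stays in \<open>Kex\<close> because
  the Riesz sums pass to it.
\<close>

theorem Kex_sequentially_compact:
  assumes h: "\<And>n. h n \<in> Kex"
  obtains g k where "g \<in> Kex" "strict_mono (k :: nat \<Rightarrow> nat)"
    "\<forall>e>0. \<exists>N. \<forall>n\<ge>N. \<forall>s\<in>{0..1}. \<bar>h (k n) s - g s\<bar> < e"
proof -
  have hC: "h n \<in> mspace Cex" for n using h by (simp add: Kex_iff)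
  have h0: "h n 0 = 0" "h n 1 = 0" "s \<in> {0..1} \<Longrightarrow> 0 \<le> h n s" for n s using hC[of n] by (auto simp: mspace_Cex)
  obtain g0 k where g0: "continuous_on {0..1} g0" and k: "strict_mono (k :: nat \<Rightarrow> nat)"
    and lim: "\<And>e. 0 < e \<Longrightarrow> \<exists>N. \<forall>n x. n \<ge> N \<and> x \<in> {0..1::real} \<longrightarrow> norm (h (k n) x - g0 x) < e"
  proof (rule Arzela_Ascoli[of "{0..1::real}" h 1])
    fix n x assume x: "x \<in> {0..1::real}"
    have "(h n x)\<^sup>2 \<le> 1\<^sup>2" using Kex_Holder[OF h[of n] x, of 0] h0 x by simp
    then show "norm (h n x) \<le> 1" unfolding real_norm_def by (subst (asm) abs_le_square_iff[symmetric]) simp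
  next
    fix x e :: real assume x: "x \<in> {0..1}" "0 < e"
    show "\<exists>d>0. \<forall>n y. y \<in> {0..1} \<and> norm (x - y) < d \<longrightarrow> norm (h n x - h n y) < e"
    proof (intro exI[of _ "e\<^sup>2"] conjI allI impI)
      fix n y assume y: "y \<in> {0..1} \<and> norm (x - y) < e\<^sup>2"
      then have "\<bar>h n x - h n y\<bar>\<^sup>2 < e\<^sup>2" using Kex_Holder[OF h[of n] x(1), of y] by simp
      then show "norm (h n x - h n y) < e"
        unfolding real_norm_def by (rule power_less_imp_less_base) (use x(2) in simp)
    qed (use x in simp)
  qed auto
  define g where "g = restrict g0 {0..1}"
  have conv: "(\<lambda>n. h (k n) s) \<longlonglongrightarrow> g s" if "s \<in> {0..1}" for s
    using lim that by (intro LIMSEQ_I) (fastforce simp: g_def)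
  have gC: "g \<in> mspace Cex"
    unfolding mspace_Cex
  proof (intro CollectI conjI ballI)
    show "continuous_on {0..1} g" by (rule continuous_on_eq[OF g0]) (simp add: g_def)
    show "g 0 = 0" "g 1 = 0" using LIMSEQ_unique[OF conv[of 0]] LIMSEQ_unique[OF conv[of 1]] h0 by auto
    fix s :: real assume s: "s \<in> {0..1}"
    show "0 \<le> g s" using h0(3)[OF s] by (intro LIMSEQ_le_const[OF conv[OF s]]) auto
  qed (simp add: g_def)
  have "g \<in> Kex"
  proof (rule Riesz_sums_imp_Kex[OF gC])
    fix I :: "(real \<times> real) set"
    assume I: "finite I" "\<And>i. i \<in> I \<Longrightarrow> 0 \<le> fst i \<and> fst i < snd i \<and> snd i \<le> 1"
      "\<And>i j. i \<in> I \<Longrightarrow> j \<in> I \<Longrightarrow> i \<noteq> j \<Longrightarrow> {fst i<..<snd i} \<inter> {fst j<..<snd j} = {}"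
    have "(\<lambda>n. \<Sum>i\<in>I. (h (k n) (snd i) - h (k n) (fst i))\<^sup>2 / (snd i - fst i)) \<longlonglongrightarrow>
        (\<Sum>i\<in>I. (g (snd i) - g (fst i))\<^sup>2 / (snd i - fst i))"
      using I(2) by (intro tendsto_sum tendsto_divide tendsto_power tendsto_diff conv tendsto_const) force+
    then show "(\<Sum>i\<in>I. (g (snd i) - g (fst i))\<^sup>2 / (snd i - fst i)) \<le> 1"
      using Riesz_sum_le_1[OF h I] by (intro LIMSEQ_le_const2) auto
  qed
  moreover have "\<exists>N. \<forall>n\<ge>N. \<forall>s\<in>{0..1}. \<bar>h (k n) s - g s\<bar> < e" if e: "e > 0" for e
  proof -
    obtain N where "\<forall>n x. n \<ge> N \<and> x \<in> {0..1::real} \<longrightarrow> norm (h (k n) x - g0 x) < e" using lim[OF e] by blast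
    then show ?thesis by (intro exI[of _ N]) (simp add: g_def)
  qed
  ultimately show ?thesis using k by (intro that[of g k]) auto
qed

section \<open>Polygonal interpolation\<close>

text \<open>
  The polygon through the points of the graph at the multiples of \<open>1 / N\<close>, for functions with
  \<open>f 0 = 0\<close>. Summing ramps makes Lipschitz continuity and homogeneity in \<open>f\<close> evident.
\<close>

definition interp :: "nat \<Rightarrow> (real \<Rightarrow> real) \<Rightarrow> real \<Rightarrow> real" where
  "interp N f = (\<lambda>s\<in>{0..1}. \<Sum>i<N. (f ((real i + 1) / real N) - f (real i / real N)) *
                  max 0 (min 1 (real N * s - real i)))"

lemma grid_cell:
  assumes "N > 0" "s \<in> {0..1}"
  obtains k where "k < N" "s \<in> {real k / real N..(real k + 1) / real N}"
proof (cases "s = 1")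
  case True
  show ?thesis using assms True by (intro that[of "N - 1"]) (auto simp: of_nat_diff)
next
  case False
  define k where "k = nat \<lfloor>real N * s\<rfloor>"
  have "real k = of_int \<lfloor>real N * s\<rfloor>" using assms by (simp add: k_def)
  then have k: "real k \<le> real N * s" "real N * s < real k + 1" by linarith+
  have "real N * s < real N * 1" using assms False by (intro mult_strict_left_mono) auto
  then have "real k < real N" using k(1) by linarith
  then show ?thesis using k assms(1) by (intro that[of k]) (auto simp: field_simps)
qed

lemma interp_on_cell:
  assumes k: "k < N" and s: "s \<in> {real k / real N..(real k + 1) / real N}" and f: "f 0 = 0"
  shows "interp N f s = f (real k / real N) + (f ((real k + 1) / real N) - f (real k / real N)) * (real N * s - real k)"
proof -
  have N: "real N > 0" using k by simp
  have s': "real k \<le> real N * s" "real N * s \<le> real k + 1" using s N by (auto simp: field_simps)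
  have "(real k + 1) / real N \<le> 1" using k N by (simp add: field_simps)
  then have "s \<in> {0..1}" using s by (auto intro: order_trans[rotated])
  define d where "d i = f ((real i + 1) / real N) - f (real i / real N)" for i
  define g where "g i = d i * max 0 (min 1 (real N * s - real i))" for i
  have "{..<N} = {..<k} \<union> {k} \<union> {k<..<N}" using k by auto
  then have "sum g {..<N} = sum g ({..<k} \<union> {k} \<union> {k<..<N})" by simp
  also have "\<dots> = sum g {..<k} + g k + sum g {k<..<N}"
    by (subst sum.union_disjoint; (subst sum.union_disjoint)?) auto
  also have "sum g {..<k} = (\<Sum>i<k. f (real (Suc i) / real N) - f (real i / real N))"
  proof (rule sum.cong[OF refl])
    fix i assume "i \<in> {..<k}"
    then have "real i + 1 \<le> real k" by simp
    then have "max 0 (min 1 (real N * s - real i)) = 1" using s' by simp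
    then show "g i = f (real (Suc i) / real N) - f (real i / real N)" by (simp add: g_def d_def add.commute)
  qed
  also have "\<dots> = f (real k / real N)"
    by (subst sum_lessThan_telescope) (simp add: f)
  also have "sum g {k<..<N} = 0"
  proof (rule sum.neutral, intro ballI)
    fix i assume "i \<in> {k<..<N}"
    then have "real k + 1 \<le> real i" by auto
    then have "real N * s - real i \<le> 0" using s' by linarith
    then show "g i = 0" by (simp add: g_def)
  qed
  also have "g k = d k * (real N * s - real k)" using s' by (simp add: g_def)
  finally show ?thesis using \<open>s \<in> {0..1}\<close> by (simp add: interp_def g_def d_def)
qed

lemma interp_Lipschitz:
  assumes "s \<in> {0..1}" "t \<in> {0..1}"
  shows "\<bar>interp N f s - interp N f t\<bar> \<le>
    real N * (\<Sum>i<N. \<bar>f ((real i + 1) / real N) - f (real i / real N)\<bar>) * \<bar>s - t\<bar>"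
proof -
  define d where "d i = f ((real i + 1) / real N) - f (real i / real N)" for i
  have "interp N f s - interp N f t = (\<Sum>i<N. d i * (max 0 (min 1 (real N * s - real i)) - max 0 (min 1 (real N * t - real i))))"
    using assms by (simp add: interp_def d_def sum_subtractf[symmetric] right_diff_distrib)
  also have "\<bar>\<dots>\<bar> \<le> (\<Sum>i<N. \<bar>d i\<bar> * (real N * \<bar>s - t\<bar>))"
  proof (rule order_trans[OF sum_abs sum_mono])
    fix i
    have "\<bar>max 0 (min 1 (real N * s - real i)) - max 0 (min 1 (real N * t - real i))\<bar> \<le> \<bar>real N * s - real N * t\<bar>"
      by (auto simp: max_def min_def)
    also have "\<dots> = real N * \<bar>s - t\<bar>" by (simp add: right_diff_distrib[symmetric] abs_mult)
    finally show "\<bar>d i * (max 0 (min 1 (real N * s - real i)) - max 0 (min 1 (real N * t - real i)))\<bar> \<le> \<bar>d i\<bar> * (real N * \<bar>s - t\<bar>)"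
      unfolding abs_mult by (intro mult_left_mono) auto
  qed
  also have "\<dots> = real N * (\<Sum>i<N. \<bar>d i\<bar>) * \<bar>s - t\<bar>"
    by (simp add: sum_distrib_left sum_distrib_right mult_ac)
  finally show ?thesis by (simp add: d_def)
qed

lemma Lipschitz_imp_abs_continuous_on:
  assumes "\<And>s t. s \<in> S \<Longrightarrow> t \<in> S \<Longrightarrow> \<bar>f s - f t\<bar> \<le> C * \<bar>s - t :: real\<bar>" "0 \<le> C"
  shows "abs_continuous_on S f"
  unfolding abs_continuous_on_def
proof (intro allI impI)
  fix \<epsilon> :: real assume \<epsilon>: "\<epsilon> > 0"
  show "\<exists>\<delta>>0. \<forall>I. finite I \<longrightarrow> (\<forall>(a, b)\<in>I. a < b \<and> {a..b} \<subseteq> S) \<longrightarrow>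
        disjoint_family_on (\<lambda>(a, b). {a<..<b}) I \<longrightarrow> (\<Sum>(a, b)\<in>I. b - a) < \<delta> \<longrightarrow>
        (\<Sum>(a, b)\<in>I. \<bar>f b - f a\<bar>) < \<epsilon>"
  proof (intro exI[of _ "\<epsilon> / (C + 1)"] conjI allI impI)
    show "0 < \<epsilon> / (C + 1)" using \<epsilon> assms(2) by simp
    fix I assume I: "finite I" "\<forall>(a, b)\<in>I. a < b \<and> {a..b} \<subseteq> S" "(\<Sum>(a, b)\<in>I. b - a) < \<epsilon> / (C + 1)"
    have "(\<Sum>(a, b)\<in>I. \<bar>f b - f a\<bar>) \<le> (\<Sum>(a, b)\<in>I. (C + 1) * (b - a))"
    proof (rule sum_mono)
      fix i assume "i \<in> I"
      moreover obtain a b where i: "i = (a, b)" by (cases i)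
      ultimately have ab: "a < b" "{a..b} \<subseteq> S" using I(2) by auto
      have "a \<in> S" "b \<in> S" using ab by (auto intro!: subsetD[OF ab(2)])
      then have "\<bar>f b - f a\<bar> \<le> C * (b - a)" using assms(1)[of b a] ab(1) by simp
      then show "(case i of (a, b) \<Rightarrow> \<bar>f b - f a\<bar>) \<le> (case i of (a, b) \<Rightarrow> (C + 1) * (b - a))"
        using ab i by (simp add: algebra_simps)
    qed
    also have "\<dots> = (C + 1) * (\<Sum>(a, b)\<in>I. b - a)" by (simp add: sum_distrib_left case_prod_unfold)
    also have "\<dots> < \<epsilon>" using I(3) assms(2) by (simp add: less_divide_eq mult.commute)
    finally show "(\<Sum>(a, b)\<in>I. \<bar>f b - f a\<bar>) < \<epsilon>" .
  qed
qed

lemma interp_abs_continuous: "abs_continuous_on {0..1} (interp N f)"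
  by (rule Lipschitz_imp_abs_continuous_on[OF interp_Lipschitz]) (auto intro: mult_nonneg_nonneg sum_nonneg)

lemma interp_in_Cex:
  assumes N: "N > 0" and f: "f \<in> mspace Cex"
  shows "interp N f \<in> mspace Cex"
  unfolding mspace_Cex
proof (intro CollectI conjI ballI)
  have f0: "f 0 = 0" "f 1 = 0" and fp: "\<And>s. s \<in> {0..1} \<Longrightarrow> 0 \<le> f s" using f by (auto simp: mspace_Cex)
  show "interp N f \<in> extensional {0..1}" by (simp add: interp_def)
  show "continuous_on {0..1} (interp N f)"
    by (rule abs_continuous_on_imp_continuous_on[OF interp_abs_continuous])
  show "interp N f 0 = 0" using interp_on_cell[of 0 N 0 f] N f0 by simp
  have "(real (N - 1) + 1) / real N = 1" "real N - real (N - 1) = 1" using N by (auto simp: of_nat_diff)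
  then show "interp N f 1 = 0" using interp_on_cell[of "N - 1" N 1 f] N f0 by (auto simp: field_simps)
  fix s :: real assume s: "s \<in> {0..1}"
  obtain k where k: "k < N" "s \<in> {real k / real N..(real k + 1) / real N}" by (rule grid_cell[OF N s])
  define u where "u = real N * s - real k"
  have u: "0 \<le> u" "u \<le> 1" using k N by (auto simp: u_def field_simps)
  have kk: "real k / real N \<in> {0..1}" "(real k + 1) / real N \<in> {0..1}" using k(1) by (auto simp: divide_le_eq)
  have "interp N f s = (1 - u) * f (real k / real N) + u * f ((real k + 1) / real N)"
    using interp_on_cell[where f = f, OF k f0(1)] by (simp add: u_def algebra_simps)
  then show "0 \<le> interp N f s" using u fp[OF kk(1)] fp[OF kk(2)] by simp
qed

lemma interp_close:
  assumes N: "N > 0" and f: "f 0 = 0"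
    and osc: "\<And>k t. k < N \<Longrightarrow> t \<in> {real k / real N..(real k + 1) / real N} \<Longrightarrow> \<bar>f t - f (real k / real N)\<bar> \<le> \<delta>"
    and s: "s \<in> {0..1}"
  shows "\<bar>f s - interp N f s\<bar> \<le> 2 * \<delta>"
proof -
  obtain k where k: "k < N" "s \<in> {real k / real N..(real k + 1) / real N}" by (rule grid_cell[OF N s])
  define u where "u = real N * s - real k"
  have u: "0 \<le> u" "u \<le> 1" using k N by (auto simp: u_def field_simps)
  have "\<bar>(f ((real k + 1) / real N) - f (real k / real N)) * u\<bar> \<le> \<delta> * 1"
    unfolding abs_mult using u by (intro mult_mono osc k(1)) (auto simp: divide_right_mono intro: order_trans[OF abs_ge_zero osc[OF k]])
  moreover have "interp N f s = f (real k / real N) + (f ((real k + 1) / real N) - f (real k / real N)) * u"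
    using interp_on_cell[where f = f, OF k f] by (simp add: u_def)
  ultimately show ?thesis using osc[OF k] by linarith
qed

lemma interp_energy_le:
  assumes N: "N > 0" and f: "f 0 = 0"
  shows "energy (interp N f) \<le> ennreal (real N * (\<Sum>k<N. (f ((real k + 1) / real N) - f (real k / real N))\<^sup>2))"
proof -
  define D where "D k = (real N * (f ((real k + 1) / real N) - f (real k / real N)))\<^sup>2" for k
  let ?c = "\<lambda>k. {real k / real N..<(real k + 1) / real N}"
  let ?G = "\<lambda>k x. ennreal (D k) * indicator (?c k) x"
  have deriv: "deriv (interp N f) x = real N * (f ((real k + 1) / real N) - f (real k / real N))"
    if k: "k < N" and x: "x \<in> {real k / real N<..<(real k + 1) / real N}" for k x
  proof (rule DERIV_imp_deriv)
    have "((\<lambda>s. f (real k / real N) + (f ((real k + 1) / real N) - f (real k / real N)) * (real N * s - real k))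
        has_field_derivative real N * (f ((real k + 1) / real N) - f (real k / real N))) (at x)"
      by (auto intro!: derivative_eq_intros)
    then show "(interp N f has_field_derivative real N * (f ((real k + 1) / real N) - f (real k / real N))) (at x)"
      by (rule has_field_derivative_transform_within_open[OF _ open_greaterThanLessThan x])
         (auto intro!: interp_on_cell[where f = f, OF k _ f, symmetric])
  qed
  have "energy (interp N f) \<le> (\<integral>\<^sup>+x. (\<Sum>k<N. ?G k x) \<partial>lebesgue)"
    unfolding energy_def
  proof (rule nn_integral_mono_AE)
    have "insert 1 ((\<lambda>k. real k / real N) ` {..<N}) \<in> null_sets lebesgue"
      by (simp add: negligible_iff_null_sets[symmetric] negligible_finite)
    then have "AE x in lebesgue. x \<notin> insert 1 ((\<lambda>k. real k / real N) ` {..<N})" by (rule AE_not_in)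
    then show "AE x in lebesgue. ennreal ((deriv (interp N f) x)\<^sup>2) * indicator {0..1} x \<le> (\<Sum>k<N. ?G k x)"
    proof (rule eventually_mono)
      fix x assume x: "x \<notin> insert 1 ((\<lambda>k. real k / real N) ` {..<N})"
      show "ennreal ((deriv (interp N f) x)\<^sup>2) * indicator {0..1} x \<le> (\<Sum>k<N. ?G k x)"
      proof (cases "x \<in> {0..1}")
        case True
        obtain k where k: "k < N" "x \<in> {real k / real N..(real k + 1) / real N}" by (rule grid_cell[OF N True])
        have "x \<noteq> real k / real N" using x k(1) by auto
        moreover have "x \<noteq> (real k + 1) / real N"
        proof (cases "Suc k < N")
          case True
          then show ?thesis using x by (auto simp: image_iff add.commute dest: bspec[of _ _ "Suc k"])
        next
          case False
          then have "real k + 1 = real N" using k(1) by linarith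
          then show ?thesis using x N by simp
        qed
        ultimately have k': "x \<in> {real k / real N<..<(real k + 1) / real N}" using k(2) by auto
        have "ennreal ((deriv (interp N f) x)\<^sup>2) * indicator {0..1} x = ?G k x"
          using True k' deriv[OF k(1) k'] by (simp add: D_def)
        also have "\<dots> \<le> (\<Sum>k<N. ?G k x)" using k(1) by (intro sum_nonneg_leq_bound[OF _ _ refl]) auto
        finally show ?thesis .
      qed simp
    qed
  qed
  also have "\<dots> = (\<Sum>k<N. \<integral>\<^sup>+x. ?G k x \<partial>lebesgue)"
    by (intro nn_integral_sum borel_measurable_times_ennreal borel_measurable_const borel_measurable_indicator) simp
  also have "\<dots> = (\<Sum>k<N. ennreal (D k * (1 / real N)))"
  proof (rule sum.cong[OF refl])
    fix k
    have "(\<integral>\<^sup>+x. ?G k x \<partial>lebesgue) = ennreal (D k) * emeasure lebesgue (?c k)"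
      by (rule nn_integral_cmult_indicator) simp
    also have "emeasure lebesgue (?c k) = emeasure lborel (?c k)" by simp
    also have "\<dots> = ennreal ((real k + 1) / real N - real k / real N)"
      by (rule emeasure_lborel_Ico) (simp add: divide_right_mono)
    also have "(real k + 1) / real N - real k / real N = 1 / real N" by (simp add: add_divide_distrib)
    finally show "(\<integral>\<^sup>+x. ?G k x \<partial>lebesgue) = ennreal (D k * (1 / real N))"
      by (simp add: D_def ennreal_mult[symmetric])
  qed
  also have "\<dots> = ennreal (\<Sum>k<N. D k * (1 / real N))" by (rule sum_ennreal) (simp add: D_def)
  also have "(\<Sum>k<N. D k * (1 / real N)) = real N * (\<Sum>k<N. (f ((real k + 1) / real N) - f (real k / real N))\<^sup>2)"
    using N by (simp add: D_def sum_distrib_left power2_eq_square mult_ac)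
  finally show ?thesis .
qed

lemma interp_in_Kex:
  assumes N: "N > 0" and f: "f \<in> mspace Cex"
    and "real N * (\<Sum>k<N. (f ((real k + 1) / real N) - f (real k / real N))\<^sup>2) \<le> 1"
  shows "interp N f \<in> Kex"
proof -
  have "f 0 = 0" using f by (simp add: mspace_Cex)
  then have "energy (interp N f) \<le> ennreal 1"
    using interp_energy_le[OF N, of f] assms(3) by (auto intro: order_trans ennreal_leI)
  then show ?thesis using interp_in_Cex[OF N f] interp_abs_continuous by (simp add: Kex_iff)
qed

lemma interp_cmult: "s \<in> {0..1} \<Longrightarrow> interp N (\<lambda>s\<in>{0..1}. c * f s) s = c * interp N f s"
proof -
  assume s: "s \<in> {0..1}"
  have "real i / real N \<in> {0..1} \<and> (real i + 1) / real N \<in> {0..1}" if "i < N" for i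
    using that by (auto simp: divide_le_eq)
  then show ?thesis
    using s unfolding interp_def by (simp add: sum_distrib_left right_diff_distrib[symmetric] mult.assoc)
qed

lemma Cex_cmult:
  assumes "f \<in> mspace Cex" "0 \<le> c" shows "(\<lambda>s\<in>{0..1}. c * f s) \<in> mspace Cex"
proof -
  have "continuous_on {0..1} (\<lambda>s. c * f s)" using assms by (auto simp: mspace_Cex intro: continuous_intros)
  then have "continuous_on {0..1} (\<lambda>s\<in>{0..1}. c * f s)" by (rule continuous_on_eq) simp
  then show ?thesis using assms by (auto simp: mspace_Cex)
qed

section \<open>Homogeneous functionals on the energy ball\<close>

locale homogeneous_functional =
  fixes \<Phi> :: "(real \<Rightarrow> real) \<Rightarrow> real"
  assumes continuous: "continuous_map (mtopology_of Cex) euclidean \<Phi>"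
    and nonneg: "f \<in> mspace Cex \<Longrightarrow> 0 \<le> \<Phi> f"
    and homogeneous: "f \<in> mspace Cex \<Longrightarrow> 0 \<le> t \<Longrightarrow> \<Phi> (\<lambda>s\<in>{0..1}. t * f s) = t * \<Phi> f"
    and nonzero: "\<exists>f\<in>mspace Cex. \<Phi> f \<noteq> 0"
begin

lemma uniformly_close:
  assumes f: "f \<in> mspace Cex" and "0 < e"
  obtains d where "0 < d"
    "\<forall>g\<in>mspace Cex. (\<forall>s\<in>{0..1}. \<bar>f s - g s\<bar> \<le> d) \<longrightarrow> \<bar>\<Phi> f - \<Phi> g\<bar> < e"
proof -
  interpret Metric_space "mspace Cex" "mdist Cex" by (rule Metric_space_mspace_mdist)
  have top: "mtopology_of Cex = mtopology" by (simp add: mtopology_of_def)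
  let ?U = "{g \<in> mspace Cex. \<Phi> g \<in> ball (\<Phi> f) e}"
  have "openin mtopology ?U"
    using continuous openin_continuous_map_preimage[of mtopology euclidean \<Phi> "ball (\<Phi> f) e"]
    by (simp add: top)
  moreover have "f \<in> ?U" using assms by simp
  ultimately obtain r where r: "r > 0" "mball f r \<subseteq> ?U" by (auto simp: openin_mtopology)
  show ?thesis
  proof (rule that[of "r / 2"])
    show "\<forall>g\<in>mspace Cex. (\<forall>s\<in>{0..1}. \<bar>f s - g s\<bar> \<le> r / 2) \<longrightarrow> \<bar>\<Phi> f - \<Phi> g\<bar> < e"
    proof (intro ballI impI)
    fix g assume g: "g \<in> mspace Cex" "\<forall>s\<in>{0..1}. \<bar>f s - g s\<bar> \<le> r / 2"
    have "mdist Cex f g \<le> r / 2" unfolding mdist_Cex[OF f g(1)] using g(2) by (intro cSUP_least) auto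
    then have "g \<in> mball f r" using r(1) f g(1) by (simp add: in_mball)
    then show "\<bar>\<Phi> f - \<Phi> g\<bar> < e" using r(2) by (auto simp: dist_real_def)
    qed
  qed (use r in simp)
qed

lemma Phi_tendsto:
  assumes g: "g \<in> mspace Cex" "\<And>n. h n \<in> mspace Cex"
    and conv: "\<And>e. e > 0 \<Longrightarrow> \<exists>N. \<forall>n\<ge>N. \<forall>s\<in>{0..1}. \<bar>h n s - g s\<bar> < e"
  shows "(\<lambda>n. \<Phi> (h n)) \<longlonglongrightarrow> \<Phi> g"
proof (rule LIMSEQ_I)
  fix e :: real assume "e > 0"
  obtain d where d: "0 < d"
    "\<forall>f\<in>mspace Cex. (\<forall>s\<in>{0..1}. \<bar>g s - f s\<bar> \<le> d) \<longrightarrow> \<bar>\<Phi> g - \<Phi> f\<bar> < e"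
    by (rule uniformly_close[OF g(1) \<open>e > 0\<close>]) (rule that)
  obtain N where N: "\<forall>n\<ge>N. \<forall>s\<in>{0..1}. \<bar>h n s - g s\<bar> < d" using conv[OF d(1)] by blast
  show "\<exists>N. \<forall>n\<ge>N. norm (\<Phi> (h n) - \<Phi> g) < e"
  proof (intro exI[of _ N] allI impI)
    fix n assume "n \<ge> N"
    then have "\<bar>\<Phi> g - \<Phi> (h n)\<bar> < e"
      using N by (intro d(2)[rule_format] g(2)) (auto simp: abs_minus_commute less_imp_le)
    then show "norm (\<Phi> (h n) - \<Phi> g) < e" by (simp add: abs_minus_commute)
  qed
qed

text \<open>
  Fine polygons approximate a function at which \<open>\<Phi>\<close> is positive, so \<open>\<Phi>\<close> is positive at some
  polygon. A polygon has finite energy, and shrinking it brings the energy below \<open>1\<close> while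
  homogeneity preserves \<open>\<Phi> > 0\<close>.
\<close>

lemma exists_positive_Kex: "\<exists>h\<in>Kex. 0 < \<Phi> h"
proof -
  obtain f where f: "f \<in> mspace Cex" "\<Phi> f \<noteq> 0" using nonzero by blast
  then have pos: "\<Phi> f > 0" using nonneg[OF f(1)] by linarith
  obtain d where d: "0 < d"
    "\<forall>g\<in>mspace Cex. (\<forall>s\<in>{0..1}. \<bar>f s - g s\<bar> \<le> d) \<longrightarrow> \<bar>\<Phi> f - \<Phi> g\<bar> < \<Phi> f"
    by (rule uniformly_close[OF f(1) pos]) (rule that)
  have "uniformly_continuous_on {0..1} f"
    using f(1) by (intro compact_uniformly_continuous) (auto simp: mspace_Cex)
  then obtain \<eta> where \<eta>: "\<eta> > 0" "\<And>s t. s \<in> {0..1} \<Longrightarrow> t \<in> {0..1} \<Longrightarrow> dist t s < \<eta> \<Longrightarrow> dist (f t) (f s) < d / 2"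
    using d(1) unfolding uniformly_continuous_on_def by (metis half_gt_zero)
  obtain n where n: "inverse (real (Suc n)) < \<eta>" using reals_Archimedean[OF \<eta>(1)] by blast
  define N where "N = Suc n"
  have N: "N > 0" "1 / real N < \<eta>" using n by (simp_all add: N_def inverse_eq_divide)
  have f0: "f 0 = 0" using f by (simp add: mspace_Cex)
  define g where "g = interp N f"
  have g: "g \<in> mspace Cex" unfolding g_def by (rule interp_in_Cex[OF N(1) f(1)])
  have "\<bar>f s - g s\<bar> \<le> 2 * (d / 2)" if "s \<in> {0..1}" for s
    unfolding g_def
  proof (rule interp_close[where f = f, OF N(1) f0 _ that])
    fix k t assume k: "k < N" "t \<in> {real k / real N..(real k + 1) / real N}"
    have 1: "real k / real N \<in> {0..1}" "(real k + 1) / real N \<le> 1" using k(1) by (auto simp: divide_le_eq)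
    have "0 \<le> real k / real N" by simp
    then have t: "t \<in> {0..1}" using k(2) 1(2) unfolding atLeastAtMost_iff by linarith
    have "\<bar>t - real k / real N\<bar> \<le> 1 / real N" using k(2) by (auto simp: add_divide_distrib)
    then show "\<bar>f t - f (real k / real N)\<bar> \<le> d / 2"
      using \<eta>(2)[OF 1(1) t] N(2) by (simp add: dist_real_def)
  qed
  then have "\<bar>\<Phi> f - \<Phi> g\<bar> < \<Phi> f" using d(2) g by simp
  then have gpos: "\<Phi> g > 0" by linarith
  define S where "S = real N * (\<Sum>k<N. (f ((real k + 1) / real N) - f (real k / real N))\<^sup>2)"
  \<comment> \<open>Adding \<open>1\<close> to the energy \<open>S\<close> saves a case distinction on \<open>S = 0\<close>.\<close>
  define c where "c = 1 / sqrt (S + 1)"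
  have S: "S \<ge> 0" unfolding S_def by (intro mult_nonneg_nonneg sum_nonneg) auto
  then have c: "c > 0" "c\<^sup>2 * S \<le> 1" by (auto simp: c_def power_divide divide_le_eq)
  define h where "h = (\<lambda>s\<in>{0..1}. c * f s)"
  have h: "h \<in> mspace Cex" unfolding h_def using f(1) c(1) by (intro Cex_cmult) auto
  have "interp N h \<in> Kex"
  proof (rule interp_in_Kex[OF N(1) h])
    have "h ((real k + 1) / real N) - h (real k / real N) = c * (f ((real k + 1) / real N) - f (real k / real N))"
      if "k < N" for k
      using that by (simp add: h_def divide_le_eq right_diff_distrib)
    then have "real N * (\<Sum>k<N. (h ((real k + 1) / real N) - h (real k / real N))\<^sup>2) =
       real N * (\<Sum>k<N. c\<^sup>2 * (f ((real k + 1) / real N) - f (real k / real N))\<^sup>2)"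
      by (simp add: power_mult_distrib)
    also have "\<dots> = c\<^sup>2 * S" by (simp add: S_def sum_distrib_left mult_ac)
    finally show "real N * (\<Sum>k<N. (h ((real k + 1) / real N) - h (real k / real N))\<^sup>2) \<le> 1"
      using c(2) by simp
  qed
  moreover have "interp N h = (\<lambda>s\<in>{0..1}. c * g s)"
  proof
    fix s show "interp N h s = (\<lambda>s\<in>{0..1}. c * g s) s"
      by (cases "s \<in> {0..1}") (auto simp: h_def g_def interp_cmult, auto simp: interp_def)
  qed
  then have "\<Phi> (interp N h) = c * \<Phi> g" using homogeneous[OF g] c(1) by simp
  ultimately show ?thesis using c(1) gpos by (intro bexI[of _ "interp N h"]) auto
qed

definition \<gamma> :: real where "\<gamma> = (SUP f\<in>Kex. \<Phi> f)"

lemma gamma_attained: "\<exists>f\<in>Kex. \<Phi> f = \<gamma>" and gamma_upper: "f \<in> Kex \<Longrightarrow> \<Phi> f \<le> \<gamma>"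
proof -
  have limit: "\<exists>g\<in>Kex. \<exists>k. strict_mono (k :: nat \<Rightarrow> nat) \<and> (\<lambda>n. \<Phi> (h (k n))) \<longlonglongrightarrow> \<Phi> g" if h: "\<And>n. h n \<in> Kex" for h
  proof -
    obtain g k where g: "g \<in> Kex" "strict_mono (k :: nat \<Rightarrow> nat)"
      "\<forall>e>0. \<exists>N. \<forall>n\<ge>N. \<forall>s\<in>{0..1}. \<bar>h (k n) s - g s\<bar> < e"
      by (rule Kex_sequentially_compact[of h, OF h]) (rule that)
    then have "(\<lambda>n. \<Phi> (h (k n))) \<longlonglongrightarrow> \<Phi> g"
      using h by (intro Phi_tendsto) (auto simp: Kex_iff)
    then show ?thesis using g by blast
  qed
  have bdd: "bdd_above (\<Phi> ` Kex)"
  proof (rule ccontr)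
    assume "\<not> bdd_above (\<Phi> ` Kex)"
    then have "\<exists>h\<in>Kex. \<Phi> h > real n" for n unfolding bdd_above_def by (auto simp: not_le)
    then obtain h where h: "\<And>n. h n \<in> Kex" "\<And>n. \<Phi> (h n) > real n" by metis
    obtain g k where k: "strict_mono (k :: nat \<Rightarrow> nat)" "(\<lambda>n. \<Phi> (h (k n))) \<longlonglongrightarrow> \<Phi> g" using limit[of h, OF h(1)] by blast
    have "Bseq (\<lambda>n. \<Phi> (h (k n)))" using k(2) by (intro convergent_imp_Bseq) (auto simp: convergent_def)
    then obtain C where C: "\<And>n. norm (\<Phi> (h (k n))) \<le> C" by (auto simp: Bseq_def)
    obtain n where n: "real n > C" using reals_Archimedean2 by blast
    have "real n \<le> real (k n)" using seq_suble[OF k(1), of n] by simp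
    then show False using C[of n] h(2)[of "k n"] n by simp
  qed
  show upper: "\<Phi> f \<le> \<gamma>" if "f \<in> Kex" for f unfolding \<gamma>_def using bdd that by (intro cSUP_upper) auto
  have "\<exists>h\<in>Kex. \<gamma> - inverse (real (Suc n)) < \<Phi> h" for n
  proof -
    have "\<gamma> - inverse (real (Suc n)) < (SUP f\<in>Kex. \<Phi> f)" by (simp add: \<gamma>_def)
    then show ?thesis using bdd exists_positive_Kex by (subst (asm) less_cSUP_iff) auto
  qed
  then obtain h where h: "\<And>n. h n \<in> Kex" "\<And>n. \<gamma> - inverse (real (Suc n)) < \<Phi> (h n)" by metis
  obtain g k where g: "g \<in> Kex" and k: "strict_mono (k :: nat \<Rightarrow> nat)" "(\<lambda>n. \<Phi> (h (k n))) \<longlonglongrightarrow> \<Phi> g"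
    using limit[of h, OF h(1)] by blast
  have "(\<lambda>n. \<gamma> - inverse (real (Suc n))) \<longlonglongrightarrow> \<gamma> - 0"
    by (intro tendsto_diff tendsto_const LIMSEQ_inverse_real_of_nat)
  then have "(\<lambda>n. \<gamma> - inverse (real (Suc (k n)))) \<longlonglongrightarrow> \<gamma> - 0"
    using LIMSEQ_subseq_LIMSEQ[OF _ k(1), of "\<lambda>n. \<gamma> - inverse (real (Suc n))"] by (simp add: o_def)
  then have "\<gamma> - 0 \<le> \<Phi> g" using k(2) h(2) by (intro LIMSEQ_le) (auto intro: less_imp_le)
  then show "\<exists>f\<in>Kex. \<Phi> f = \<gamma>" using g upper[OF g] by (intro bexI[of _ g]) auto
qed

lemma gamma_pos: "0 < \<gamma>"
  using exists_positive_Kex gamma_upper by fastforce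

text \<open>
  Functions arbitrarily close to \<open>Kex\<close> with \<open>\<Phi> \<ge> \<kappa>\<close> would by compactness accumulate at a
  member of \<open>Kex\<close> with \<open>\<Phi> \<ge> \<kappa> > \<gamma>\<close>. A single distance thus serves for the whole of \<open>Kex\<close>, as the
  upper bound on the tail requires.
\<close>

lemma close_to_Kex:
  assumes "\<gamma> < \<kappa>"
  obtains d where "0 < d"
    "\<forall>f\<in>mspace Cex. \<forall>h\<in>Kex. (\<forall>s\<in>{0..1}. \<bar>f s - h s\<bar> \<le> d) \<longrightarrow> \<Phi> f < \<kappa>"
proof -
  have "\<exists>d>0. \<forall>f h. f \<in> mspace Cex \<longrightarrow> h \<in> Kex \<longrightarrow> (\<forall>s\<in>{0..1}. \<bar>f s - h s\<bar> \<le> d) \<longrightarrow> \<Phi> f < \<kappa>"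
  proof (rule ccontr)
    assume neg: "\<not> ?thesis"
    have "\<exists>f h. f \<in> mspace Cex \<and> h \<in> Kex \<and> (\<forall>s\<in>{0..1}. \<bar>f s - h s\<bar> \<le> inverse (real (Suc n))) \<and> \<kappa> \<le> \<Phi> f" for n
    proof -
      have "inverse (real (Suc n)) > 0" by simp
      then show ?thesis using neg by (meson not_le)
    qed
    then obtain f h where fh: "\<And>n. f n \<in> mspace Cex" "\<And>n. h n \<in> Kex"
      "\<And>n s. s \<in> {0..1} \<Longrightarrow> \<bar>f n s - h n s\<bar> \<le> inverse (real (Suc n))" "\<And>n. \<kappa> \<le> \<Phi> (f n)" by metis
    obtain g k where g: "g \<in> Kex" "strict_mono (k :: nat \<Rightarrow> nat)"
      "\<forall>e>0. \<exists>N. \<forall>n\<ge>N. \<forall>s\<in>{0..1}. \<bar>h (k n) s - g s\<bar> < e"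
      by (rule Kex_sequentially_compact[of h, OF fh(2)]) (rule that)
    have "(\<lambda>n. \<Phi> (f (k n))) \<longlonglongrightarrow> \<Phi> g"
    proof (rule Phi_tendsto)
      show "g \<in> mspace Cex" using g(1) by (simp add: Kex_iff)
      fix e :: real assume e: "e > 0"
      obtain N where N: "\<forall>n\<ge>N. \<forall>s\<in>{0..1}. \<bar>h (k n) s - g s\<bar> < e / 2" using g(3) half_gt_zero[OF e] by blast
      obtain M where M: "inverse (real (Suc M)) < e / 2" using reals_Archimedean[OF half_gt_zero[OF e]] by blast
      show "\<exists>N. \<forall>n\<ge>N. \<forall>s\<in>{0..1}. \<bar>f (k n) s - g s\<bar> < e"
      proof (intro exI[of _ "max N M"] allI impI ballI)
        fix n s assume n: "max N M \<le> n" and s: "s \<in> {0..1::real}"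
        have "M \<le> k n" using seq_suble[OF g(2), of n] n by simp
        then have "inverse (real (Suc (k n))) \<le> inverse (real (Suc M))" by (intro le_imp_inverse_le) auto
        then have "\<bar>f (k n) s - h (k n) s\<bar> < e / 2" using fh(3)[OF s, of "k n"] M by linarith
        moreover have "\<bar>h (k n) s - g s\<bar> < e / 2" using N n s by simp
        ultimately show "\<bar>f (k n) s - g s\<bar> < e" by linarith
      qed
    qed (rule fh(1))
    then have "\<kappa> \<le> \<Phi> g" using fh(4) by (intro LIMSEQ_le_const) auto
    then show False using gamma_upper[OF g(1)] assms by simp
  qed
  then show ?thesis using that by blast
qed

end

section \<open>Gaussian bounds for the densities of the excursion\<close>

text \<open>
  The energy of the polygon from \<open>(0, 0)\<close> through the points \<open>(t i, x i)\<close> to \<open>(1, 0)\<close>. Half of it is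
  the exponent of the product of Gaussian densities that make up the density of the excursion.
\<close>

definition path_energy :: "nat \<Rightarrow> (nat \<Rightarrow> real) \<Rightarrow> (nat \<Rightarrow> real) \<Rightarrow> real" where
  "path_energy n t x = (x 0)\<^sup>2 / t 0 + (\<Sum>i\<in>{1..<n}. (x i - x (i - 1))\<^sup>2 / (t i - t (i - 1))) +
     (x (n - 1))\<^sup>2 / (1 - t (n - 1))"

text \<open>
  Up to constants, an upper bound for the prefactors: \<open>1 / v\<close> stands for \<open>1 / sqrt (2 * pi * v)\<close>, which is
  smaller for \<open>v \<le> 1\<close>.
\<close>

definition inverse_gaps :: "nat \<Rightarrow> (nat \<Rightarrow> real) \<Rightarrow> real" where
  "inverse_gaps n t = 1 / t 0 * (\<Prod>i\<in>{1..<n}. 1 / (t i - t (i - 1))) * (1 / (1 - t (n - 1)))"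

definition time_grid :: "nat \<Rightarrow> (nat \<Rightarrow> real) \<Rightarrow> bool" where
  "time_grid n t \<longleftrightarrow> 1 \<le> n \<and> strict_mono_on {..<n} t \<and> t ` {..<n} \<subseteq> {0<..<1}"

lemma time_gridD:
  assumes "time_grid n t"
  shows "1 \<le> n" "\<And>i. i < n \<Longrightarrow> 0 < t i" "\<And>i. i < n \<Longrightarrow> t i < 1"
    "\<And>i. i \<in> {1..<n} \<Longrightarrow> 0 < t i - t (i - 1)" "\<And>i. i \<in> {1..<n} \<Longrightarrow> t i - t (i - 1) < 1"
proof -
  show "1 \<le> n" using assms by (simp add: time_grid_def)
  show 1: "0 < t i" "t i < 1" if "i < n" for i
    using assms that by (auto simp: time_grid_def image_subset_iff)
  fix i assume i: "i \<in> {1..<n}"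
  have "t (i - 1) < t i"
    using assms i by (intro strict_mono_onD[of "{..<n}" t]) (auto simp: time_grid_def)
  then show "0 < t i - t (i - 1)" by simp
  have "0 < t (i - 1)" "t i < 1" using 1[of "i - 1"] 1[of i] i by auto
  then show "t i - t (i - 1) < 1" by simp
qed

lemma normal_density_sqrt:
  assumes "0 < v"
  shows "normal_density m (sqrt v) y = 1 / sqrt (2 * pi * v) * exp (- ((y - m)\<^sup>2 / v / 2))"
  using assms by (simp add: normal_density_def)

lemma inverse_sqrt_le:
  assumes "0 < v" "v \<le> 1" shows "1 / sqrt (2 * pi * v) \<le> 1 / v"
proof -
  have "v * v \<le> 1 * v" using assms by (intro mult_right_mono) auto
  also have "1 * v \<le> 2 * pi * v" using assms pi_gt3 by (intro mult_right_mono) auto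
  finally have "v\<^sup>2 \<le> 2 * pi * v" by (simp add: power2_eq_square)
  then have "v \<le> sqrt (2 * pi * v)" by (rule real_le_rsqrt)
  then show ?thesis using assms by (intro divide_left_mono mult_pos_pos) auto
qed

lemma hitting_density_nonneg: "0 \<le> x \<Longrightarrow> 0 \<le> t \<Longrightarrow> 0 \<le> hitting_density x t"
  by (simp add: hitting_density_def)

text \<open>
  The linear factor \<open>x\<close> is absorbed by giving up a fraction \<open>\<epsilon>\<close> of the Gaussian exponent.
\<close>

lemma hitting_density_upper:
  assumes x: "0 < x" and t: "0 < t" and e: "0 < \<epsilon>" "\<epsilon> \<le> 1"
  shows "hitting_density x t \<le> 1 / \<epsilon> * (1 / t) * exp (- ((1 - \<epsilon>) * (x\<^sup>2 / t) / 2))"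
proof -
  define z where "z = x / sqrt t"
  have z: "0 < z" "z\<^sup>2 = x\<^sup>2 / t" using x t by (auto simp: z_def power_divide)
  have "\<epsilon> * z \<le> 1 + \<epsilon> * z\<^sup>2 / 2"
  proof -
    have "0 \<le> \<epsilon> * (z - 1)\<^sup>2" using e by simp
    then have "2 * (\<epsilon> * z) \<le> \<epsilon> * z\<^sup>2 + \<epsilon>" by (simp add: power2_eq_square algebra_simps)
    then show ?thesis using e by simp
  qed
  also have "\<dots> \<le> exp (\<epsilon> * z\<^sup>2 / 2)" by (rule exp_ge_add_one_self)
  finally have "z \<le> 1 / \<epsilon> * exp (\<epsilon> * z\<^sup>2 / 2)" using e by (simp add: field_simps)
  then have "z * exp (- (z\<^sup>2 / 2)) \<le> 1 / \<epsilon> * exp (\<epsilon> * z\<^sup>2 / 2) * exp (- (z\<^sup>2 / 2))"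
    by (intro mult_right_mono) auto
  also have "\<dots> = 1 / \<epsilon> * exp (- ((1 - \<epsilon>) * z\<^sup>2 / 2))"
    by (simp add: exp_add[symmetric] field_simps)
  finally have 1: "z * exp (- (z\<^sup>2 / 2)) \<le> 1 / \<epsilon> * exp (- ((1 - \<epsilon>) * z\<^sup>2 / 2))" .
  have "hitting_density x t = 1 / sqrt (2 * pi) * (1 / t) * (z * exp (- (z\<^sup>2 / 2)))"
    using t unfolding hitting_density_def normal_density_sqrt[OF t] z(2) by (simp add: z_def real_sqrt_mult)
  also have "\<dots> \<le> 1 * (1 / t) * (z * exp (- (z\<^sup>2 / 2)))"
  proof -
    have "1 \<le> sqrt (2 * pi)" using pi_gt3 by simp
    then have "1 / sqrt (2 * pi) \<le> 1" by simp
    then show ?thesis using t z by (intro mult_right_mono) auto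
  qed
  also have "\<dots> \<le> 1 * (1 / t) * (1 / \<epsilon> * exp (- ((1 - \<epsilon>) * z\<^sup>2 / 2)))"
    using 1 t by (intro mult_left_mono) auto
  finally show ?thesis by (simp add: z(2) mult_ac)
qed

text \<open>
  For positive \<open>x\<close> and \<open>y\<close> the reflected point \<open>- x\<close> is farther from \<open>y\<close> than \<open>x\<close>, so the reflected
  term is the smaller one. The exponent is weakened by \<open>1 - \<epsilon>\<close> only to match
  \<open>hitting_density_upper\<close>.
\<close>

lemma killed_kernel_bounds:
  assumes x: "0 < x" and y: "0 < y" and v: "0 < v" "v \<le> 1" and e: "0 < \<epsilon>"
  shows "0 \<le> killed_kernel v x y"
    "killed_kernel v x y \<le> 1 / v * exp (- ((1 - \<epsilon>) * ((y - x)\<^sup>2 / v) / 2))"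
proof -
  have "(y - x)\<^sup>2 \<le> (y - - x)\<^sup>2" using x y by (simp add: power2_eq_square algebra_simps)
  then have "(y - x)\<^sup>2 / v / 2 \<le> (y - - x)\<^sup>2 / v / 2" using v by (intro divide_right_mono) auto
  then show "0 \<le> killed_kernel v x y"
    unfolding killed_kernel_def normal_density_sqrt[OF v(1)] diff_ge_0_iff_ge using v
    by (intro mult_left_mono) auto
  have "killed_kernel v x y \<le> 1 / sqrt (2 * pi * v) * exp (- ((y - x)\<^sup>2 / v / 2))"
    unfolding killed_kernel_def normal_density_sqrt[OF v(1)] using v by simp
  also have "\<dots> \<le> 1 / v * exp (- ((y - x)\<^sup>2 / v / 2))"
    by (intro mult_right_mono inverse_sqrt_le v) auto
  also have "\<dots> \<le> 1 / v * exp (- ((1 - \<epsilon>) * ((y - x)\<^sup>2 / v) / 2))"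
  proof -
    have "(1 - \<epsilon>) * ((y - x)\<^sup>2 / v) \<le> 1 * ((y - x)\<^sup>2 / v)"
      using v e by (intro mult_right_mono) auto
    then show ?thesis using v by (intro mult_left_mono) auto
  qed
  finally show "killed_kernel v x y \<le> 1 / v * exp (- ((1 - \<epsilon>) * ((y - x)\<^sup>2 / v) / 2))" .
qed

lemma excursion_density_upper:
  assumes t: "time_grid n t" and e: "0 < \<epsilon>" "\<epsilon> \<le> 1" and x: "\<forall>i<n. 0 < x i"
  shows "excursion_density n t x \<le> sqrt (8 * pi) * (1 / \<epsilon>)\<^sup>2 * inverse_gaps n t * exp (- ((1 - \<epsilon>) * path_energy n t x / 2))"
proof -
  note t = time_gridD[OF t]
  define E where "E w = exp (- ((1 - \<epsilon>) * w / 2))" for w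
  have E: "E (a + b) = E a * E b" "0 < E a" for a b
  proof -
    show "E (a + b) = E a * E b"
      unfolding E_def exp_add[symmetric] by (rule arg_cong[of _ _ exp]) (simp add: field_simps)
  qed (simp add: E_def)
  have Esum: "E (sum f S) = (\<Prod>i\<in>S. E (f i))" if "finite S" for f :: "nat \<Rightarrow> real" and S
    using that by (induction S) (auto simp: E(1), simp add: E_def)
  have n: "0 < n" using t(1) by simp
  let ?h0 = "hitting_density (x 0) (t 0)" and ?h1 = "hitting_density (x (n - 1)) (1 - t (n - 1))"
  let ?k = "\<lambda>i. killed_kernel (t i - t (i - 1)) (x (i - 1)) (x i)"
  have h0: "0 \<le> ?h0" "?h0 \<le> 1 / \<epsilon> * (1 / t 0) * E ((x 0)\<^sup>2 / t 0)"
    unfolding E_def using hitting_density_upper[of "x 0" "t 0" \<epsilon>] t(2)[of 0] n x e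
    by (simp_all add: hitting_density_nonneg less_imp_le)
  have h1: "0 \<le> ?h1" "?h1 \<le> 1 / \<epsilon> * (1 / (1 - t (n - 1))) * E ((x (n - 1))\<^sup>2 / (1 - t (n - 1)))"
    unfolding E_def using hitting_density_upper[of "x (n - 1)" "1 - t (n - 1)" \<epsilon>] t(3)[of "n - 1"] n x e
    by (simp_all add: hitting_density_nonneg less_imp_le)
  have k: "0 \<le> ?k i" "?k i \<le> 1 / (t i - t (i - 1)) * E ((x i - x (i - 1))\<^sup>2 / (t i - t (i - 1)))" if "i \<in> {1..<n}" for i
    unfolding E_def using killed_kernel_bounds[of "x (i - 1)" "x i" "t i - t (i - 1)" \<epsilon>] t(4,5)[OF that] that x e by auto
  have "?h0 * (\<Prod>i\<in>{1..<n}. ?k i) * ?h1 \<le>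
      (1 / \<epsilon> * (1 / t 0) * E ((x 0)\<^sup>2 / t 0)) *
      (\<Prod>i\<in>{1..<n}. 1 / (t i - t (i - 1)) * E ((x i - x (i - 1))\<^sup>2 / (t i - t (i - 1)))) *
      (1 / \<epsilon> * (1 / (1 - t (n - 1))) * E ((x (n - 1))\<^sup>2 / (1 - t (n - 1))))"
  proof -
    have P: "0 \<le> (\<Prod>i\<in>{1..<n}. ?k i)" using k(1) by (rule prod_nonneg)
    have P': "(\<Prod>i\<in>{1..<n}. ?k i) \<le> (\<Prod>i\<in>{1..<n}. 1 / (t i - t (i - 1)) * E ((x i - x (i - 1))\<^sup>2 / (t i - t (i - 1))))"
      using k by (intro prod_mono conjI)
    show ?thesis
      by (rule mult_mono[OF mult_mono[OF h0(2) P' order_trans[OF h0] P] h1(2)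
            mult_nonneg_nonneg[OF order_trans[OF h0] order_trans[OF P P']] h1(1)])
  qed
  also have "\<dots> = (1 / \<epsilon>)\<^sup>2 * inverse_gaps n t * E (path_energy n t x)"
    unfolding prod.distrib path_energy_def E(1) Esum[OF finite_atLeastLessThan] inverse_gaps_def
    by (simp only: power2_eq_square mult_ac)
  finally have "sqrt (8 * pi) * (?h0 * (\<Prod>i\<in>{1..<n}. ?k i) * ?h1) \<le>
     sqrt (8 * pi) * ((1 / \<epsilon>)\<^sup>2 * inverse_gaps n t * E (path_energy n t x))"
    by (intro mult_left_mono) auto
  then show ?thesis using x by (simp add: excursion_density_def E_def mult.assoc)
qed

text \<open>
  By the inequality \<open>(a + b)\<^sup>2 / (s + v) \<le> a\<^sup>2 / s + b\<^sup>2 / v\<close>, merging two segments of a polygon into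
  one lowers the energy; merging all segments before \<open>t i\<close> leaves \<open>(x i)\<^sup>2 / t i\<close>.
\<close>

lemma square_le_path_energy:
  assumes t: "time_grid n t" and i: "i < n"
  shows "(x i)\<^sup>2 \<le> path_energy n t x"
proof -
  note t = time_gridD[OF t]
  have step: "(a + b)\<^sup>2 / (s + v) \<le> a\<^sup>2 / s + b\<^sup>2 / v" if "0 < s" "0 < v" for a b s v :: real
  proof -
    have "0 \<le> (a * v - b * s)\<^sup>2" by simp
    then have "(a + b)\<^sup>2 * (s * v) \<le> (a\<^sup>2 * v + b\<^sup>2 * s) * (s + v)"
      by (simp add: power2_eq_square algebra_simps)
    moreover have "a\<^sup>2 / s + b\<^sup>2 / v = (a\<^sup>2 * v + b\<^sup>2 * s) / (s * v)" using that by (simp add: field_simps)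
    ultimately show ?thesis using that by (simp add: frac_le_eq divide_le_eq pos_le_divide_eq)
  qed
  have part: "(x i)\<^sup>2 / t i \<le> (x 0)\<^sup>2 / t 0 + (\<Sum>j\<in>{1..<Suc i}. (x j - x (j - 1))\<^sup>2 / (t j - t (j - 1)))" if "i < n" for i
    using that
  proof (induction i)
    case (Suc i)
    have "(x (Suc i))\<^sup>2 / t (Suc i) = (x i + (x (Suc i) - x i))\<^sup>2 / (t i + (t (Suc i) - t i))" by simp
    also have "\<dots> \<le> (x i)\<^sup>2 / t i + (x (Suc i) - x i)\<^sup>2 / (t (Suc i) - t i)"
      using t(2)[of i] t(4)[of "Suc i"] Suc.prems by (intro step) auto
    also have "\<dots> \<le> (x 0)\<^sup>2 / t 0 + (\<Sum>j\<in>{1..<Suc i}. (x j - x (j - 1))\<^sup>2 / (t j - t (j - 1))) + (x (Suc i) - x i)\<^sup>2 / (t (Suc i) - t i)"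
      using Suc by auto
    finally show ?case by simp
  qed simp
  have nn: "0 \<le> (x j - x (j - 1))\<^sup>2 / (t j - t (j - 1))" if "j \<in> {1..<n}" for j
    using t(4)[OF that] by simp
  have "(x i)\<^sup>2 \<le> (x i)\<^sup>2 / t i" using t(2,3)[OF i] by (simp add: le_divide_eq mult_left_le)
  also note part[OF i]
  also have "(\<Sum>j\<in>{1..<Suc i}. (x j - x (j - 1))\<^sup>2 / (t j - t (j - 1))) \<le> (\<Sum>j\<in>{1..<n}. (x j - x (j - 1))\<^sup>2 / (t j - t (j - 1)))"
    using i nn by (intro sum_mono2) auto
  also have "(x 0)\<^sup>2 / t 0 + \<dots> \<le> path_energy n t x"
    using t(3)[of "n - 1"] t(1) by (simp add: path_energy_def)
  finally show ?thesis by simp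
qed

lemma nn_integral_gaussian:
  assumes "0 < a"
  shows "(\<integral>\<^sup>+x. ennreal (exp (- (a * x\<^sup>2))) \<partial>lborel) = ennreal (sqrt (pi / a))"
proof -
  define s where "s = sqrt (1 / (2 * a))"
  have s: "0 < s" "s\<^sup>2 = 1 / (2 * a)" using assms by (auto simp: s_def)
  have "exp (- (a * x\<^sup>2)) = sqrt (pi / a) * normal_density 0 s x" for x
    using assms unfolding normal_density_def s(2) by (simp add: real_sqrt_divide field_simps)
  then have "(\<integral>\<^sup>+x. ennreal (exp (- (a * x\<^sup>2))) \<partial>lborel) =
     (\<integral>\<^sup>+x. ennreal (sqrt (pi / a)) * ennreal (normal_density 0 s x) \<partial>lborel)"
    using assms by (simp add: ennreal_mult[symmetric])
  also have "\<dots> = ennreal (sqrt (pi / a)) * (\<integral>\<^sup>+x. ennreal (normal_density 0 s x) \<partial>lborel)"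
    by (rule nn_integral_cmult) simp
  also have "(\<integral>\<^sup>+x. ennreal (normal_density 0 s x) \<partial>lborel) = 1"
    using s(1) integral_normal_density[OF s(1), of 0] integrable_normal_density[OF s(1), of 0]
    by (subst nn_integral_eq_integral) auto
  finally show ?thesis by simp
qed

lemma path_energy_measurable:
  assumes "1 \<le> n"
  shows "(\<lambda>x. path_energy n t x) \<in> borel_measurable (\<Pi>\<^sub>M i\<in>{..<n}. lborel)"
proof -
  have [measurable]: "(\<lambda>x. x i) \<in> borel_measurable (\<Pi>\<^sub>M i\<in>{..<n}. lborel)" if "i < n" for i
    using measurable_component_singleton[of i "{..<n}" "\<lambda>_. lborel :: real measure"] that by simp
  show ?thesis
    unfolding path_energy_def using assms
    by (intro borel_measurable_add borel_measurable_sum borel_measurable_divide borel_measurable_power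
      borel_measurable_diff borel_measurable_const) auto
qed

lemma path_energy_cong: "1 \<le> n \<Longrightarrow> (\<And>i. i < n \<Longrightarrow> x i = y i) \<Longrightarrow> path_energy n t x = path_energy n t y"
  unfolding path_energy_def by (intro arg_cong2[of _ _ _ _ "(+)"] sum.cong) auto

lemma brownian_excursion_grid:
  assumes "brownian_excursion M B" "time_grid n t"
  shows "distributed M (\<Pi>\<^sub>M i\<in>{..<n}. lborel) (\<lambda>\<omega>. \<lambda>i\<in>{..<n}. B \<omega> (t i)) (\<lambda>x. ennreal (excursion_density n t x))"
  using assms unfolding brownian_excursion_def time_grid_def by blast

lemma brownian_excursion_path:
  assumes "brownian_excursion M B" "\<omega> \<in> space M" shows "B \<omega> \<in> mspace Cex"
proof -
  have "B \<in> M \<rightarrow>\<^sub>M Cex_borel" using assms by (simp add: brownian_excursion_def)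
  then have "B \<omega> \<in> space Cex_borel" using assms(2) by (rule measurable_space)
  moreover have "{U. openin (mtopology_of Cex) U} \<subseteq> Pow (mspace Cex)"
    using openin_subset[of "mtopology_of Cex"] by auto
  ultimately show ?thesis by (simp add: Cex_borel_def)
qed

lemma brownian_excursion_eval_measurable:
  assumes B: "brownian_excursion M B" and s: "s \<in> {0..1}"
  shows "(\<lambda>\<omega>. B \<omega> s) \<in> borel_measurable M"
proof (cases "s = 0 \<or> s = 1")
  case True
  have "B \<omega> s = 0" if "\<omega> \<in> space M" for \<omega>
    using brownian_excursion_path[OF B that] True by (auto simp: mspace_Cex)
  then show ?thesis by (subst measurable_cong[of M _ "\<lambda>_. 0"]) auto
next
  case False
  define t where "t = (\<lambda>_::nat. s)"
  have "time_grid 1 t" using False s by (auto simp: time_grid_def t_def strict_mono_on_def)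
  then have "(\<lambda>\<omega>. \<lambda>i\<in>{..<1}. B \<omega> (t i)) \<in> M \<rightarrow>\<^sub>M (\<Pi>\<^sub>M i\<in>{..<1}. lborel)"
    using brownian_excursion_grid[OF B] by (intro distributed_measurable)
  then have "(\<lambda>\<omega>. (\<lambda>i\<in>{..<1::nat}. B \<omega> (t i)) 0) \<in> M \<rightarrow>\<^sub>M lborel"
    by (rule measurable_compose[OF _ measurable_component_singleton]) simp
  then show ?thesis by (simp add: t_def)
qed

text \<open>
  The density is at most a constant times \<open>exp (- (1 - \<epsilon>) * Q / 2)\<close> with \<open>Q\<close> the path energy. On
  \<open>q \<le> Q\<close> the part \<open>(1 - 2 * \<epsilon>) * Q / 2\<close> of the exponent yields the bound, and what remains,
  \<open>\<epsilon> * Q / 2\<close>, dominates \<open>\<epsilon> / (2 * n)\<close> times the sum of the squares of the values, so that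
  a product of Gaussian integrals is left.
\<close>

theorem path_energy_tail:
  assumes B: "brownian_excursion M B" and t: "time_grid n t" and e: "0 < \<epsilon>" "\<epsilon> \<le> 1 / 2"
  shows "measure M {\<omega>\<in>space M. q \<le> path_energy n t (\<lambda>i. B \<omega> (t i))} \<le>
    sqrt (8 * pi) * (1 / \<epsilon>)\<^sup>2 * inverse_gaps n t * sqrt (2 * pi * real n / \<epsilon>) ^ n * exp (- ((1 - 2 * \<epsilon>) * q / 2))"
proof -
  interpret prob_space M using B by (simp add: brownian_excursion_def)
  interpret product_sigma_finite "\<lambda>_::nat. lborel :: real measure" by standard
  let ?N = "\<Pi>\<^sub>M i\<in>{..<n}. (lborel :: real measure)"
  define X where "X = (\<lambda>\<omega>. \<lambda>i\<in>{..<n}. B \<omega> (t i))"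
  define A where "A = {x\<in>space ?N. q \<le> path_energy n t x}"
  define C where "C = sqrt (8 * pi) * (1 / \<epsilon>)\<^sup>2 * inverse_gaps n t * exp (- ((1 - 2 * \<epsilon>) * q / 2))"
  define a where "a = \<epsilon> / (2 * real n)"
  have n: "1 \<le> n" by (rule time_gridD(1)[OF t])
  have a: "0 < a" "pi / a = 2 * pi * real n / \<epsilon>" using e n by (simp_all add: a_def)
  have gaps: "0 \<le> inverse_gaps n t"
    unfolding inverse_gaps_def using time_gridD[OF t] n
    by (intro mult_nonneg_nonneg prod_nonneg) (auto simp: less_imp_le)
  have C: "0 \<le> C" unfolding C_def using gaps by simp
  have A: "A \<in> sets ?N" unfolding A_def using path_energy_measurable[OF n] by measurable
  have D: "distributed M ?N X (\<lambda>x. ennreal (excursion_density n t x))"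
    unfolding X_def by (rule brownian_excursion_grid[OF B t])
  have "{\<omega>\<in>space M. q \<le> path_energy n t (\<lambda>i. B \<omega> (t i))} = X -` A \<inter> space M"
  proof -
    have "path_energy n t (X \<omega>) = path_energy n t (\<lambda>i. B \<omega> (t i))" for \<omega>
      using n by (rule path_energy_cong) (simp add: X_def)
    then show ?thesis
      using measurable_space[OF distributed_measurable[OF D]] by (auto simp: A_def)
  qed
  then have "emeasure M {\<omega>\<in>space M. q \<le> path_energy n t (\<lambda>i. B \<omega> (t i))} =
      (\<integral>\<^sup>+x. ennreal (excursion_density n t x) * indicator A x \<partial>?N)"
    using distributed_emeasure[OF D A] by simp
  also have "\<dots> \<le> (\<integral>\<^sup>+x. ennreal C * (\<Prod>i\<in>{..<n}. ennreal (exp (- (a * (x i)\<^sup>2)))) \<partial>?N)"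
  proof (rule nn_integral_mono)
    fix x
    have "excursion_density n t x \<le> C * (\<Prod>i\<in>{..<n}. exp (- (a * (x i)\<^sup>2)))" if x: "x \<in> A" "\<forall>i<n. 0 < x i"
    proof -
      let ?Q = "path_energy n t x"
      have "(\<Sum>i<n. (x i)\<^sup>2) \<le> (\<Sum>i<n. ?Q)" by (intro sum_mono square_le_path_energy[OF t]) auto
      then have "a * (\<Sum>i<n. (x i)\<^sup>2) \<le> a * (real n * ?Q)" using a by (intro mult_left_mono) auto
      also have "\<dots> = \<epsilon> * ?Q / 2" using n by (simp add: a_def)
      finally have 1: "(\<Sum>i<n. a * (x i)\<^sup>2) \<le> \<epsilon> * ?Q / 2" by (simp add: sum_distrib_left)
      have "(1 - 2 * \<epsilon>) * q \<le> (1 - 2 * \<epsilon>) * ?Q" using x(1) e by (intro mult_left_mono) (auto simp: A_def)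
      then have "- ((1 - \<epsilon>) * ?Q / 2) \<le> - ((1 - 2 * \<epsilon>) * q / 2) + - (\<Sum>i<n. a * (x i)\<^sup>2)"
      proof -
        have "(1 - \<epsilon>) * ?Q = (1 - 2 * \<epsilon>) * ?Q + \<epsilon> * ?Q" by (simp add: algebra_simps)
        then show ?thesis using 1 \<open>(1 - 2 * \<epsilon>) * q \<le> (1 - 2 * \<epsilon>) * ?Q\<close> by linarith
      qed
      then have "exp (- ((1 - \<epsilon>) * ?Q / 2)) \<le> exp (- ((1 - 2 * \<epsilon>) * q / 2)) * (\<Prod>i\<in>{..<n}. exp (- (a * (x i)\<^sup>2)))"
        by (simp add: exp_add[symmetric] exp_sum[symmetric] sum_negf)
      then have "sqrt (8 * pi) * (1 / \<epsilon>)\<^sup>2 * inverse_gaps n t * exp (- ((1 - \<epsilon>) * ?Q / 2)) \<le>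
        sqrt (8 * pi) * (1 / \<epsilon>)\<^sup>2 * inverse_gaps n t * (exp (- ((1 - 2 * \<epsilon>) * q / 2)) * (\<Prod>i\<in>{..<n}. exp (- (a * (x i)\<^sup>2))))"
        using gaps by (intro mult_left_mono mult_nonneg_nonneg) auto
      then have "sqrt (8 * pi) * (1 / \<epsilon>)\<^sup>2 * inverse_gaps n t * exp (- ((1 - \<epsilon>) * ?Q / 2)) \<le>
          C * (\<Prod>i\<in>{..<n}. exp (- (a * (x i)\<^sup>2)))"
        unfolding C_def by (simp only: mult.assoc)
      moreover have "excursion_density n t x \<le> sqrt (8 * pi) * (1 / \<epsilon>)\<^sup>2 * inverse_gaps n t * exp (- ((1 - \<epsilon>) * ?Q / 2))"
        using e by (intro excursion_density_upper[OF t e(1) _ x(2)]) simp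
      ultimately show ?thesis by (rule order_trans[rotated])
    qed
    moreover have "0 \<le> C * (\<Prod>i\<in>{..<n}. exp (- (a * (x i)\<^sup>2)))" using C by (intro mult_nonneg_nonneg prod_nonneg) auto
    moreover have "ennreal C * (\<Prod>i\<in>{..<n}. ennreal (exp (- (a * (x i)\<^sup>2)))) = ennreal (C * (\<Prod>i\<in>{..<n}. exp (- (a * (x i)\<^sup>2))))"
      using C by (subst prod_ennreal) (auto simp: ennreal_mult prod_nonneg)
    moreover have "excursion_density n t x = 0" if "\<not> (\<forall>i<n. 0 < x i)"
      using that unfolding excursion_density_def by (rule if_not_P)
    ultimately show "ennreal (excursion_density n t x) * indicator A x \<le>
        ennreal C * (\<Prod>i\<in>{..<n}. ennreal (exp (- (a * (x i)\<^sup>2))))"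
      by (cases "x \<in> A"; cases "\<forall>i<n. 0 < x i") (auto intro: ennreal_leI)
  qed
  also have "\<dots> = ennreal C * (\<integral>\<^sup>+x. (\<Prod>i\<in>{..<n}. ennreal (exp (- (a * (x i)\<^sup>2)))) \<partial>?N)"
  proof (rule nn_integral_cmult)
    have [measurable]: "(\<lambda>x. x i) \<in> borel_measurable ?N" if "i < n" for i
      using measurable_component_singleton[of i "{..<n}" "\<lambda>_. lborel :: real measure"] that by simp
    show "(\<lambda>x. \<Prod>i\<in>{..<n}. ennreal (exp (- (a * (x i)\<^sup>2)))) \<in> borel_measurable ?N"
      by (intro borel_measurable_prod_ennreal) measurable
  qed
  also have "(\<integral>\<^sup>+x. (\<Prod>i\<in>{..<n}. ennreal (exp (- (a * (x i)\<^sup>2)))) \<partial>?N) =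
      (\<Prod>i\<in>{..<n}. (\<integral>\<^sup>+x. ennreal (exp (- (a * x\<^sup>2))) \<partial>lborel))"
    by (rule product_nn_integral_prod) auto
  also have "\<dots> = ennreal (sqrt (2 * pi * real n / \<epsilon>) ^ n)"
    using a e by (simp add: nn_integral_gaussian ennreal_power)
  also have "ennreal C * \<dots> = ennreal (C * sqrt (2 * pi * real n / \<epsilon>) ^ n)"
    using C e by (simp add: ennreal_mult)
  finally have "measure M {\<omega>\<in>space M. q \<le> path_energy n t (\<lambda>i. B \<omega> (t i))} \<le> C * sqrt (2 * pi * real n / \<epsilon>) ^ n"
    unfolding emeasure_eq_measure using C e by (subst (asm) ennreal_le_iff) auto
  then show ?thesis by (simp add: C_def mult_ac)
qed

lemma sqrt_gauss_le_3:
  assumes "0 < v" "v \<le> 1" shows "sqrt (2 * pi * v) \<le> 3"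
proof -
  have "pi * v \<le> pi * 1" using assms by (intro mult_left_mono) auto
  then have "2 * pi * v \<le> 3\<^sup>2" using pi_less_4 unfolding power2_eq_square by linarith
  then have "sqrt (2 * pi * v) \<le> sqrt (3\<^sup>2)" by (rule real_sqrt_le_mono)
  then show ?thesis by simp
qed

lemma hitting_density_lower:
  assumes x: "1 \<le> x" and t: "0 < t" "t < 1"
  shows "1 / 6 * exp (- (x\<^sup>2 / t / 2)) \<le> hitting_density x t"
proof -
  have s: "0 < sqrt (2 * pi * t)" "sqrt (2 * pi * t) \<le> 3" using t by (simp_all add: sqrt_gauss_le_3)
  then have "1 / 6 \<le> 1 / sqrt (2 * pi * t)" by (simp add: field_simps)
  then have "1 * (1 / 6 * exp (- (x\<^sup>2 / t / 2))) \<le> x / t * (1 / sqrt (2 * pi * t) * exp (- (x\<^sup>2 / t / 2)))"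
    using x t by (intro mult_mono mult_right_mono) auto
  then show ?thesis unfolding hitting_density_def normal_density_sqrt[OF t(1)] by simp
qed

text \<open>
  The reflected term is smaller than the direct one by the factor \<open>exp (- 2 * x * y / v)\<close>, which is
  at most \<open>1 / 2\<close> when both points lie above \<open>1\<close> and the time \<open>v\<close> below \<open>1\<close>.
\<close>

lemma killed_kernel_lower:
  assumes x: "1 \<le> x" and y: "1 \<le> y" and v: "0 < v" "v < 1"
  shows "1 / 6 * exp (- ((y - x)\<^sup>2 / v / 2)) \<le> killed_kernel v x y"
proof -
  let ?s = "sqrt (2 * pi * v)" and ?e = "exp (- ((y - x)\<^sup>2 / v / 2))"
  have s: "0 < ?s" "?s \<le> 3" using v by (simp_all add: sqrt_gauss_le_3)
  have "1 * 1 \<le> x * y" using x y by (intro mult_mono) auto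
  then have xy: "1 \<le> x * y / v" using v by (simp add: le_divide_eq)
  have "exp (- ((y - - x)\<^sup>2 / v / 2)) = ?e * exp (- (2 * (x * y / v)))"
    unfolding exp_add[symmetric] by (rule arg_cong[of _ _ exp]) (use v in \<open>simp add: field_simps power2_eq_square\<close>)
  also have "\<dots> \<le> ?e * (1 / 2)"
  proof (rule mult_left_mono)
    have "2 \<le> exp (2 * (x * y / v))" using exp_ge_add_one_self[of "2 * (x * y / v)"] xy by linarith
    then have "inverse (exp (2 * (x * y / v))) \<le> inverse 2" by (intro le_imp_inverse_le) auto
    then show "exp (- (2 * (x * y / v))) \<le> 1 / 2" by (simp add: exp_minus)
  qed simp
  finally have h: "?e / 2 \<le> ?e - exp (- ((y - - x)\<^sup>2 / v / 2))" by simp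
  have "1 / 6 * ?e = 1 / 3 * (?e / 2)" by simp
  also have "\<dots> \<le> 1 / ?s * (?e - exp (- ((y - - x)\<^sup>2 / v / 2)))"
    using s h by (intro mult_mono) (auto simp: field_simps)
  also have "\<dots> = killed_kernel v x y"
    unfolding killed_kernel_def normal_density_sqrt[OF v(1)] by (simp add: right_diff_distrib)
  finally show ?thesis .
qed

lemma excursion_density_lower:
  assumes t: "time_grid n t" and x: "\<forall>i<n. 1 \<le> x i"
  shows "(1 / 6) ^ (n + 1) * exp (- (path_energy n t x / 2)) \<le> excursion_density n t x"
proof -
  note t = time_gridD[OF t]
  define E where "E w = 1 / 6 * exp (- (w / 2))" for w :: real
  have n: "0 < n" "0 < x 0" "1 \<le> x 0" "1 \<le> x (n - 1)" using t(1) x by (auto intro: less_le_trans[OF zero_less_one])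
  let ?h0 = "hitting_density (x 0) (t 0)" and ?h1 = "hitting_density (x (n - 1)) (1 - t (n - 1))"
  let ?k = "\<lambda>i. killed_kernel (t i - t (i - 1)) (x (i - 1)) (x i)"
  let ?d = "\<lambda>i. (x i - x (i - 1))\<^sup>2 / (t i - t (i - 1))"
  have h0: "E ((x 0)\<^sup>2 / t 0) \<le> ?h0"
    unfolding E_def using t(2,3)[of 0] n by (intro hitting_density_lower) auto
  have h1: "E ((x (n - 1))\<^sup>2 / (1 - t (n - 1))) \<le> ?h1"
    unfolding E_def using t(2,3)[of "n - 1"] n by (intro hitting_density_lower) auto
  have k: "E (?d i) \<le> ?k i" if "i \<in> {1..<n}" for i
    unfolding E_def using t(4,5)[OF that] x that by (intro killed_kernel_lower) auto
  have E0: "0 \<le> E w" for w by (simp add: E_def)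
  have P: "(\<Prod>i\<in>{1..<n}. E (?d i)) \<le> (\<Prod>i\<in>{1..<n}. ?k i)" using k E0 by (intro prod_mono conjI)
  have EP: "0 \<le> (\<Prod>i\<in>{1..<n}. E (?d i))" using E0 by (intro prod_nonneg)
  have nn: "0 \<le> ?h0" "0 \<le> (\<Prod>i\<in>{1..<n}. ?k i)" "0 \<le> ?h1"
    by (rule order_trans[OF E0 h0], rule order_trans[OF EP P], rule order_trans[OF E0 h1])
  have "(1 / 6) ^ (n + 1) * exp (- (path_energy n t x / 2)) =
      E ((x 0)\<^sup>2 / t 0) * (\<Prod>i\<in>{1..<n}. E (?d i)) * E ((x (n - 1))\<^sup>2 / (1 - t (n - 1)))"
  proof -
    have "(\<Prod>i\<in>{1..<n}. E (?d i)) = (1 / 6) ^ (n - 1) * exp (- ((\<Sum>i\<in>{1..<n}. ?d i) / 2))"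
      unfolding E_def prod.distrib by (simp add: exp_sum[symmetric] sum_negf sum_divide_distrib)
    moreover have "(1 / 6 :: real) ^ (n + 1) = 1 / 6 * (1 / 6) ^ (n - 1) * (1 / 6)"
      using n(1) by (cases n) auto
    moreover have halves: "- ((a + b + c) / 2) = - (a / 2) + - (b / 2) + - (c / 2)" for a b c :: real
      by (simp add: add_divide_distrib)
    have "exp (- (path_energy n t x / 2)) =
       exp (- ((x 0)\<^sup>2 / t 0 / 2)) * exp (- ((\<Sum>i\<in>{1..<n}. ?d i) / 2)) * exp (- ((x (n - 1))\<^sup>2 / (1 - t (n - 1)) / 2))"
      unfolding exp_add[symmetric] path_energy_def by (rule arg_cong[of _ _ exp], rule halves)
    ultimately show ?thesis unfolding E_def by (simp only: mult_ac)
  qed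
  also have "\<dots> \<le> ?h0 * (\<Prod>i\<in>{1..<n}. ?k i) * ?h1"
    by (rule mult_mono[OF mult_mono[OF h0 P nn(1) EP] h1 mult_nonneg_nonneg[OF nn(1,2)] E0])
  also have "\<dots> \<le> sqrt (8 * pi) * (?h0 * (\<Prod>i\<in>{1..<n}. ?k i) * ?h1)"
  proof -
    have "1 \<le> sqrt (8 * pi)" using pi_gt3 by simp
    moreover have "0 \<le> ?h0 * (\<Prod>i\<in>{1..<n}. ?k i) * ?h1" using nn by (intro mult_nonneg_nonneg)
    ultimately show ?thesis using mult_right_mono[of 1 "sqrt (8 * pi)"] by fastforce
  qed
  also have "\<dots> = excursion_density n t x"
  proof -
    have "\<forall>i<n. 0 < x i" using x by (auto intro: less_le_trans[OF zero_less_one])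
    then show ?thesis by (simp add: excursion_density_def mult.assoc)
  qed
  finally show ?thesis .
qed

text \<open>
  The box has volume \<open>1\<close>, so its probability is at least the minimum of the density on it. As the
  box keeps away from \<open>0\<close>, all prefactors of the density are bounded below by constants.
\<close>

theorem box_probability_lower:
  assumes B: "brownian_excursion M B" and t: "time_grid n t" and a: "\<And>i. i < n \<Longrightarrow> 1 \<le> a i"
    and q: "\<And>x. (\<And>i. i < n \<Longrightarrow> a i \<le> x i \<and> x i \<le> a i + 1) \<Longrightarrow> path_energy n t x \<le> q"
  shows "(1 / 6) ^ (n + 1) * exp (- (q / 2)) \<le>
    measure M {\<omega>\<in>space M. \<forall>i<n. a i \<le> B \<omega> (t i) \<and> B \<omega> (t i) \<le> a i + 1}"
proof -
  interpret prob_space M using B by (simp add: brownian_excursion_def)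
  interpret product_sigma_finite "\<lambda>_::nat. lborel :: real measure" by standard
  let ?N = "\<Pi>\<^sub>M i\<in>{..<n}. (lborel :: real measure)"
  define X where "X = (\<lambda>\<omega>. \<lambda>i\<in>{..<n}. B \<omega> (t i))"
  define A where "A = (\<Pi>\<^sub>E i\<in>{..<n}. {a i..a i + 1})"
  define c where "c = (1 / 6) ^ (n + 1) * exp (- (q / 2))"
  have A: "A \<in> sets ?N" unfolding A_def by (intro sets_PiM_I_finite) auto
  have D: "distributed M ?N X (\<lambda>x. ennreal (excursion_density n t x))"
    unfolding X_def by (rule brownian_excursion_grid[OF B t])
  have "{\<omega>\<in>space M. \<forall>i<n. a i \<le> B \<omega> (t i) \<and> B \<omega> (t i) \<le> a i + 1} = X -` A \<inter> space M"
  proof -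
    have "X \<omega> \<in> A \<longleftrightarrow> (\<forall>i<n. a i \<le> B \<omega> (t i) \<and> B \<omega> (t i) \<le> a i + 1)" for \<omega>
      unfolding A_def X_def restrict_PiE_iff by (simp add: Ball_def)
    then show ?thesis by blast
  qed
  then have "emeasure M {\<omega>\<in>space M. \<forall>i<n. a i \<le> B \<omega> (t i) \<and> B \<omega> (t i) \<le> a i + 1} =
      (\<integral>\<^sup>+x. ennreal (excursion_density n t x) * indicator A x \<partial>?N)"
    using distributed_emeasure[OF D A] by simp
  also have "\<dots> \<ge> (\<integral>\<^sup>+x. ennreal c * indicator A x \<partial>?N)"
  proof (rule nn_integral_mono)
    fix x
    have "c \<le> excursion_density n t x" if "x \<in> A"
    proof -
      have x: "a i \<le> x i \<and> x i \<le> a i + 1" if "i < n" for i using \<open>x \<in> A\<close> that by (auto simp: A_def PiE_iff)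
      have "c \<le> (1 / 6) ^ (n + 1) * exp (- (path_energy n t x / 2))"
        unfolding c_def using q[OF x] by (intro mult_left_mono) auto
      also have "\<dots> \<le> excursion_density n t x"
        using x a by (intro excursion_density_lower[OF t]) (auto intro: order_trans)
      finally show ?thesis .
    qed
    then show "ennreal c * indicator A x \<le> ennreal (excursion_density n t x) * indicator A x"
      by (cases "x \<in> A") (auto intro: ennreal_leI)
  qed
  also have "(\<integral>\<^sup>+x. ennreal c * indicator A x \<partial>?N) = ennreal c"
    using A emeasure_PiM[of "{..<n}" "\<lambda>i. {a i..a i + 1}"] by (simp add: nn_integral_cmult_indicator A_def)
  finally have "ennreal c \<le> emeasure M {\<omega>\<in>space M. \<forall>i<n. a i \<le> B \<omega> (t i) \<and> B \<omega> (t i) \<le> a i + 1}" .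
  then show ?thesis unfolding emeasure_eq_measure c_def by (subst (asm) ennreal_le_iff) auto
qed

lemma path_energy_measurable_excursion:
  assumes B: "brownian_excursion M B" and t: "time_grid n t"
  shows "(\<lambda>\<omega>. path_energy n t (\<lambda>i. B \<omega> (t i))) \<in> borel_measurable M"
proof -
  have m: "(\<lambda>\<omega>. B \<omega> (t i)) \<in> borel_measurable M" if "i < n" for i
    using time_gridD(2,3)[OF t that] by (intro brownian_excursion_eval_measurable[OF B]) auto
  show ?thesis
    unfolding path_energy_def using time_gridD(1)[OF t]
    by (intro borel_measurable_add borel_measurable_sum borel_measurable_divide borel_measurable_power
      borel_measurable_diff borel_measurable_const m) auto
qed

section \<open>Fluctuations between grid points\<close>

lemma time_grid_1: "0 < t 0 \<Longrightarrow> t 0 < 1 \<Longrightarrow> time_grid 1 t"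
  by (auto simp: time_grid_def intro!: strict_mono_onI)

lemma time_grid_2:
  assumes "0 < t 0" "t 0 < t 1" "t 1 < 1" shows "time_grid 2 t"
proof -
  have "{..<2::nat} = {0, 1}" by auto
  then show ?thesis using assms by (auto simp: time_grid_def intro!: strict_mono_onI)
qed

text \<open>
  With at most two times and \<open>\<epsilon> = 1 / 4\<close> the constants of \<open>path_energy_tail\<close> become absolute.
\<close>

lemma increment_tail_aux:
  assumes B: "brownian_excursion M B" and t: "time_grid n t" and n: "n \<le> 2"
    and gaps: "inverse_gaps n t \<le> 8 ^ j"
    and A: "\<And>\<omega>. \<omega> \<in> A \<Longrightarrow> \<omega> \<in> space M \<and> 2 ^ j * u\<^sup>2 \<le> path_energy n t (\<lambda>i. B \<omega> (t i))"
  shows "measure M A \<le> sqrt (8 * pi) * 256 * pi * 8 ^ j * exp (- (2 ^ j * u\<^sup>2 / 4))"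
proof -
  interpret prob_space M using B by (simp add: brownian_excursion_def)
  note m[measurable] = path_energy_measurable_excursion[OF B t]
  have n1: "1 \<le> n" by (rule time_gridD(1)[OF t])
  have "sqrt (8 * pi * real n) ^ n \<le> 16 * pi"
  proof -
    have "n = 1 \<or> n = 2" using n n1 by auto
    moreover have "sqrt (8 * pi) \<le> 16 * pi"
      by (rule real_le_lsqrt) (use pi_gt3 in \<open>auto simp: power2_eq_square intro: order_trans[OF _ mult_mono]\<close>)
    ultimately show ?thesis by auto
  qed
  have "measure M A \<le> measure M {\<omega>\<in>space M. 2 ^ j * u\<^sup>2 \<le> path_energy n t (\<lambda>i. B \<omega> (t i))}"
    using A by (intro finite_measure_mono) auto
  also have "\<dots> \<le> sqrt (8 * pi) * (1 / (1 / 4))\<^sup>2 * inverse_gaps n t * sqrt (2 * pi * real n / (1 / 4)) ^ n *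
      exp (- ((1 - 2 * (1 / 4)) * (2 ^ j * u\<^sup>2) / 2))"
    by (rule path_energy_tail[OF B t]) auto
  also have "\<dots> = sqrt (8 * pi) * 16 * (inverse_gaps n t * sqrt (8 * pi * real n) ^ n) * exp (- (2 ^ j * u\<^sup>2 / 4))"
    by (simp add: power2_eq_square mult_ac)
  also have "\<dots> \<le> sqrt (8 * pi) * 16 * (8 ^ j * (16 * pi)) * exp (- (2 ^ j * u\<^sup>2 / 4))"
    using gaps \<open>sqrt (8 * pi * real n) ^ n \<le> 16 * pi\<close>
    by (intro mult_right_mono mult_left_mono mult_mono) auto
  finally show ?thesis by (simp add: mult_ac)
qed

text \<open>
  A path with increment \<open>u\<close> over a dyadic cell of length \<open>1 / 2 ^ j\<close> has at least the energy
  \<open>2 ^ j * u\<^sup>2\<close> along the grid formed by the endpoints of that cell; a cell that touches \<open>0\<close> or \<open>1\<close>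
  contributes only its other endpoint, since the excursion vanishes there. None of the at most three
  gaps of the grid is shorter than \<open>1 / 2 ^ j\<close>, whence the factor \<open>8 ^ j\<close>.
\<close>

lemma increment_tail:
  assumes B: "brownian_excursion M B" and j: "1 \<le> j" and k: "k < 2 ^ j" and u: "0 \<le> u"
  shows "measure M {\<omega>\<in>space M. u \<le> \<bar>B \<omega> ((real k + 1) / 2 ^ j) - B \<omega> (real k / 2 ^ j)\<bar>} \<le>
     sqrt (8 * pi) * 256 * pi * 8 ^ j * exp (- (2 ^ j * u\<^sup>2 / 4))" (is "measure M ?A \<le> _")
proof -
  define N :: real where "N = 2 ^ j"
  have "(2::real) ^ 1 \<le> 2 ^ j" using j by (intro power_increasing) auto
  then have N: "2 \<le> N" by (simp add: N_def)
  have "real k + 1 \<le> real (2 ^ j)" using k by linarith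
  then have kN: "real k + 1 \<le> N" by (simp add: N_def)
  have N8: "N * N * N = 8 ^ j" by (simp add: N_def power_mult_distrib[symmetric])
  have ends: "B \<omega> 0 = 0" "B \<omega> 1 = 0" if "\<omega> \<in> space M" for \<omega>
    using brownian_excursion_path[OF B that] by (auto simp: mspace_Cex)
  have sq: "u\<^sup>2 \<le> d\<^sup>2" if "u \<le> \<bar>d\<bar>" for d :: real
    using that u by (subst power2_abs[symmetric]) (intro power_mono)
  have inv: "1 / (w / N) \<le> N" if "1 \<le> w" for w using that N by (simp add: field_simps)
  consider "k = 0" | "0 < k" "real k + 1 = N" | "0 < k" "real k + 1 < N" using kN by force
  then show ?thesis
  proof cases
    case 1
    define t where "t = (\<lambda>_::nat. 1 / N)"
    show ?thesis
    proof (rule increment_tail_aux[OF B, of 1 t])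
      show "time_grid 1 t" using N by (intro time_grid_1) (auto simp: t_def)
      have "inverse_gaps 1 t = N * (1 / ((N - 1) / N))" using N by (simp add: inverse_gaps_def t_def diff_divide_distrib)
      also have "\<dots> \<le> N * N" using N inv[of "N - 1"] by (intro mult_left_mono) auto
      also have "\<dots> \<le> N * N * N" using N by simp
      finally show "inverse_gaps 1 t \<le> 8 ^ j" by (simp add: N8)
      fix \<omega> assume \<omega>: "\<omega> \<in> ?A"
      then have "u\<^sup>2 \<le> (B \<omega> (1 / N))\<^sup>2" using 1 ends[of \<omega>] by (intro sq) (auto simp: N_def)
      then have "N * u\<^sup>2 \<le> N * (B \<omega> (1 / N))\<^sup>2" using N by (intro mult_left_mono) auto
      also have "\<dots> \<le> path_energy 1 t (\<lambda>i. B \<omega> (t i))" using N by (simp add: path_energy_def t_def mult.commute)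
      finally show "\<omega> \<in> space M \<and> 2 ^ j * u\<^sup>2 \<le> path_energy 1 t (\<lambda>i. B \<omega> (t i))" using \<omega> by (simp add: N_def)
    qed simp
  next
    case 2
    define t where "t = (\<lambda>_::nat. real k / N)"
    have t: "t 0 > 0" "1 - t 0 = 1 / N" using 2 N by (auto simp: t_def field_simps)
    show ?thesis
    proof (rule increment_tail_aux[OF B, of 1 t])
      have "1 / N > 0" using N by simp
      then have "t 0 < 1" using t by linarith
      then show "time_grid 1 t" using t(1) by (intro time_grid_1)
      have "inverse_gaps 1 t = 1 / (real k / N) * N" using t by (simp add: inverse_gaps_def) (simp add: t_def)
      also have "\<dots> \<le> N * N" using N inv[of "real k"] 2 by (intro mult_right_mono) auto
      also have "\<dots> \<le> N * N * N" using N by simp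
      finally show "inverse_gaps 1 t \<le> 8 ^ j" by (simp add: N8)
      fix \<omega> assume \<omega>: "\<omega> \<in> ?A"
      have "(real k + 1) / 2 ^ j = 1" using 2 by (simp add: N_def)
      then have "u\<^sup>2 \<le> (B \<omega> (t 0))\<^sup>2" using \<omega> ends[of \<omega>] by (intro sq) (auto simp: N_def t_def)
      then have "N * u\<^sup>2 \<le> N * (B \<omega> (t 0))\<^sup>2" using N by (intro mult_left_mono) auto
      also have "\<dots> \<le> path_energy 1 t (\<lambda>i. B \<omega> (t i))" using t by (simp add: path_energy_def mult.commute)
      finally show "\<omega> \<in> space M \<and> 2 ^ j * u\<^sup>2 \<le> path_energy 1 t (\<lambda>i. B \<omega> (t i))" using \<omega> by (simp add: N_def)
    qed simp
  next
    case 3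
    define t where "t = (\<lambda>i::nat. (real k + real i) / N)"
    have t: "0 < t 0" "t 1 - t 0 = 1 / N" "1 - t 1 = (N - real k - 1) / N" "0 < 1 - t 1"
      using 3 N by (auto simp: t_def field_simps)
    have le: "1 \<le> N - real k - 1"
    proof -
      have "real (k + 1) < real (2 ^ j)" using 3 by (simp add: N_def)
      then have "k + 1 < 2 ^ j" by (simp only: of_nat_less_iff)
      then have "real (k + 2) \<le> real (2 ^ j)" by (simp only: of_nat_le_iff)
      then show ?thesis by (simp add: N_def)
    qed
    have two: "{1..<2::nat} = {1}" by auto
    show ?thesis
    proof (rule increment_tail_aux[OF B, of 2 t])
      have "1 / N > 0" using N by simp
      then have "t 0 < t 1" "t 1 < 1" using t by linarith+
      then show "time_grid 2 t" using t(1) by (intro time_grid_2)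
      have "inverse_gaps 2 t = 1 / (real k / N) * N * (1 / ((N - real k - 1) / N))"
      proof -
        have "inverse_gaps 2 t = 1 / t 0 * (1 / (t 1 - t 0)) * (1 / (1 - t 1))"
          unfolding inverse_gaps_def two by simp
        then have "inverse_gaps 2 t = 1 / t 0 * N * (1 / ((N - real k - 1) / N))" unfolding t(2,3) by simp
        then show ?thesis by (simp add: t_def)
      qed
      also have "\<dots> \<le> N * N * N" using N inv[of "real k"] inv[OF le] 3 le by (intro mult_mono) auto
      finally show "inverse_gaps 2 t \<le> 8 ^ j" by (simp add: N8)
      fix \<omega> assume \<omega>: "\<omega> \<in> ?A"
      then have "u\<^sup>2 \<le> (B \<omega> (t 1) - B \<omega> (t 0))\<^sup>2" by (intro sq) (auto simp: N_def t_def add.commute)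
      then have "N * u\<^sup>2 \<le> N * (B \<omega> (t 1) - B \<omega> (t 0))\<^sup>2" using N by (intro mult_left_mono) auto
      also have "\<dots> \<le> path_energy 2 t (\<lambda>i. B \<omega> (t i))"
      proof -
        have "path_energy 2 t (\<lambda>i. B \<omega> (t i)) =
            (B \<omega> (t 0))\<^sup>2 / t 0 + (B \<omega> (t 1) - B \<omega> (t 0))\<^sup>2 / (t 1 - t 0) + (B \<omega> (t 1))\<^sup>2 / (1 - t 1)"
          unfolding path_energy_def two by simp
        moreover have "0 \<le> (B \<omega> (t 0))\<^sup>2 / t 0" "0 \<le> (B \<omega> (t 1))\<^sup>2 / (1 - t 1)"
          using t(1,4) by (auto intro!: divide_nonneg_pos simp del: One_nat_def)
        moreover have "(B \<omega> (t 1) - B \<omega> (t 0))\<^sup>2 / (t 1 - t 0) = N * (B \<omega> (t 1) - B \<omega> (t 0))\<^sup>2"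
          unfolding t(2) by simp
        ultimately show ?thesis by linarith
      qed
      finally show "\<omega> \<in> space M \<and> 2 ^ j * u\<^sup>2 \<le> path_energy 2 t (\<lambda>i. B \<omega> (t i))" using \<omega> by (simp add: N_def)
    qed simp
  qed
qed

text \<open>
  Index of the cell of level \<open>m + i\<close> that contains \<open>t\<close>, found by bisecting cell \<open>k\<close> of level \<open>m\<close>;
  a midpoint belongs to the left half.
\<close>

primrec dyadic_digits :: "nat \<Rightarrow> nat \<Rightarrow> real \<Rightarrow> nat \<Rightarrow> nat" where
  "dyadic_digits m k t 0 = k"
| "dyadic_digits m k t (Suc i) = (if t \<le> (2 * real (dyadic_digits m k t i) + 1) / 2 ^ (m + Suc i)
     then 2 * dyadic_digits m k t i else 2 * dyadic_digits m k t i + 1)"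

text \<open>
  The left endpoints of the cells obtained by bisection lead from \<open>k / 2 ^ m\<close> to \<open>t\<close>. Each step is
  either void or an increment over one dyadic cell, and the geometric series of the bounds sums
  to \<open>\<delta>\<close>.
\<close>

lemma dyadic_chaining:
  fixes f :: "real \<Rightarrow> real"
  assumes f: "continuous_on {0..1} f" and \<delta>: "0 \<le> \<delta>" and k: "k < 2 ^ m"
    and t: "t \<in> {real k / 2 ^ m..(real k + 1) / 2 ^ m}"
    and inc: "\<And>i l. l < 2 ^ (m + Suc i) \<Longrightarrow>
       \<bar>f ((real l + 1) / 2 ^ (m + Suc i)) - f (real l / 2 ^ (m + Suc i))\<bar> \<le> \<delta> / 4 * (3 / 4) ^ i"
  shows "\<bar>f t - f (real k / 2 ^ m)\<bar> \<le> \<delta>"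
proof -
  define a where "a = dyadic_digits m k t"
  define s where "s i = real (a i) / 2 ^ (m + i)" for i
  have inv: "a i < 2 ^ (m + i) \<and> s i \<le> t \<and> t \<le> s i + 1 / 2 ^ (m + i)" for i
  proof (induction i)
    case 0
    show ?case using k t by (simp add: a_def s_def add_divide_distrib)
  next
    case (Suc i)
    have d: "2 * real (a i) / 2 ^ (m + Suc i) = s i" "2 / 2 ^ (m + Suc i) = 1 / (2 ^ (m + i) :: real)"
      by (simp_all add: s_def)
    show ?case
    proof (cases "t \<le> (2 * real (a i) + 1) / 2 ^ (m + Suc i)")
      case True
      then have "a (Suc i) = 2 * a i" by (simp add: a_def)
      then show ?thesis using Suc True d by (simp add: s_def add_divide_distrib)
    next
      case False
      then have "a (Suc i) = 2 * a i + 1" by (simp add: a_def)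
      then show ?thesis using Suc False d by (auto simp: s_def add_divide_distrib)
    qed
  qed
  have bound: "\<bar>f (s i) - f (real k / 2 ^ m)\<bar> \<le> \<delta> * (1 - (3 / 4) ^ i)" for i
  proof (induction i)
    case 0
    show ?case by (simp add: s_def a_def)
  next
    case (Suc i)
    have "\<bar>f (s (Suc i)) - f (s i)\<bar> \<le> \<delta> / 4 * (3 / 4) ^ i"
    proof (cases "a (Suc i) = 2 * a i")
      case True
      then have "s (Suc i) = s i" by (simp add: s_def)
      then show ?thesis using \<delta> by simp
    next
      case False
      then have e: "a (Suc i) = 2 * a i + 1" by (auto simp: a_def split: if_splits)
      have "2 * a i < 2 ^ (m + Suc i)" using inv[of "Suc i"] e by simp
      then have "\<bar>f ((real (2 * a i) + 1) / 2 ^ (m + Suc i)) - f (real (2 * a i) / 2 ^ (m + Suc i))\<bar> \<le> \<delta> / 4 * (3 / 4) ^ i"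
        by (rule inc)
      moreover have "real (2 * a i) / 2 ^ (m + Suc i) = s i" by (simp add: s_def)
      moreover have "(real (2 * a i) + 1) / 2 ^ (m + Suc i) = s (Suc i)" unfolding s_def e by (simp add: add.commute)
      ultimately show ?thesis by (simp only:)
    qed
    moreover have "\<delta> / 4 * (3 / 4) ^ i + \<delta> * (1 - (3 / 4) ^ i) = \<delta> * (1 - (3 / 4) ^ Suc i)"
      by (simp add: algebra_simps)
    ultimately show ?case using Suc.IH by linarith
  qed
  have lim: "s \<longlonglongrightarrow> t"
  proof (rule tendsto_sandwich[of "\<lambda>i. t - (1 / 2) ^ i" s _ "\<lambda>_. t"])
    have "1 / 2 ^ (m + i) \<le> (1 / 2 :: real) ^ i" for i
      by (simp add: power_one_over power_add divide_simps)
    then show "\<forall>\<^sub>F i in sequentially. t - (1 / 2) ^ i \<le> s i"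
      using inv by (intro always_eventually allI) (smt (verit))
    show "\<forall>\<^sub>F i in sequentially. s i \<le> t" using inv by auto
    have "(\<lambda>i. t - (1 / 2) ^ i) \<longlonglongrightarrow> t - 0" by (intro tendsto_diff tendsto_const LIMSEQ_power_zero) simp
    then show "(\<lambda>i. t - (1 / 2) ^ i) \<longlonglongrightarrow> t" by simp
  qed simp
  have s01: "s i \<in> {0..1}" for i
  proof -
    have "real (a i) \<le> 2 ^ (m + i)" using inv[of i] by (metis of_nat_less_iff of_nat_numeral of_nat_power less_imp_le)
    then show ?thesis by (simp add: s_def)
  qed
  have t01: "t \<in> {0..1}" using LIMSEQ_le_const[OF lim, of 0] LIMSEQ_le_const2[OF lim, of 1] s01 by auto
  have "(\<lambda>i. f (s i)) \<longlonglongrightarrow> f t"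
    using continuous_on_tendsto_compose[OF f lim t01] s01 by simp
  then have "(\<lambda>i. \<bar>f (s i) - f (real k / 2 ^ m)\<bar>) \<longlonglongrightarrow> \<bar>f t - f (real k / 2 ^ m)\<bar>"
    by (intro tendsto_intros)
  moreover have "\<bar>f (s i) - f (real k / 2 ^ m)\<bar> \<le> \<delta>" for i
  proof -
    have "\<delta> * (1 - (3 / 4) ^ i) \<le> \<delta> * 1" using \<delta> by (intro mult_left_mono) auto
    then show ?thesis using bound[of i] by simp
  qed
  ultimately show ?thesis by (intro LIMSEQ_le_const2) auto
qed

text \<open>
  By \<open>dyadic_chaining\<close> the fluctuation is small unless, for some \<open>i\<close>, one of the \<open>2 ^ j\<close>
  increments of level \<open>j = m + 1 + i\<close> exceeds \<open>\<delta> * x / 4 * (3 / 4) ^ i\<close>. By \<open>increment_tail\<close> each of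
  these has probability at most a constant times \<open>8 ^ j * exp (- s * (9 / 8) ^ i)\<close>, where
  \<open>s = 2 ^ (m + 1) * \<delta>\<^sup>2 / 64 * x\<^sup>2\<close>. The weights \<open>3 / 4\<close> decay more slowly than the typical
  increments of level \<open>j\<close>, which is why the exponent grows with \<open>i\<close> and beats the factor \<open>16 ^ j\<close>
  in the union bound. On a fine grid \<open>s\<close> exceeds \<open>R * x\<^sup>2\<close>, so deviations between grid
  points are rarer than any prescribed Gaussian rate.
\<close>

theorem fluctuation_tail:
  assumes B: "brownian_excursion M B" and \<delta>: "0 < \<delta>" and R: "0 < R"
  obtains m0 where "\<forall>m\<ge>m0. \<exists>C. \<forall>\<^sub>F x in at_top. \<exists>F\<in>sets M. measure M F \<le> C * exp (- (R * x\<^sup>2)) \<and>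
     (\<forall>\<omega>\<in>space M - F. \<forall>k<2 ^ m. \<forall>t\<in>{real k / 2 ^ m..(real k + 1) / 2 ^ m}.
        \<bar>B \<omega> t - B \<omega> (real k / 2 ^ m)\<bar> \<le> \<delta> * x)"
proof -
  interpret prob_space M using B by (simp add: brownian_excursion_def)
  obtain m0 :: nat where m0: "64 * R / \<delta>\<^sup>2 < 2 ^ m0" using real_arch_pow[of 2] by auto
  define C0 where "C0 = sqrt (8 * pi) * 256 * pi"
  have C0: "0 < C0" by (simp add: C0_def)
  show ?thesis
  proof (rule that[of m0], intro allI impI)
    fix m assume "m0 \<le> m"
    define s where "s x = 2 ^ (m + 1) * \<delta>\<^sup>2 / 64 * x\<^sup>2" for x :: real
    have "(2::real) ^ m0 \<le> 2 ^ (m + 1)" using \<open>m0 \<le> m\<close> by (intro power_increasing) auto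
    then have "64 * R / \<delta>\<^sup>2 \<le> 2 ^ (m + 1)" using m0 by linarith
    then have "R \<le> 2 ^ (m + 1) * \<delta>\<^sup>2 / 64" using \<delta> by (simp add: divide_le_eq)
    then have s: "R * x\<^sup>2 \<le> s x" for x unfolding s_def by (intro mult_right_mono) auto
    \<comment> \<open>From \<open>s x \<ge> 248 = 8 * 31\<close> one gets \<open>exp (- (s x / 8)) \<le> 1 / 32\<close>, which together with the
      factor \<open>16\<close> per level leaves a geometric series of ratio \<open>1 / 2\<close>.\<close>
    have "\<forall>\<^sub>F x in at_top. 248 / R + 1 \<le> (x::real)" by (rule eventually_ge_at_top)
    then have "\<forall>\<^sub>F x in at_top. \<exists>F\<in>sets M. measure M F \<le> C0 * 16 ^ (m + 1) * 2 * exp (- (R * x\<^sup>2)) \<and>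
     (\<forall>\<omega>\<in>space M - F. \<forall>k<2 ^ m. \<forall>t\<in>{real k / 2 ^ m..(real k + 1) / 2 ^ m}.
        \<bar>B \<omega> t - B \<omega> (real k / 2 ^ m)\<bar> \<le> \<delta> * x)"
    proof (rule eventually_mono)
      fix x assume "248 / R + 1 \<le> x"
      then have x: "1 \<le> x" "248 / R \<le> x" using R by (auto intro: order_trans[rotated])
      then have "248 \<le> R * x" using R by (simp add: divide_le_eq mult.commute)
      also have "\<dots> \<le> R * x\<^sup>2" using R x by (simp add: power2_eq_square)
      also have "\<dots> \<le> s x" by (rule s)
      finally have s28: "248 \<le> s x" .
      define u where "u i = \<delta> * x / 4 * (3 / 4) ^ i" for i :: nat
      define E where "E i l = {\<omega>\<in>space M. u i \<le> \<bar>B \<omega> ((real l + 1) / 2 ^ (m + Suc i)) - B \<omega> (real l / 2 ^ (m + Suc i))\<bar>}" for i l :: nat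
      define A where "A i = (\<Union>l<2 ^ (m + Suc i). E i l)" for i
      define F where "F = (\<Union>i. A i)"
      have E: "E i l \<in> sets M" if l: "l < 2 ^ (m + Suc i)" for i l
      proof -
        have "real l + 1 \<le> real (2 ^ (m + Suc i))" using l by linarith
        then have "real l / 2 ^ (m + Suc i) \<in> {0..1}" "(real l + 1) / 2 ^ (m + Suc i) \<in> {0..1}" by (simp_all add: divide_le_eq)
        note this[THEN brownian_excursion_eval_measurable[OF B], measurable]
        show ?thesis unfolding E_def by measurable
      qed
      have A: "A i \<in> sets M" for i unfolding A_def using E by (intro sets.finite_UN) auto
      have F: "F \<in> sets M" unfolding F_def using A by (intro sets.countable_UN) auto
      have q: "exp (- (s x / 8)) \<le> 1 / 32"
      proof -
        have "32 \<le> exp (s x / 8)" using exp_ge_add_one_self[of "s x / 8"] s28 by linarith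
        then have "inverse (exp (s x / 8)) \<le> inverse 32" by (intro le_imp_inverse_le) auto
        then show ?thesis by (simp add: exp_minus inverse_eq_divide)
      qed
      have mA: "measure M (A i) \<le> C0 * 16 ^ (m + 1) * exp (- s x) * (1 / 2) ^ i" for i
      proof -
        let ?j = "m + Suc i"
        have "measure M (A i) \<le> (\<Sum>l<2 ^ ?j. measure M (E i l))"
          unfolding A_def using E by (intro finite_measure_subadditive_finite) auto
        also have "\<dots> \<le> (\<Sum>l<(2::nat) ^ ?j. C0 * 8 ^ ?j * exp (- (2 ^ ?j * (u i)\<^sup>2 / 4)))"
        proof (rule sum_mono)
          fix l :: nat assume "l \<in> {..<2 ^ ?j}"
          then have l: "l < 2 ^ ?j" by simp
          have "0 \<le> u i" using x \<delta> by (simp add: u_def)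
          from increment_tail[OF B _ l this] show "measure M (E i l) \<le> C0 * 8 ^ ?j * exp (- (2 ^ ?j * (u i)\<^sup>2 / 4))"
            unfolding E_def C0_def by simp
        qed
        also have "\<dots> = C0 * 16 ^ ?j * exp (- (2 ^ ?j * (u i)\<^sup>2 / 4))"
          by (simp add: power_mult_distrib[symmetric])
        also have "\<dots> \<le> C0 * 16 ^ ?j * (exp (- s x) * (1 / 32) ^ i)"
        proof (intro mult_left_mono)
          have "(2::real) ^ i * ((3 / 4) ^ i)\<^sup>2 = (9 / 8) ^ i"
            by (simp add: power2_eq_square power_mult_distrib[symmetric])
          moreover have "P * p * (d * x / 4 * q)\<^sup>2 / 4 = P * d\<^sup>2 / 64 * x\<^sup>2 * (p * q\<^sup>2)" for P p d x q :: real
            by (simp add: power2_eq_square)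
          moreover have "(2::real) ^ ?j = 2 ^ (m + 1) * 2 ^ i" by (simp add: power_add)
          ultimately have "2 ^ ?j * (u i)\<^sup>2 / 4 = s x * (9 / 8) ^ i"
            unfolding u_def s_def by metis
          moreover have "s x * (1 + real i * (1 / 8)) \<le> s x * (1 + 1 / 8) ^ i"
            using s28 Bernoulli_inequality[of "1 / 8 :: real" i] by (intro mult_left_mono) auto
          moreover have "s x * (1 + real i * (1 / 8)) = s x + real i * (s x / 8)" by (simp add: algebra_simps)
          ultimately have "exp (- (2 ^ ?j * (u i)\<^sup>2 / 4)) \<le> exp (- s x + real i * - (s x / 8))" by simp
          also have "\<dots> = exp (- s x) * exp (- (s x / 8)) ^ i" by (simp only: exp_add exp_of_nat_mult)
          also have "\<dots> \<le> exp (- s x) * (1 / 32) ^ i" using q by (intro mult_left_mono power_mono) auto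
          finally show "exp (- (2 ^ ?j * (u i)\<^sup>2 / 4)) \<le> exp (- s x) * (1 / 32) ^ i" .
        qed (use C0 in auto)
        also have "\<dots> = C0 * 16 ^ (m + 1) * exp (- s x) * (1 / 2) ^ i"
        proof -
          have "(16::real) ^ i * (1 / 32) ^ i = (1 / 2) ^ i" by (simp add: power_mult_distrib[symmetric])
          moreover have "(16::real) ^ ?j = 16 ^ (m + 1) * 16 ^ i" by (simp add: power_add)
          ultimately show ?thesis by simp
        qed
        finally show ?thesis .
      qed
      have geo: "(\<lambda>i. C0 * 16 ^ (m + 1) * exp (- s x) * (1 / 2) ^ i) sums (C0 * 16 ^ (m + 1) * exp (- s x) * 2)"
        using geometric_sums[of "1 / 2 :: real"] by (intro sums_mult) simp
      have sumA: "summable (\<lambda>i. measure M (A i))"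
        by (rule summable_comparison_test'[OF sums_summable[OF geo], of 0]) (use mA in simp)
      have "measure M F \<le> (\<Sum>i. measure M (A i))"
        unfolding F_def using A sumA by (intro finite_measure_subadditive_countably) auto
      also have "\<dots> \<le> C0 * 16 ^ (m + 1) * exp (- s x) * 2"
        using suminf_le[OF mA sumA sums_summable[OF geo]] sums_unique[OF geo] by simp
      also have "\<dots> \<le> C0 * 16 ^ (m + 1) * exp (- (R * x\<^sup>2)) * 2"
        using s[of x] C0 by (intro mult_right_mono mult_left_mono) auto
      finally have mF: "measure M F \<le> C0 * 16 ^ (m + 1) * 2 * exp (- (R * x\<^sup>2))" by (simp add: mult_ac)
      have "\<bar>B \<omega> t - B \<omega> (real k / 2 ^ m)\<bar> \<le> \<delta> * x"
        if \<omega>: "\<omega> \<in> space M - F" and k: "k < 2 ^ m" and t: "t \<in> {real k / 2 ^ m..(real k + 1) / 2 ^ m}" for \<omega> k t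
      proof (rule dyadic_chaining[OF _ _ k t])
        show "continuous_on {0..1} (B \<omega>)" using brownian_excursion_path[OF B, of \<omega>] \<omega> by (simp add: mspace_Cex)
        show "0 \<le> \<delta> * x" using x \<delta> by simp
        fix i l :: nat assume l: "l < 2 ^ (m + Suc i)"
        have "\<omega> \<notin> E i l" using \<omega> l by (auto simp: F_def A_def)
        then show "\<bar>B \<omega> ((real l + 1) / 2 ^ (m + Suc i)) - B \<omega> (real l / 2 ^ (m + Suc i))\<bar> \<le> \<delta> * x / 4 * (3 / 4) ^ i"
          using \<omega> by (auto simp: E_def u_def)
      qed
      then show "\<exists>F\<in>sets M. measure M F \<le> C0 * 16 ^ (m + 1) * 2 * exp (- (R * x\<^sup>2)) \<and>
         (\<forall>\<omega>\<in>space M - F. \<forall>k<2 ^ m. \<forall>t\<in>{real k / 2 ^ m..(real k + 1) / 2 ^ m}.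
            \<bar>B \<omega> t - B \<omega> (real k / 2 ^ m)\<bar> \<le> \<delta> * x)"
        by (intro bexI[OF _ F] conjI mF) blast
    qed
    then show "\<exists>C. \<forall>\<^sub>F x in at_top. \<exists>F\<in>sets M. measure M F \<le> C * exp (- (R * x\<^sup>2)) \<and>
     (\<forall>\<omega>\<in>space M - F. \<forall>k<2 ^ m. \<forall>t\<in>{real k / 2 ^ m..(real k + 1) / 2 ^ m}.
        \<bar>B \<omega> t - B \<omega> (real k / 2 ^ m)\<bar> \<le> \<delta> * x)" by (rule exI[of _ "C0 * 16 ^ (m + 1) * 2"])
  qed
qed

section \<open>Gaussian tails of homogeneous functionals\<close>

lemma uniform_time_grid:
  assumes "2 \<le> N" shows "time_grid (N - 1) (\<lambda>i. real (i + 1) / real N)"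
  using assms by (auto simp: time_grid_def intro!: strict_mono_onI divide_strict_right_mono)

lemma path_energy_uniform:
  assumes N: "2 \<le> N" and f: "f 0 = 0" "f 1 = 0"
  shows "path_energy (N - 1) (\<lambda>i. real (i + 1) / real N) (\<lambda>i. f (real (i + 1) / real N)) =
     real N * (\<Sum>k<N. (f ((real k + 1) / real N) - f (real k / real N))\<^sup>2)"
proof -
  obtain p where p: "N = Suc (Suc p)" using N by (metis Suc_le_D numeral_2_eq_2 Suc_le_mono)
  define g where "g k = (f ((real k + 1) / real N) - f (real k / real N))\<^sup>2" for k :: nat
  have "{..<N} = insert 0 (insert (Suc p) {1..<Suc p})" using p by auto
  then have "(\<Sum>k<N. g k) = g 0 + (\<Sum>k\<in>{1..<Suc p}. g k) + g (Suc p)" by (simp add: add_ac)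
  moreover have "g 0 = (f (1 / real N))\<^sup>2" by (simp add: g_def f)
  moreover have "(real (Suc p) + 1) / real N = 1" using p by simp
  then have "g (Suc p) = (f (real (Suc p) / real N))\<^sup>2" unfolding g_def by (simp only: f) simp
  moreover have mid: "(\<Sum>i\<in>{1..<Suc p}. (f (real (i + 1) / real N) - f (real (i - 1 + 1) / real N))\<^sup>2 /
      (real (i + 1) / real N - real (i - 1 + 1) / real N)) = (\<Sum>i\<in>{1..<Suc p}. real N * g i)"
  proof (rule sum.cong[OF refl])
    fix i assume i: "i \<in> {1..<Suc p}"
    then have "real (i + 1) / real N - real (i - 1 + 1) / real N = 1 / real N"
      by (simp add: diff_divide_distrib[symmetric])
    moreover have "real (i - 1 + 1) = real i" "real (i + 1) = real i + 1" using i by auto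
    ultimately show "(f (real (i + 1) / real N) - f (real (i - 1 + 1) / real N))\<^sup>2 /
      (real (i + 1) / real N - real (i - 1 + 1) / real N) = real N * g i" by (simp add: g_def add.commute)
  qed
  moreover have "path_energy (N - 1) (\<lambda>i. real (i + 1) / real N) (\<lambda>i. f (real (i + 1) / real N)) =
      (f (1 / real N))\<^sup>2 / (1 / real N) + (\<Sum>i\<in>{1..<Suc p}. real N * g i) + (f (real (Suc p) / real N))\<^sup>2 / (1 / real N)"
  proof -
    have "N - 1 = Suc p" "Suc p - 1 + 1 = Suc p" using p by simp_all
    moreover have "1 - real (Suc p) / real N = 1 / real N" using p by (simp add: field_simps)
    ultimately show ?thesis unfolding path_energy_def by (simp only: mid) simp
  qed
  ultimately have "path_energy (N - 1) (\<lambda>i. real (i + 1) / real N) (\<lambda>i. f (real (i + 1) / real N)) = real N * (\<Sum>k<N. g k)"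
    by (simp add: sum_distrib_left distrib_left mult.commute del: of_nat_Suc)
  then show ?thesis by (simp add: g_def)
qed

text \<open>
  From \<open>(a + b)\<^sup>2 \<le> (1 + \<theta>) * a\<^sup>2 + (1 + 1 / \<theta>) * b\<^sup>2\<close>, segment by segment. The factor of the
  main path can be as close to \<open>1\<close> as desired, at the expense of the perturbation \<open>e\<close>, which can be
  made small afterwards.
\<close>

lemma path_energy_perturb:
  assumes t: "time_grid n t" and \<theta>: "0 < \<theta>"
  shows "path_energy n t (\<lambda>i. y * (p i + e i)) \<le>
    y\<^sup>2 * ((1 + \<theta>) * path_energy n t p + (1 + 1 / \<theta>) * path_energy n t e)"
proof -
  note t = time_gridD[OF t]
  have sq: "(a + b)\<^sup>2 \<le> (1 + \<theta>) * a\<^sup>2 + (1 + 1 / \<theta>) * b\<^sup>2" for a b :: real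
  proof -
    have "0 \<le> (\<theta> * a - b)\<^sup>2 / \<theta>" using \<theta> by simp
    also have "(\<theta> * a - b)\<^sup>2 / \<theta> = \<theta> * a\<^sup>2 - 2 * a * b + b\<^sup>2 / \<theta>"
      using \<theta> by (simp add: power2_eq_square field_simps)
    finally show ?thesis by (simp add: power2_eq_square algebra_simps)
  qed
  have trm: "(y * w)\<^sup>2 / v \<le> y\<^sup>2 * ((1 + \<theta>) * (a\<^sup>2 / v) + (1 + 1 / \<theta>) * (b\<^sup>2 / v))" if "w = a + b" "0 < v" for w a b v
  proof -
    have "(y * w)\<^sup>2 / v = y\<^sup>2 * ((a + b)\<^sup>2 / v)" using that by (simp add: power_mult_distrib)
    also have "\<dots> \<le> y\<^sup>2 * (((1 + \<theta>) * a\<^sup>2 + (1 + 1 / \<theta>) * b\<^sup>2) / v)"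
      using sq that by (intro mult_left_mono divide_right_mono) auto
    finally show ?thesis by (simp add: add_divide_distrib)
  qed
  let ?S = "\<lambda>u. \<Sum>i\<in>{1..<n}. (u i - u (i - 1))\<^sup>2 / (t i - t (i - 1))"
  have 1: "(y * (p 0 + e 0))\<^sup>2 / t 0 \<le> y\<^sup>2 * ((1 + \<theta>) * ((p 0)\<^sup>2 / t 0) + (1 + 1 / \<theta>) * ((e 0)\<^sup>2 / t 0))"
    using t by (intro trm) auto
  have 2: "(y * (p (n - 1) + e (n - 1)))\<^sup>2 / (1 - t (n - 1)) \<le>
      y\<^sup>2 * ((1 + \<theta>) * ((p (n - 1))\<^sup>2 / (1 - t (n - 1))) + (1 + 1 / \<theta>) * ((e (n - 1))\<^sup>2 / (1 - t (n - 1))))"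
    using t(1) t(3)[of "n - 1"] by (intro trm) auto
  have "?S (\<lambda>i. y * (p i + e i)) \<le> (\<Sum>i\<in>{1..<n}. y\<^sup>2 * ((1 + \<theta>) * ((p i - p (i - 1))\<^sup>2 / (t i - t (i - 1))) +
      (1 + 1 / \<theta>) * ((e i - e (i - 1))\<^sup>2 / (t i - t (i - 1)))))"
  proof (rule sum_mono)
    fix i assume i: "i \<in> {1..<n}"
    have "y * (p i + e i) - y * (p (i - 1) + e (i - 1)) = y * (p i - p (i - 1) + (e i - e (i - 1)))"
      by (simp add: algebra_simps)
    then show "(y * (p i + e i) - y * (p (i - 1) + e (i - 1)))\<^sup>2 / (t i - t (i - 1)) \<le>
       y\<^sup>2 * ((1 + \<theta>) * ((p i - p (i - 1))\<^sup>2 / (t i - t (i - 1))) +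
      (1 + 1 / \<theta>) * ((e i - e (i - 1))\<^sup>2 / (t i - t (i - 1))))"
      using trm[OF refl t(4)[OF i]] by simp
  qed
  also have "\<dots> = y\<^sup>2 * ((1 + \<theta>) * ?S p + (1 + 1 / \<theta>) * ?S e)"
    by (simp only: sum_distrib_left sum.distrib distrib_left)
  finally show ?thesis using 1 2 unfolding path_energy_def distrib_left by linarith
qed

lemma path_energy_uniform_le:
  assumes N: "2 \<le> N" and e: "\<And>i. i < N - 1 \<Longrightarrow> \<bar>e i\<bar> \<le> h" and h: "0 \<le> h"
  shows "path_energy (N - 1) (\<lambda>i. real (i + 1) / real N) e \<le> 4 * (real N)\<^sup>2 * h\<^sup>2"
proof -
  let ?t = "\<lambda>i. real (i + 1) / real N"
  have Np: "real N > 0" using N by simp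
  have sq: "(e i)\<^sup>2 \<le> 4 * h\<^sup>2" if "i < N - 1" for i
  proof -
    have "(e i)\<^sup>2 \<le> h\<^sup>2" using e[OF that] h by (metis abs_le_square_iff abs_of_nonneg)
    then show ?thesis using zero_le_power2[of h] by linarith
  qed
  have "(e 0)\<^sup>2 / ?t 0 \<le> real N * (4 * h\<^sup>2)" using sq[of 0] N Np by (simp add: mult.commute)
  moreover have "1 - ?t (N - 1 - 1) = 1 / real N" using N Np by (simp add: field_simps of_nat_diff)
  then have "(e (N - 1 - 1))\<^sup>2 / (1 - ?t (N - 1 - 1)) \<le> real N * (4 * h\<^sup>2)"
    using sq[of "N - 1 - 1"] N Np by simp
  moreover have "(\<Sum>i\<in>{1..<N - 1}. (e i - e (i - 1))\<^sup>2 / (?t i - ?t (i - 1))) \<le> (\<Sum>i\<in>{1..<N - 1}. real N * (4 * h\<^sup>2))"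
  proof (rule sum_mono)
    fix i assume i: "i \<in> {1..<N - 1}"
    have "?t i - ?t (i - 1) = 1 / real N" using i by (simp add: diff_divide_distrib[symmetric])
    moreover have "(e i - e (i - 1))\<^sup>2 \<le> (2 * h)\<^sup>2"
    proof -
      have "i < N - 1" "i - 1 < N - 1" using i by auto
      then have "\<bar>e i\<bar> \<le> h" "\<bar>e (i - 1)\<bar> \<le> h" by (auto intro: e simp del: One_nat_def)
      then have "\<bar>e i - e (i - 1)\<bar> \<le> \<bar>2 * h\<bar>" by linarith
      then show ?thesis by (simp only: abs_le_square_iff)
    qed
    ultimately show "(e i - e (i - 1))\<^sup>2 / (?t i - ?t (i - 1)) \<le> real N * (4 * h\<^sup>2)"
      using Np by (simp add: power_mult_distrib mult.commute)
  qed
  moreover have "(\<Sum>i\<in>{1..<N - 1}. real N * (4 * h\<^sup>2)) = (real N - 2) * (real N * (4 * h\<^sup>2))"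
    using N by (simp add: of_nat_diff)
  ultimately have "path_energy (N - 1) ?t e \<le> real N * (4 * h\<^sup>2) + (real N - 2) * (real N * (4 * h\<^sup>2)) + real N * (4 * h\<^sup>2)"
    unfolding path_energy_def by linarith
  also have "\<dots> = 4 * (real N)\<^sup>2 * h\<^sup>2" by (simp add: power2_eq_square algebra_simps)
  finally show ?thesis .
qed

context homogeneous_functional
begin

lemma Phi_measurable:
  assumes B: "brownian_excursion M B"
  shows "(\<lambda>\<omega>. \<Phi> (B \<omega>)) \<in> borel_measurable M"
proof -
  have Bm: "B \<in> M \<rightarrow>\<^sub>M Cex_borel" using B by (simp add: brownian_excursion_def)
  have sub: "{U. openin (mtopology_of Cex) U} \<subseteq> Pow (mspace Cex)"
    using openin_subset[of "mtopology_of Cex"] by auto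
  have "\<Phi> \<in> borel_measurable Cex_borel"
  proof (rule borel_measurableI)
    fix S :: "real set" assume "open S"
    have "openin (mtopology_of Cex) {x \<in> topspace (mtopology_of Cex). \<Phi> x \<in> S}"
      using \<open>open S\<close> by (intro openin_continuous_map_preimage[OF continuous]) simp
    moreover have "\<Phi> -` S \<inter> space Cex_borel = {x \<in> topspace (mtopology_of Cex). \<Phi> x \<in> S}"
      using sub by (auto simp: Cex_borel_def)
    ultimately show "\<Phi> -` S \<inter> space Cex_borel \<in> sets Cex_borel"
      using sub by (simp add: Cex_borel_def)
  qed
  then show ?thesis using Bm by (rule measurable_compose[rotated])
qed

text \<open>
  Let \<open>\<kappa>\<close> be slightly larger than \<open>\<gamma>\<close>. If \<open>\<Phi> (B \<omega>) > x\<close>, then by homogeneity \<open>\<Phi>\<close> exceeds \<open>\<kappa>\<close> at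
  the rescaled path \<open>\<kappa> / x * B \<omega>\<close>, so by \<open>close_to_Kex\<close> this path has distance at least \<open>d\<close> from
  \<open>Kex\<close>, in particular from the polygon inscribed in it if that polygon has energy at most \<open>1\<close>. Hence
  either the path along the grid has energy at least \<open>x\<^sup>2 / \<kappa>\<^sup>2\<close>, or the path moves by more than a fixed
  multiple of \<open>x\<close> between two grid points. The first event has the right exponential rate, and on a fine grid
  the second is at least as rare.
\<close>

theorem tail_upper:
  assumes B: "brownian_excursion M B" and \<rho>: "0 < \<rho>" "\<rho> < 1 / (2 * \<gamma>\<^sup>2)"
  shows "\<forall>\<^sub>F x in at_top. measure M {\<omega>\<in>space M. \<Phi> (B \<omega>) > x} \<le> exp (- (\<rho> * x\<^sup>2))"
proof -
  interpret prob_space M using B by (simp add: brownian_excursion_def)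
  note Phi_measurable[OF B, measurable]
  obtain \<rho>' where \<rho>': "\<rho> < \<rho>'" "\<rho>' < 1 / (2 * \<gamma>\<^sup>2)" using dense[OF \<rho>(2)] by blast
  have "0 < \<rho>'" using \<rho> \<rho>' by simp
  have "2 * \<rho>' * \<gamma>\<^sup>2 < 1" using \<rho>'(2) gamma_pos by (simp add: field_simps)
  then have "\<gamma>\<^sup>2 < 1 / (2 * \<rho>')" using \<open>0 < \<rho>'\<close> by (simp add: field_simps)
  \<comment> \<open>The square of \<open>\<kappa>\<close>: the rate \<open>1 / (2 * \<kappa>\<^sup>2)\<close> is still above \<open>\<rho>'\<close>, and \<open>\<epsilon>\<close> is chosen below to turn
    it into \<open>\<rho>'\<close> exactly.\<close>
  then obtain w where w: "\<gamma>\<^sup>2 < w" "w < 1 / (2 * \<rho>')" using dense by blast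
  define \<kappa> where "\<kappa> = sqrt w"
  have "0 < w" using w(1) zero_le_power2[of \<gamma>] by linarith
  then have \<kappa>: "\<gamma> < \<kappa>" "0 < \<kappa>" "\<kappa>\<^sup>2 = w" using w(1) by (auto simp: \<kappa>_def intro: real_less_rsqrt)
  define z where "z = 2 * \<rho>' * w"
  define \<epsilon> where "\<epsilon> = (1 - z) / 2"
  have "z < 1" "0 < z" using w(2) \<open>0 < \<rho>'\<close> \<open>0 < w\<close> by (auto simp: z_def field_simps)
  then have \<epsilon>: "0 < \<epsilon>" "\<epsilon> \<le> 1 / 2" "1 - 2 * \<epsilon> = z" by (auto simp: \<epsilon>_def field_simps)
  obtain d where d: "0 < d"
    "\<forall>f\<in>mspace Cex. \<forall>h\<in>Kex. (\<forall>s\<in>{0..1}. \<bar>f s - h s\<bar> \<le> d) \<longrightarrow> \<Phi> f < \<kappa>"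
    by (rule close_to_Kex[OF \<kappa>(1)]) (rule that)
  define \<delta> where "\<delta> = d / (2 * \<kappa>)"
  have "0 < \<delta>" using d \<kappa> by (simp add: \<delta>_def)
  obtain m0 where m0: "\<forall>m\<ge>m0. \<exists>C. \<forall>\<^sub>F x in at_top. \<exists>F\<in>sets M. measure M F \<le> C * exp (- (\<rho>' * x\<^sup>2)) \<and>
     (\<forall>\<omega>\<in>space M - F. \<forall>k<2 ^ m. \<forall>t\<in>{real k / 2 ^ m..(real k + 1) / 2 ^ m}.
        \<bar>B \<omega> t - B \<omega> (real k / 2 ^ m)\<bar> \<le> \<delta> * x)"
    by (rule fluctuation_tail[OF B \<open>0 < \<delta>\<close> \<open>0 < \<rho>'\<close>]) (rule that)
  define m where "m = Suc m0"
  define N :: nat where "N = 2 ^ m"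
  have N: "2 \<le> N" "real N = 2 ^ m" "0 < N" using one_le_power[of "2::nat" m0] by (simp_all add: N_def m_def)
  define t where "t = (\<lambda>i. real (i + 1) / real N)"
  have tg: "time_grid (N - 1) t" unfolding t_def by (rule uniform_time_grid[OF N(1)])
  have "m0 \<le> m" by (simp add: m_def)
  then obtain C1 where C1: "\<forall>\<^sub>F x in at_top. \<exists>F\<in>sets M. measure M F \<le> C1 * exp (- (\<rho>' * x\<^sup>2)) \<and>
     (\<forall>\<omega>\<in>space M - F. \<forall>k<2 ^ m. \<forall>t\<in>{real k / 2 ^ m..(real k + 1) / 2 ^ m}.
        \<bar>B \<omega> t - B \<omega> (real k / 2 ^ m)\<bar> \<le> \<delta> * x)" using m0 by blast
  define C2 where "C2 = sqrt (8 * pi) * (1 / \<epsilon>)\<^sup>2 * inverse_gaps (N - 1) t * sqrt (2 * pi * real (N - 1) / \<epsilon>) ^ (N - 1)"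
  note [measurable] = path_energy_measurable_excursion[OF B tg]
  have "\<forall>\<^sub>F x in at_top. measure M {\<omega>\<in>space M. \<Phi> (B \<omega>) > x} \<le> (C1 + C2) * exp (- (\<rho>' * x\<^sup>2))"
    using C1 eventually_gt_at_top[of "0::real"]
  proof eventually_elim
    case (elim x)
    then obtain F where F: "F \<in> sets M" "measure M F \<le> C1 * exp (- (\<rho>' * x\<^sup>2))"
      "\<forall>\<omega>\<in>space M - F. \<forall>k<2 ^ m. \<forall>t\<in>{real k / 2 ^ m..(real k + 1) / 2 ^ m}. \<bar>B \<omega> t - B \<omega> (real k / 2 ^ m)\<bar> \<le> \<delta> * x"
      by blast
    have x: "0 < x" using elim by simp
    define G where "G = {\<omega>\<in>space M. x\<^sup>2 / w \<le> path_energy (N - 1) t (\<lambda>i. B \<omega> (t i))}"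
    have G: "G \<in> sets M" unfolding G_def by measurable
    have "{\<omega>\<in>space M. \<Phi> (B \<omega>) > x} \<subseteq> F \<union> G"
    proof (rule subsetI, rule ccontr)
      fix \<omega> assume "\<omega> \<in> {\<omega>\<in>space M. \<Phi> (B \<omega>) > x}" and notin: "\<omega> \<notin> F \<union> G"
      then have \<omega>: "\<omega> \<in> space M" "\<Phi> (B \<omega>) > x" by auto
      define f where "f = B \<omega>"
      have f: "f \<in> mspace Cex" unfolding f_def by (rule brownian_excursion_path[OF B \<omega>(1)])
      have f0: "f 0 = 0" "f 1 = 0" using f by (auto simp: mspace_Cex)
      define c where "c = \<kappa> / x"
      have c: "0 < c" using \<kappa> x by (simp add: c_def)
      define g where "g = (\<lambda>s\<in>{0..1}. c * f s)"
      have g: "g \<in> mspace Cex" unfolding g_def using f c by (intro Cex_cmult) auto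
      have grid: "real k / real N \<in> {0..1}" "(real k + 1) / real N \<in> {0..1}" if "k < N" for k
        using that by (auto simp: divide_le_eq)
      have lt: "real N * (\<Sum>k<N. (f ((real k + 1) / real N) - f (real k / real N))\<^sup>2) < x\<^sup>2 / w"
        using notin \<omega>(1) path_energy_uniform[where f = f, OF N(1) f0] unfolding G_def t_def f_def by auto
      have scale: "real N * (\<Sum>k<N. (g ((real k + 1) / real N) - g (real k / real N))\<^sup>2) =
          c\<^sup>2 * (real N * (\<Sum>k<N. (f ((real k + 1) / real N) - f (real k / real N))\<^sup>2))"
      proof -
        have "(g ((real k + 1) / real N) - g (real k / real N))\<^sup>2 = c\<^sup>2 * (f ((real k + 1) / real N) - f (real k / real N))\<^sup>2"
          if "k < N" for k
          using grid[OF that] by (simp add: g_def power_mult_distrib right_diff_distrib[symmetric] del: atLeastAtMost_iff)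
        then show ?thesis by (simp add: sum_distrib_left mult_ac)
      qed
      have one: "c\<^sup>2 * (x\<^sup>2 / w) = 1" using \<kappa> x \<open>0 < w\<close> by (simp add: c_def power_divide)
      have "c\<^sup>2 * (real N * (\<Sum>k<N. (f ((real k + 1) / real N) - f (real k / real N))\<^sup>2)) \<le> c\<^sup>2 * (x\<^sup>2 / w)"
        using lt by (intro mult_left_mono) auto
      then have "real N * (\<Sum>k<N. (g ((real k + 1) / real N) - g (real k / real N))\<^sup>2) \<le> 1"
        unfolding scale one .
      then have "interp N g \<in> Kex" by (rule interp_in_Kex[OF N(3) g])
      moreover have "\<bar>g s - interp N g s\<bar> \<le> d" if s: "s \<in> {0..1}" for s
      proof -
        have "\<bar>g s - interp N g s\<bar> \<le> 2 * (d / 2)"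
        proof (rule interp_close[where f = g, OF N(3) _ _ s])
          show "g 0 = 0" using g by (simp add: mspace_Cex)
          fix k s assume k: "k < N" and s: "s \<in> {real k / real N..(real k + 1) / real N}"
          have s01: "s \<in> {0..1}" using s grid[OF k] unfolding atLeastAtMost_iff by linarith
          have "\<bar>f s - f (real k / real N)\<bar> \<le> \<delta> * x"
          proof -
            have "k < 2 ^ m" "s \<in> {real k / 2 ^ m..(real k + 1) / 2 ^ m}" "\<omega> \<in> space M - F"
              using k s \<omega>(1) notin unfolding N(2) by (auto simp: N_def)
            then show ?thesis using F(3) unfolding f_def N(2) by blast
          qed
          then have "c * \<bar>f s - f (real k / real N)\<bar> \<le> c * (\<delta> * x)" using c by (intro mult_left_mono) auto
          also have "c * (\<delta> * x) = d / 2" using \<kappa> x by (simp add: c_def \<delta>_def)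
          also have "c * \<bar>f s - f (real k / real N)\<bar> = \<bar>g s - g (real k / real N)\<bar>"
            using s01 grid(1)[OF k] c by (simp add: g_def right_diff_distrib[symmetric] abs_mult del: atLeastAtMost_iff)
          finally show "\<bar>g s - g (real k / real N)\<bar> \<le> d / 2" .
        qed
        then show ?thesis by simp
      qed
      ultimately have "\<Phi> g < \<kappa>" using d(2) g by blast
      moreover have "\<Phi> g = c * \<Phi> f" unfolding g_def using f c by (intro homogeneous) auto
      moreover have "c * x < c * \<Phi> f" using \<omega>(2) c unfolding f_def by (intro mult_strict_left_mono)
      moreover have "c * x = \<kappa>" using x by (simp add: c_def)
      ultimately show False by simp
    qed
    then have "measure M {\<omega>\<in>space M. \<Phi> (B \<omega>) > x} \<le> measure M (F \<union> G)"
      using F(1) G by (intro finite_measure_mono) auto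
    also have "\<dots> \<le> measure M F + measure M G" using F(1) G by (rule measure_Un_le)
    also have "measure M G \<le> C2 * exp (- ((1 - 2 * \<epsilon>) * (x\<^sup>2 / w) / 2))"
      unfolding G_def C2_def by (rule path_energy_tail[OF B tg \<epsilon>(1,2)])
    also have "(1 - 2 * \<epsilon>) * (x\<^sup>2 / w) / 2 = \<rho>' * x\<^sup>2" unfolding \<epsilon>(3) z_def using \<open>0 < w\<close> by simp
    finally show ?case using F(2) by (simp add: distrib_right)
  qed
  moreover have "\<forall>\<^sub>F x in at_top. (C1 + C2) * exp (- (\<rho>' * x\<^sup>2)) \<le> exp (- (\<rho> * x\<^sup>2))"
  proof -
    have "\<forall>\<^sub>F x in at_top. C1 + C2 \<le> exp ((\<rho>' - \<rho>) * x\<^sup>2)"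
    proof -
      have "0 < \<rho>' - \<rho>" using \<rho>' by simp
      then have "filterlim (\<lambda>x. exp ((\<rho>' - \<rho>) * x\<^sup>2)) at_top at_top" by real_asymp
      then show ?thesis by (simp add: filterlim_at_top)
    qed
    then show ?thesis
    proof (rule eventually_mono)
      fix x assume "C1 + C2 \<le> exp ((\<rho>' - \<rho>) * x\<^sup>2)"
      then have "(C1 + C2) * exp (- (\<rho>' * x\<^sup>2)) \<le> exp ((\<rho>' - \<rho>) * x\<^sup>2) * exp (- (\<rho>' * x\<^sup>2))"
        by (intro mult_right_mono) auto
      also have "\<dots> = exp (- (\<rho> * x\<^sup>2))" by (simp add: exp_add[symmetric] left_diff_distrib)
      finally show "(C1 + C2) * exp (- (\<rho>' * x\<^sup>2)) \<le> exp (- (\<rho> * x\<^sup>2))" .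
    qed
  qed
  ultimately show ?thesis by eventually_elim (rule order_trans)
qed

text \<open>
  Let \<open>f\<close> maximise \<open>\<Phi>\<close> over \<open>Kex\<close>, and let \<open>g = c * f\<close> with \<open>c\<close> slightly larger than \<open>1 / \<gamma>\<close>, so that
  \<open>\<Phi> g > 1\<close>. If the excursion stays near \<open>y * g\<close>, then \<open>\<Phi>\<close> exceeds \<open>y\<close> by continuity and homogeneity.
  It stays there if it passes through boxes of width \<open>1\<close> near the values of \<open>y * g\<close> on a fine
  grid and does not fluctuate between the grid points. The boxes have probability at least about
  \<open>exp (- c\<^sup>2 * y\<^sup>2 / 2)\<close>, because the energy of a polygon inscribed in \<open>f\<close> is at most \<open>1\<close>, and
  the fluctuations are negligible in comparison.
\<close>

theorem tail_lower:
  assumes B: "brownian_excursion M B" and \<rho>: "1 / (2 * \<gamma>\<^sup>2) < \<rho>"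
  shows "\<forall>\<^sub>F x in at_top. exp (- (\<rho> * x\<^sup>2)) \<le> measure M {\<omega>\<in>space M. \<Phi> (B \<omega>) > x}"
proof -
  interpret prob_space M using B by (simp add: brownian_excursion_def)
  note Phi_measurable[OF B, measurable]
  obtain \<rho>' where \<rho>': "1 / (2 * \<gamma>\<^sup>2) < \<rho>'" "\<rho>' < \<rho>" using dense[OF \<rho>] by blast
  have "0 < 1 / (2 * \<gamma>\<^sup>2)" using gamma_pos by simp
  then have \<rho>'0: "0 < \<rho>'" using \<rho>'(1) by linarith
  have "1 / \<gamma>\<^sup>2 < 2 * \<rho>'" using \<rho>'(1) gamma_pos by (simp add: field_simps)
  then obtain w where w: "1 / \<gamma>\<^sup>2 < w" "w < 2 * \<rho>'" using dense[of "1 / \<gamma>\<^sup>2" "2 * \<rho>'"] by blast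
  have "0 < 1 / \<gamma>\<^sup>2" using gamma_pos by simp
  then have w0: "0 < w" using w(1) by linarith
  define c where "c = sqrt w"
  have c: "0 < c" "c\<^sup>2 = w" using w0 by (simp_all add: c_def)
  have "1 / \<gamma> < c" unfolding c_def using w(1) by (intro real_less_rsqrt) (simp add: power_divide)
  then have cg: "1 < c * \<gamma>" using gamma_pos by (simp add: divide_less_eq)
  obtain f where f: "f \<in> Kex" "\<Phi> f = \<gamma>" using gamma_attained by blast
  have fC: "f \<in> mspace Cex" using f by (simp add: Kex_iff)
  define g where "g = (\<lambda>s\<in>{0..1}. c * f s)"
  have g: "g \<in> mspace Cex" unfolding g_def using fC c by (intro Cex_cmult) auto
  have g0: "g 0 = 0" "g 1 = 0" and gnn: "\<And>s. s \<in> {0..1} \<Longrightarrow> 0 \<le> g s" using g by (auto simp: mspace_Cex)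
  have \<Phi>g: "\<Phi> g = c * \<gamma>" unfolding g_def using homogeneous[OF fC] c f by simp
  obtain d where d: "0 < d"
    "\<forall>h\<in>mspace Cex. (\<forall>s\<in>{0..1}. \<bar>g s - h s\<bar> \<le> d) \<longrightarrow> \<bar>\<Phi> g - \<Phi> h\<bar> < c * \<gamma> - 1"
    by (rule uniformly_close[OF g, of "c * \<gamma> - 1"]) (use cg in \<open>auto intro: that\<close>)
  have "0 < d / 4" using d by simp
  have "0 < \<rho> + 1" using \<rho>'0 \<rho>'(2) by simp
  obtain m0 where m0: "\<forall>m\<ge>m0. \<exists>C. \<forall>\<^sub>F x in at_top. \<exists>F\<in>sets M. measure M F \<le> C * exp (- ((\<rho> + 1) * x\<^sup>2)) \<and>
     (\<forall>\<omega>\<in>space M - F. \<forall>k<2 ^ m. \<forall>t\<in>{real k / 2 ^ m..(real k + 1) / 2 ^ m}.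
        \<bar>B \<omega> t - B \<omega> (real k / 2 ^ m)\<bar> \<le> d / 4 * x)"
    by (rule fluctuation_tail[OF B \<open>0 < d / 4\<close> \<open>0 < \<rho> + 1\<close>]) (rule that)
  have "uniformly_continuous_on {0..1} g"
    using g by (intro compact_uniformly_continuous) (auto simp: mspace_Cex)
  then obtain \<eta> where \<eta>: "\<eta> > 0" "\<forall>s\<in>{0..1}. \<forall>t\<in>{0..1}. dist t s < \<eta> \<longrightarrow> dist (g t) (g s) < d / 4"
    using \<open>0 < d / 4\<close> unfolding uniformly_continuous_on_def by blast
  obtain m1 :: nat where m1: "1 / \<eta> < 2 ^ m1" using real_arch_pow[of 2] by auto
  define m where "m = Suc (max m0 m1)"
  define N :: nat where "N = 2 ^ m"
  have N: "2 \<le> N" "real N = 2 ^ m" "0 < N" using one_le_power[of "2::nat" "max m0 m1"] by (simp_all add: N_def m_def)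
  have "1 / \<eta> < real N"
  proof -
    have "(2::real) ^ m1 \<le> 2 ^ m" by (intro power_increasing) (auto simp: m_def)
    then show ?thesis using m1 N(2) by linarith
  qed
  then have N\<eta>: "1 / real N < \<eta>" using \<eta>(1) N(3) by (simp add: field_simps)
  define t where "t = (\<lambda>i. real (i + 1) / real N)"
  have tg: "time_grid (N - 1) t" unfolding t_def by (rule uniform_time_grid[OF N(1)])
  have grid: "real k / real N \<in> {0..1}" "(real k + 1) / real N \<in> {0..1}" if "k < N" for k
    using that by (auto simp: divide_le_eq)
  have "m0 \<le> m" by (simp add: m_def)
  then obtain C where C: "\<forall>\<^sub>F x in at_top. \<exists>F\<in>sets M. measure M F \<le> C * exp (- ((\<rho> + 1) * x\<^sup>2)) \<and>
     (\<forall>\<omega>\<in>space M - F. \<forall>k<2 ^ m. \<forall>t\<in>{real k / 2 ^ m..(real k + 1) / 2 ^ m}.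
        \<bar>B \<omega> t - B \<omega> (real k / 2 ^ m)\<bar> \<le> d / 4 * x)" using m0 by blast
  have energy_f: "real N * (\<Sum>k<N. (f ((real k + 1) / real N) - f (real k / real N))\<^sup>2) \<le> 1"
  proof -
    have "(\<Sum>k<N. (f ((real k + 1) / real N) - f (real k / real N))\<^sup>2 / ((real k + 1) / real N - real k / real N)) \<le> 1"
    proof (rule Riesz_sum_le_1[OF f(1)])
      fix k assume "k \<in> {..<N}"
      then show "0 \<le> real k / real N \<and> real k / real N < (real k + 1) / real N \<and> (real k + 1) / real N \<le> 1"
        using N(3) by (auto simp: divide_strict_right_mono divide_le_eq)
    qed (use grid_cells_disjoint in auto)
    moreover have "(real k + 1) / real N - real k / real N = 1 / real N" for k
      by (simp add: diff_divide_distrib[symmetric])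
    ultimately show ?thesis by (simp add: sum_distrib_left mult.commute)
  qed
  have "(g ((real k + 1) / real N) - g (real k / real N))\<^sup>2 = w * (f ((real k + 1) / real N) - f (real k / real N))\<^sup>2"
    if "k < N" for k
    using grid[OF that] by (simp add: g_def power_mult_distrib right_diff_distrib[symmetric] c(2) del: atLeastAtMost_iff)
  then have scale: "real N * (\<Sum>k<N. (g ((real k + 1) / real N) - g (real k / real N))\<^sup>2) =
      w * (real N * (\<Sum>k<N. (f ((real k + 1) / real N) - f (real k / real N))\<^sup>2))"
    by (simp add: sum_distrib_left mult_ac)
  have "real N * (\<Sum>k<N. (g ((real k + 1) / real N) - g (real k / real N))\<^sup>2) \<le> w"
    unfolding scale using energy_f w0 by (intro mult_left_le) auto
  then have PEg: "path_energy (N - 1) t (\<lambda>i. g (t i)) \<le> w"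
    using path_energy_uniform[where f = g, OF N(1) g0] unfolding t_def by simp
  \<comment> \<open>Scaling \<open>w\<close> by \<open>1 + \<theta>\<close> uses up half of the gap between \<open>w\<close> and \<open>2 * \<rho>'\<close>; the other half, \<open>r\<close>, is
    what the energy of the perturbation may cost.\<close>
  define \<theta> where "\<theta> = (2 * \<rho>' / w - 1) / 2"
  have \<theta>: "0 < \<theta>" using w(2) w0 by (simp add: \<theta>_def)
  define D where "D = (1 + 1 / \<theta>) * (4 * (real N)\<^sup>2)"
  have D: "0 < D" unfolding D_def using \<theta> N(3) by (intro mult_pos_pos add_pos_pos divide_pos_pos) auto
  define r where "r = 2 * \<rho>' - (1 + \<theta>) * w"
  have r: "0 < r"
  proof -
    have "(1 + \<theta>) * w = (w + 2 * \<rho>') / 2" using w0 by (simp add: \<theta>_def field_simps)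
    then show ?thesis using w(2) by (simp add: r_def)
  qed
  define h where "h = min (d / 4) (sqrt (r / D))"
  have h: "0 < h" "h \<le> d / 4" using d r D by (simp_all add: h_def)
  have "h\<^sup>2 \<le> (sqrt (r / D))\<^sup>2" using h by (intro power_mono) (auto simp: h_def)
  then have "h\<^sup>2 \<le> r / D" using r D by simp
  then have hD: "D * h\<^sup>2 \<le> r" using D by (simp add: le_divide_eq mult.commute)
  have "\<forall>\<^sub>F x in at_top. (1 / 6) ^ N * exp (- (\<rho>' * x\<^sup>2)) - C * exp (- ((\<rho> + 1) * x\<^sup>2)) \<le>
      measure M {\<omega>\<in>space M. \<Phi> (B \<omega>) > x}"
    using C eventually_ge_at_top[of "2 / h"]
  proof eventually_elim
    case (elim y)
    then obtain F where F: "F \<in> sets M" "measure M F \<le> C * exp (- ((\<rho> + 1) * y\<^sup>2))"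
      "\<forall>\<omega>\<in>space M - F. \<forall>k<2 ^ m. \<forall>t\<in>{real k / 2 ^ m..(real k + 1) / 2 ^ m}. \<bar>B \<omega> t - B \<omega> (real k / 2 ^ m)\<bar> \<le> d / 4 * y"
      by blast
    have "0 < 2 / h" using h by simp
    then have y: "0 < y" using elim by linarith
    have yh: "2 \<le> y * h" using elim h by (simp add: divide_le_eq)
    \<comment> \<open>Since \<open>g\<close> may vanish, the boxes are lifted by \<open>y * h / 2 \<ge> 1\<close> to lie above \<open>1\<close>. The same
      inequality makes their width at most \<open>y * h / 2\<close>, so that the values stay within \<open>y * h\<close> of \<open>y * g\<close>.\<close>
    define a where "a i = y * (g (t i) + h / 2)" for i
    define G where "G = {\<omega>\<in>space M. \<forall>i<N - 1. a i \<le> B \<omega> (t i) \<and> B \<omega> (t i) \<le> a i + 1}"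
    have t01: "t i \<in> {0..1}" if "i < N - 1" for i using time_gridD(2,3)[OF tg that] by simp
    have near: "\<bar>v / y - g (t i)\<bar> \<le> h" if "a i \<le> v" "v \<le> a i + 1" for v i
    proof -
      have "y * (g (t i) + h / 2) \<le> v" "v \<le> y * (g (t i) + h)"
        using that yh by (simp_all add: a_def distrib_left)
      then have "g (t i) + h / 2 \<le> v / y" "v / y \<le> g (t i) + h" using y by (simp_all add: le_divide_eq divide_le_eq mult.commute)
      then show ?thesis using h by linarith
    qed
    have "(1 / 6) ^ (N - 1 + 1) * exp (- (2 * \<rho>' * y\<^sup>2 / 2)) \<le> measure M G"
      unfolding G_def
    proof (rule box_probability_lower[OF B tg])
      fix i assume i: "i < N - 1"
      have "0 \<le> y * g (t i)" using gnn[OF t01[OF i]] y by simp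
      then show "1 \<le> a i" using yh by (simp add: a_def distrib_left)
    next
      fix x assume x: "\<And>i. i < N - 1 \<Longrightarrow> a i \<le> x i \<and> x i \<le> a i + 1"
      define e where "e i = x i / y - g (t i)" for i
      have "x = (\<lambda>i. y * (g (t i) + e i))" using y by (auto simp: e_def)
      then have "path_energy (N - 1) t x \<le>
          y\<^sup>2 * ((1 + \<theta>) * path_energy (N - 1) t (\<lambda>i. g (t i)) + (1 + 1 / \<theta>) * path_energy (N - 1) t e)"
        using path_energy_perturb[OF tg \<theta>, of y "\<lambda>i. g (t i)" e] by simp
      also have "\<dots> \<le> y\<^sup>2 * ((1 + \<theta>) * w + (1 + 1 / \<theta>) * (4 * (real N)\<^sup>2 * h\<^sup>2))"
      proof (intro mult_left_mono add_mono PEg)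
        show "path_energy (N - 1) t e \<le> 4 * (real N)\<^sup>2 * h\<^sup>2"
          unfolding t_def using near x h by (intro path_energy_uniform_le N) (auto simp: e_def t_def)
      qed (use \<theta> in auto)
      also have "\<dots> = y\<^sup>2 * ((1 + \<theta>) * w + D * h\<^sup>2)" by (simp add: D_def mult.assoc)
      also have "\<dots> \<le> y\<^sup>2 * (2 * \<rho>')" using hD by (intro mult_left_mono) (auto simp: r_def)
      finally show "path_energy (N - 1) t x \<le> 2 * \<rho>' * y\<^sup>2" by (simp add: mult_ac)
    qed
    then have PG: "(1 / 6) ^ N * exp (- (\<rho>' * y\<^sup>2)) \<le> measure M G" using N(3) by simp
    have G: "G \<in> sets M"
    proof -
      have cell: "{\<omega>\<in>space M. a i \<le> B \<omega> (t i) \<and> B \<omega> (t i) \<le> a i + 1} \<in> sets M" if "i \<in> {..<N - 1}" for i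
      proof -
        have "i < N - 1" using that by simp
        note brownian_excursion_eval_measurable[OF B t01[OF this], measurable]
        show ?thesis by measurable
      qed
      have "{\<omega>\<in>space M. \<forall>i\<in>{..<N - 1}. a i \<le> B \<omega> (t i) \<and> B \<omega> (t i) \<le> a i + 1} \<in> sets M"
        by (rule sets.sets_Collect_finite_All[OF cell]) simp_all
      then show ?thesis unfolding G_def by (simp only: Ball_def lessThan_iff)
    qed
    have "G - F \<subseteq> {\<omega>\<in>space M. \<Phi> (B \<omega>) > y}"
    proof
      fix \<omega> assume "\<omega> \<in> G - F"
      then have \<omega>: "\<omega> \<in> space M" "\<omega> \<notin> F" and box: "\<And>i. i < N - 1 \<Longrightarrow> a i \<le> B \<omega> (t i) \<and> B \<omega> (t i) \<le> a i + 1"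
        by (auto simp: G_def)
      define b where "b = B \<omega>"
      have b: "b \<in> mspace Cex" unfolding b_def by (rule brownian_excursion_path[OF B \<omega>(1)])
      have b0: "b 0 = 0" using b by (simp add: mspace_Cex)
      define z where "z = (\<lambda>s\<in>{0..1}. (1 / y) * b s)"
      have z: "z \<in> mspace Cex" unfolding z_def using b y by (intro Cex_cmult) auto
      have "\<bar>g s - z s\<bar> \<le> d" if s: "s \<in> {0..1}" for s
      proof -
        obtain k where k: "k < N" "s \<in> {real k / real N..(real k + 1) / real N}" by (rule grid_cell[OF N(3) s])
        let ?k = "real k / real N"
        have "\<bar>b s - b ?k\<bar> \<le> d / 4 * y"
        proof -
          have "k < 2 ^ m" "s \<in> {real k / 2 ^ m..(real k + 1) / 2 ^ m}" "\<omega> \<in> space M - F"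
            using k \<omega> unfolding N(2) by (auto simp: N_def)
          then show ?thesis using F(3) unfolding b_def N(2) by blast
        qed
        then have "\<bar>b s - b ?k\<bar> / y \<le> d / 4" using y by (simp add: divide_le_eq)
        moreover have "\<bar>b s - b ?k\<bar> / y = \<bar>b s / y - b ?k / y\<bar>" using y by (simp add: diff_divide_distrib[symmetric])
        ultimately have 1: "\<bar>b s / y - b ?k / y\<bar> \<le> d / 4" by simp
        have 2: "\<bar>b ?k / y - g ?k\<bar> \<le> d / 4"
        proof (cases k)
          case 0
          then show ?thesis using b0 g0 d by simp
        next
          case (Suc i)
          then have i: "i < N - 1" "t i = ?k" using k(1) by (auto simp: t_def)
          then show ?thesis using near[of i "b (t i)"] box[OF i(1)] h unfolding b_def by simp
        qed
        have "\<bar>s - ?k\<bar> \<le> 1 / real N" using k(2) by (auto simp: add_divide_distrib)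
        then have "dist s ?k < \<eta>" using N\<eta> by (simp add: dist_real_def)
        then have "dist (g s) (g ?k) < d / 4" using \<eta>(2) grid(1)[OF k(1)] s by blast
        then have 3: "\<bar>g s - g ?k\<bar> < d / 4" by (simp add: dist_real_def)
        have "z s = b s / y" using s by (simp add: z_def)
        then show ?thesis using 1 2 3 d(1) by linarith
      qed
      then have "\<bar>\<Phi> g - \<Phi> z\<bar> < c * \<gamma> - 1" using d(2) z by blast
      then have "1 < \<Phi> z" unfolding \<Phi>g by linarith
      moreover have "\<Phi> z = 1 / y * \<Phi> b" unfolding z_def using b y by (intro homogeneous) auto
      ultimately have "y < \<Phi> b" using y by (simp add: less_divide_eq)
      then show "\<omega> \<in> {\<omega>\<in>space M. \<Phi> (B \<omega>) > y}" using \<omega> by (simp add: b_def)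
    qed
    then have "measure M (G - F) \<le> measure M {\<omega>\<in>space M. \<Phi> (B \<omega>) > y}"
      by (intro finite_measure_mono) auto
    moreover have "measure M G - measure M F \<le> measure M (G - F)"
    proof -
      have "measure M G \<le> measure M ((G - F) \<union> F)" using G F(1) by (intro finite_measure_mono) auto
      also have "\<dots> \<le> measure M (G - F) + measure M F" using G F(1) by (intro measure_Un_le) auto
      finally show ?thesis by simp
    qed
    ultimately show ?case using PG F(2) by linarith
  qed
  moreover have "\<forall>\<^sub>F x in at_top. exp (- (\<rho> * x\<^sup>2)) \<le> (1 / 6) ^ N * exp (- (\<rho>' * x\<^sup>2)) - C * exp (- ((\<rho> + 1) * x\<^sup>2))"
  proof -
    have "\<forall>\<^sub>F x in at_top. 6 ^ N * (1 + \<bar>C\<bar>) \<le> exp ((\<rho> - \<rho>') * x\<^sup>2)"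
    proof -
      have "0 < \<rho> - \<rho>'" using \<rho>' by simp
      then have "filterlim (\<lambda>x. exp ((\<rho> - \<rho>') * x\<^sup>2)) at_top at_top" by real_asymp
      then show ?thesis by (simp add: filterlim_at_top)
    qed
    then show ?thesis
    proof (rule eventually_mono)
      fix x assume *: "6 ^ N * (1 + \<bar>C\<bar>) \<le> exp ((\<rho> - \<rho>') * x\<^sup>2)"
      have "C * exp (- ((\<rho> + 1) * x\<^sup>2)) \<le> \<bar>C\<bar> * exp (- (\<rho> * x\<^sup>2))"
        by (intro mult_mono) (auto simp: distrib_right)
      then have "exp (- (\<rho> * x\<^sup>2)) + C * exp (- ((\<rho> + 1) * x\<^sup>2)) \<le> (1 + \<bar>C\<bar>) * exp (- (\<rho> * x\<^sup>2))"
        by (simp add: distrib_right)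
      also have "1 + \<bar>C\<bar> \<le> (1 / 6) ^ N * exp ((\<rho> - \<rho>') * x\<^sup>2)" using * by (simp add: field_simps power_divide)
      then have "(1 + \<bar>C\<bar>) * exp (- (\<rho> * x\<^sup>2)) \<le> (1 / 6) ^ N * exp ((\<rho> - \<rho>') * x\<^sup>2) * exp (- (\<rho> * x\<^sup>2))"
        by (intro mult_right_mono) auto
      also have "\<dots> = (1 / 6) ^ N * exp (- (\<rho>' * x\<^sup>2))"
        unfolding mult.assoc exp_add[symmetric] by (simp add: left_diff_distrib)
      finally show "exp (- (\<rho> * x\<^sup>2)) \<le> (1 / 6) ^ N * exp (- (\<rho>' * x\<^sup>2)) - C * exp (- ((\<rho> + 1) * x\<^sup>2))" by simp
    qed
  qed
  ultimately show ?thesis by eventually_elim (rule order_trans)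
qed

end

section \<open>Exponential and power moments of variables with Gaussian tails\<close>

lemma asymp_equiv_of_bounds:
  fixes f g :: "real \<Rightarrow> real"
  assumes pos: "\<forall>\<^sub>F x in F. 0 < g x"
    and lower: "\<And>l. 0 < l \<Longrightarrow> l < 1 \<Longrightarrow> \<forall>\<^sub>F x in F. l * g x \<le> f x"
    and upper: "\<And>u. 1 < u \<Longrightarrow> \<forall>\<^sub>F x in F. f x \<le> u * g x"
  shows "f \<sim>[F] g"
proof (rule asymp_equivI')
  show "((\<lambda>x. f x / g x) \<longlongrightarrow> 1) F"
  proof (rule order_tendstoI)
    fix a :: real assume "a < 1"
    define l where "l = (max a 0 + 1) / 2"
    have l: "a < l" "0 < l" "l < 1" using \<open>a < 1\<close> by (auto simp: l_def max_def)
    show "\<forall>\<^sub>F x in F. a < f x / g x" using pos lower[OF l(2,3)]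
    proof eventually_elim
      case (elim x)
      then have "l \<le> f x / g x" by (simp add: le_divide_eq)
      then show ?case using l(1) by simp
    qed
  next
    fix a :: real assume "1 < a"
    then obtain u where u: "1 < u" "u < a" using dense by blast
    show "\<forall>\<^sub>F x in F. f x / g x < a" using pos upper[OF u(1)]
    proof eventually_elim
      case (elim x)
      then have "f x / g x \<le> u" by (simp add: divide_le_eq)
      then show ?case using u(2) by simp
    qed
  qed
qed

text \<open>
  Tails of the form \<open>exp (- (a + o(1)) * x\<^sup>2)\<close>, with the error term expressed by rates above and
  below \<open>a\<close>.
\<close>

locale gaussian_tail = prob_space +
  fixes X :: "'a \<Rightarrow> real" and a :: real
  assumes X[measurable]: "X \<in> borel_measurable M"
    and X_nonneg: "\<And>\<omega>. \<omega> \<in> space M \<Longrightarrow> 0 \<le> X \<omega>"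
    and a_pos: "0 < a"
    and tail_le: "\<And>\<rho>. 0 < \<rho> \<Longrightarrow> \<rho> < a \<Longrightarrow> \<forall>\<^sub>F x in at_top. prob {\<omega>\<in>space M. X \<omega> > x} \<le> exp (- (\<rho> * x\<^sup>2))"
    and tail_ge: "\<And>\<rho>. a < \<rho> \<Longrightarrow> \<forall>\<^sub>F x in at_top. exp (- (\<rho> * x\<^sup>2)) \<le> prob {\<omega>\<in>space M. X \<omega> > x}"
begin

theorem neg_ln_tail_asymp: "(\<lambda>x. - ln (prob {\<omega>\<in>space M. X \<omega> > x})) \<sim>[at_top] (\<lambda>x. a * x\<^sup>2)"
proof (rule asymp_equiv_of_bounds)
  show "\<forall>\<^sub>F x in at_top. 0 < a * x\<^sup>2"
    using eventually_gt_at_top[of "0::real"] by eventually_elim (use a_pos in simp)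
next
  fix l :: real assume l: "0 < l" "l < 1"
  have la: "a < a + 1" "0 < l * a" "l * a < a" using l a_pos by simp_all
  show "\<forall>\<^sub>F x in at_top. l * (a * x\<^sup>2) \<le> - ln (prob {\<omega>\<in>space M. X \<omega> > x})"
    using tail_le[OF la(2,3)] tail_ge[OF la(1)]
  proof eventually_elim
    case (elim x)
    then have "0 < prob {\<omega>\<in>space M. X \<omega> > x}" by (meson exp_gt_zero less_le_trans)
    then have "ln (prob {\<omega>\<in>space M. X \<omega> > x}) \<le> ln (exp (- (l * a * x\<^sup>2)))" using elim(1) by (subst ln_le_cancel_iff) auto
    then show ?case by (simp add: mult.assoc)
  qed
next
  fix u :: real assume u: "1 < u"
  then have "a < u * a" using a_pos by simp
  show "\<forall>\<^sub>F x in at_top. - ln (prob {\<omega>\<in>space M. X \<omega> > x}) \<le> u * (a * x\<^sup>2)"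
    using tail_ge[OF \<open>a < u * a\<close>]
  proof eventually_elim
    case (elim x)
    then have "ln (exp (- (u * a * x\<^sup>2))) \<le> ln (prob {\<omega>\<in>space M. X \<omega> > x})"
      by (subst ln_le_cancel_iff) (auto intro: less_le_trans[OF exp_gt_zero])
    then show ?case by (simp add: mult.assoc)
  qed
qed

text \<open>
  The integral is at most the sum of \<open>exp (b * (k + 1)\<^sup>2) * prob {X > k - 1}\<close> over \<open>k\<close>, and a tail
  of rate \<open>\<rho> > b\<close> makes these terms smaller than \<open>exp (- k)\<close> in the end.
\<close>

lemma exp_square_integrable:
  assumes b: "0 < b" "b < a"
  shows "integrable M (\<lambda>\<omega>. exp (b * (X \<omega>)\<^sup>2))"
proof (rule integrableI_bounded)
  show "(\<lambda>\<omega>. exp (b * (X \<omega>)\<^sup>2)) \<in> borel_measurable M" by measurable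
  obtain \<rho> where \<rho>: "b < \<rho>" "\<rho> < a" using dense[OF b(2)] by blast
  \<comment> \<open>The strict inequality with \<open>k - 1\<close> admits the value \<open>X \<omega> = k\<close>, also for \<open>k = 0\<close>.\<close>
  define E where "E k = {\<omega>\<in>space M. X \<omega> > real k - 1}" for k :: nat
  have E[measurable]: "E k \<in> sets M" for k unfolding E_def by measurable
  define v where "v k = exp (b * (real k + 1)\<^sup>2)" for k :: nat
  have "\<forall>\<^sub>F x in at_top. prob {\<omega>\<in>space M. X \<omega> > x} \<le> exp (- (\<rho> * x\<^sup>2))" using \<rho> b by (intro tail_le) auto
  moreover have "filterlim (\<lambda>k::nat. real k - 1) at_top sequentially" by real_asymp
  ultimately have ev1: "\<forall>\<^sub>F k in sequentially. prob (E k) \<le> exp (- (\<rho> * (real k - 1)\<^sup>2))"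
    unfolding E_def by (rule eventually_compose_filterlim)
  have "0 < \<rho> - b" using \<rho> by simp
  then have "filterlim (\<lambda>k::nat. \<rho> * (real k - 1)\<^sup>2 - b * (real k + 1)\<^sup>2 - real k) at_top sequentially"
    by real_asymp
  then have ev2: "\<forall>\<^sub>F k in sequentially. 0 \<le> \<rho> * (real k - 1)\<^sup>2 - b * (real k + 1)\<^sup>2 - real k"
    unfolding filterlim_at_top by blast
  have summ: "summable (\<lambda>k. v k * prob (E k))"
  proof (rule summable_comparison_test_ev)
    show "\<forall>\<^sub>F k in sequentially. norm (v k * prob (E k)) \<le> exp (- 1) ^ k"
      using ev1 ev2
    proof eventually_elim
      case (elim k)
      have "norm (v k * prob (E k)) = v k * prob (E k)" by (simp add: v_def)
      also have "\<dots> \<le> v k * exp (- (\<rho> * (real k - 1)\<^sup>2))" using elim(1) by (intro mult_left_mono) (auto simp: v_def)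
      also have "\<dots> \<le> exp (real k * (- 1))" unfolding v_def exp_add[symmetric] using elim(2) by simp
      finally show ?case by (simp only: exp_of_nat_mult)
    qed
    show "summable (\<lambda>k. exp (- 1 :: real) ^ k)" by (rule summable_geometric) simp
  qed
  have "(\<integral>\<^sup>+\<omega>. ennreal (norm (exp (b * (X \<omega>)\<^sup>2))) \<partial>M) \<le> (\<integral>\<^sup>+\<omega>. (\<Sum>k. ennreal (v k) * indicator (E k) \<omega>) \<partial>M)"
  proof (rule nn_integral_mono)
    fix \<omega> assume \<omega>: "\<omega> \<in> space M"
    define k where "k = nat \<lfloor>X \<omega>\<rfloor>"
    have "real k = of_int \<lfloor>X \<omega>\<rfloor>" using X_nonneg[OF \<omega>] by (simp add: k_def)
    then have k: "real k \<le> X \<omega>" "X \<omega> \<le> real k + 1" by linarith+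
    have "(X \<omega>)\<^sup>2 \<le> (real k + 1)\<^sup>2" using k X_nonneg[OF \<omega>] by (intro power_mono) auto
    then have "exp (b * (X \<omega>)\<^sup>2) \<le> v k" using b unfolding v_def by simp
    then have "ennreal (norm (exp (b * (X \<omega>)\<^sup>2))) \<le> ennreal (v k) * indicator (E k) \<omega>"
      using \<omega> k by (simp add: E_def ennreal_leI)
    also have "\<dots> \<le> (\<Sum>k. ennreal (v k) * indicator (E k) \<omega>)"
    proof -
      have "(\<Sum>k\<in>{k}. ennreal (v k) * indicator (E k) \<omega>) \<le> (\<Sum>k. ennreal (v k) * indicator (E k) \<omega>)"
        by (rule sum_le_suminf) auto
      then show ?thesis by (simp only: sum.insert finite.emptyI empty_iff not_False_eq_True sum.empty add_0_right)
    qed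
    finally show "ennreal (norm (exp (b * (X \<omega>)\<^sup>2))) \<le> (\<Sum>k. ennreal (v k) * indicator (E k) \<omega>)" .
  qed
  also have "\<dots> = (\<Sum>k. \<integral>\<^sup>+\<omega>. ennreal (v k) * indicator (E k) \<omega> \<partial>M)"
    by (rule nn_integral_suminf) measurable
  also have "\<dots> = (\<Sum>k. ennreal (v k * prob (E k)))"
    by (simp add: nn_integral_cmult_indicator emeasure_eq_measure ennreal_mult v_def)
  also have "\<dots> = ennreal (\<Sum>k. v k * prob (E k))"
    using summ by (intro suminf_ennreal_eq summable_sums) (auto simp: v_def)
  finally show "(\<integral>\<^sup>+\<omega>. ennreal (norm (exp (b * (X \<omega>)\<^sup>2))) \<partial>M) < \<infinity>"
    by (simp add: le_less_trans)
qed

lemma Markov_lower: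
  assumes "integrable M Y" "\<And>\<omega>. \<omega> \<in> space M \<Longrightarrow> 0 \<le> Y \<omega>" "\<And>\<omega>. \<omega> \<in> space M \<Longrightarrow> x < X \<omega> \<Longrightarrow> c \<le> Y \<omega>"
  shows "c * prob {\<omega>\<in>space M. X \<omega> > x} \<le> (\<integral>\<omega>. Y \<omega> \<partial>M)"
proof -
  define A where "A = {\<omega>\<in>space M. X \<omega> > x}"
  have A: "A \<in> sets M" unfolding A_def by measurable
  have "(\<integral>\<omega>. c * indicator A \<omega> \<partial>M) \<le> (\<integral>\<omega>. Y \<omega> \<partial>M)"
  proof (rule integral_mono)
    show "integrable M (\<lambda>\<omega>. c * indicator A \<omega>)"
      using A by (intro integrable_mult_right integrable_real_indicator) (auto simp: emeasure_eq_measure)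
    show "c * indicator A \<omega> \<le> Y \<omega>" if "\<omega> \<in> space M" for \<omega>
      using assms(2,3)[OF that] by (cases "\<omega> \<in> A") (auto simp: A_def)
  qed (rule assms(1))
  then show ?thesis using A by (simp add: A_def)
qed

text \<open>
  Completing the square: \<open>t * X \<le> t\<^sup>2 / (4 * b) + b * X\<^sup>2\<close>.
\<close>

lemma exp_integrable: "integrable M (\<lambda>\<omega>. exp (t * X \<omega>))"
  and exp_integral_le: "0 < b \<Longrightarrow> b < a \<Longrightarrow>
    (\<integral>\<omega>. exp (t * X \<omega>) \<partial>M) \<le> exp (t\<^sup>2 / (4 * b)) * (\<integral>\<omega>. exp (b * (X \<omega>)\<^sup>2) \<partial>M)"
proof -
  have le: "exp (t * X \<omega>) \<le> exp (t\<^sup>2 / (4 * b)) * exp (b * (X \<omega>)\<^sup>2)" if "0 < b" for b \<omega>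
  proof -
    have "0 \<le> (t - 2 * b * X \<omega>)\<^sup>2 / (4 * b)" using that by simp
    also have "\<dots> = t\<^sup>2 / (4 * b) + b * (X \<omega>)\<^sup>2 - t * X \<omega>" using that by (simp add: power2_eq_square field_simps)
    finally show ?thesis by (simp add: exp_add[symmetric])
  qed
  have int: "integrable M (\<lambda>\<omega>. exp (t\<^sup>2 / (4 * b)) * exp (b * (X \<omega>)\<^sup>2))" if "0 < b" "b < a" for b
    using exp_square_integrable[OF that] by simp
  show 1: "integrable M (\<lambda>\<omega>. exp (t * X \<omega>))"
    by (rule Bochner_Integration.integrable_bound[OF int[of "a / 2"]]) (use le[of "a / 2"] a_pos in auto)
  show "(\<integral>\<omega>. exp (t * X \<omega>) \<partial>M) \<le> exp (t\<^sup>2 / (4 * b)) * (\<integral>\<omega>. exp (b * (X \<omega>)\<^sup>2) \<partial>M)" if b: "0 < b" "b < a"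
  proof -
    have "(\<integral>\<omega>. exp (t * X \<omega>) \<partial>M) \<le> (\<integral>\<omega>. exp (t\<^sup>2 / (4 * b)) * exp (b * (X \<omega>)\<^sup>2) \<partial>M)"
      using 1 int[OF b] le[OF b(1)] by (intro integral_mono) auto
    then show ?thesis by simp
  qed
qed

lemma exp_square_integral_ge_1:
  assumes "0 < b" "b < a" shows "1 \<le> (\<integral>\<omega>. exp (b * (X \<omega>)\<^sup>2) \<partial>M)"
proof -
  have "(\<integral>\<omega>. 1 \<partial>M) \<le> (\<integral>\<omega>. exp (b * (X \<omega>)\<^sup>2) \<partial>M)"
    using assms exp_square_integrable[OF assms] by (intro integral_mono) auto
  then show ?thesis by (simp add: prob_space)
qed

text \<open>
  The exponent \<open>t * x - \<rho> * x\<^sup>2\<close> is maximal at \<open>x = t / (2 * \<rho>)\<close>, with value \<open>t\<^sup>2 / (4 * \<rho>)\<close>. The tail at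
  that single \<open>x\<close> gives the lower bound for every \<open>\<rho> > a\<close>; for the upper bound, \<open>exp_integral_le\<close>
  attains the same value for every \<open>b < a\<close>, up to a factor that does not depend on \<open>t\<close>.
\<close>

theorem ln_mgf_asymp: "(\<lambda>t. ln (\<integral>\<omega>. exp (t * X \<omega>) \<partial>M)) \<sim>[at_top] (\<lambda>t. t\<^sup>2 / (4 * a))"
proof (rule asymp_equiv_of_bounds)
  show "\<forall>\<^sub>F t in at_top. 0 < t\<^sup>2 / (4 * a)"
    using eventually_gt_at_top[of "0::real"] by eventually_elim (use a_pos in simp)
next
  fix l :: real assume l: "0 < l" "l < 1"
  define \<rho> where "\<rho> = a / l"
  have \<rho>: "a < \<rho>" "0 < \<rho>" using l a_pos by (simp_all add: \<rho>_def less_divide_eq)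
  have "filterlim (\<lambda>t. t / (2 * \<rho>)) at_top at_top" using \<rho>(2) by real_asymp
  with tail_ge[OF \<rho>(1)] have "\<forall>\<^sub>F t in at_top. exp (- (\<rho> * (t / (2 * \<rho>))\<^sup>2)) \<le> prob {\<omega>\<in>space M. X \<omega> > t / (2 * \<rho>)}"
    by (rule eventually_compose_filterlim)
  then show "\<forall>\<^sub>F t in at_top. l * (t\<^sup>2 / (4 * a)) \<le> ln (\<integral>\<omega>. exp (t * X \<omega>) \<partial>M)"
    using eventually_gt_at_top[of 0]
  proof eventually_elim
    case (elim t)
    let ?x = "t / (2 * \<rho>)"
    have "exp (l * (t\<^sup>2 / (4 * a))) = exp (t * ?x) * exp (- (\<rho> * ?x\<^sup>2))"
      unfolding exp_add[symmetric]
      by (rule arg_cong[of _ _ exp]) (use l a_pos in \<open>simp add: \<rho>_def power2_eq_square field_simps\<close>)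
    also have "\<dots> \<le> exp (t * ?x) * prob {\<omega>\<in>space M. X \<omega> > ?x}" using elim(1) by (intro mult_left_mono) auto
    also have "\<dots> \<le> (\<integral>\<omega>. exp (t * X \<omega>) \<partial>M)"
    proof (rule Markov_lower[OF exp_integrable])
      fix \<omega> assume "?x < X \<omega>"
      then have "t * ?x \<le> t * X \<omega>" using elim(2) by (intro mult_left_mono) auto
      then show "exp (t * ?x) \<le> exp (t * X \<omega>)" by simp
    qed simp
    finally have *: "exp (l * (t\<^sup>2 / (4 * a))) \<le> (\<integral>\<omega>. exp (t * X \<omega>) \<partial>M)" .
    then have "ln (exp (l * (t\<^sup>2 / (4 * a)))) \<le> ln (\<integral>\<omega>. exp (t * X \<omega>) \<partial>M)"
      by (subst ln_le_cancel_iff) (auto intro: less_le_trans[OF exp_gt_zero])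
    then show ?case by simp
  qed
next
  fix u :: real assume "1 < u"
  then obtain w where w: "1 < w" "w < u" using dense[of 1 u] by blast
  define b where "b = a / w"
  have b: "0 < b" "b < a" using w a_pos by (simp_all add: b_def divide_less_eq)
  define C where "C = (\<integral>\<omega>. exp (b * (X \<omega>)\<^sup>2) \<partial>M)"
  have C: "1 \<le> C" unfolding C_def by (rule exp_square_integral_ge_1[OF b])
  have "0 < (u - w) / (4 * a)" using w a_pos by simp
  then have "filterlim (\<lambda>t::real. (u - w) / (4 * a) * t\<^sup>2) at_top at_top" by real_asymp
  then have "\<forall>\<^sub>F t in at_top. ln C \<le> (u - w) / (4 * a) * t\<^sup>2" unfolding filterlim_at_top by blast
  then show "\<forall>\<^sub>F t in at_top. ln (\<integral>\<omega>. exp (t * X \<omega>) \<partial>M) \<le> u * (t\<^sup>2 / (4 * a))"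
    using eventually_gt_at_top[of 0]
  proof eventually_elim
    case (elim t)
    have "(\<integral>\<omega>. exp (t * X \<omega>) \<partial>M) \<ge> (\<integral>\<omega>. 1 \<partial>M)"
      using exp_integrable[of t] elim(2) X_nonneg by (intro integral_mono) auto
    then have "0 < (\<integral>\<omega>. exp (t * X \<omega>) \<partial>M)" by (simp add: prob_space)
    then have "ln (\<integral>\<omega>. exp (t * X \<omega>) \<partial>M) \<le> ln (exp (t\<^sup>2 / (4 * b)) * C)"
      using exp_integral_le[OF b, of t] C unfolding C_def by (subst ln_le_cancel_iff) auto
    also have "\<dots> = t\<^sup>2 / (4 * b) + ln C" using C by (simp add: ln_mult)
    also have "t\<^sup>2 / (4 * b) = w * (t\<^sup>2 / (4 * a))" using w a_pos by (simp add: b_def)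
    also have "w * (t\<^sup>2 / (4 * a)) + ln C \<le> w * (t\<^sup>2 / (4 * a)) + (u - w) / (4 * a) * t\<^sup>2" using elim(1) by simp
    also have "\<dots> = u * (t\<^sup>2 / (4 * a))" using a_pos by (simp add: field_simps)
    finally show ?case .
  qed
qed

text \<open>
  Here \<open>r * ln x - \<rho> * x\<^sup>2\<close> is maximal at \<open>x = sqrt (r / (2 * \<rho>))\<close>, with value
  \<open>r / 2 * ln (r / (2 * \<rho> * exp 1))\<close>. As before, the tail at this point gives the lower bound, and
  bounding \<open>X powr r\<close> by the maximum times \<open>exp (b * X\<^sup>2)\<close> gives the upper bound; the constant
  \<open>C\<close> that this leaves is eliminated by the root, as \<open>C powr (1 / r)\<close> tends to \<open>1\<close>.
\<close>

theorem moment_asymp: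
  "(\<lambda>r. (\<integral>\<omega>. X \<omega> powr r \<partial>M) powr (1 / r)) \<sim>[at_top] (\<lambda>r. sqrt (1 / (2 * a * exp 1)) * r powr (1 / 2))"
proof -
  have powr_le: "x powr r \<le> (r / (2 * b * exp 1)) powr (r / 2) * exp (b * x\<^sup>2)" if "0 \<le> x" "0 < b" "0 < r" for x b r :: real
  proof (cases "x = 0")
    case False
    then have x: "0 < x" using that by simp
    define z where "z = 2 * b * x\<^sup>2 / r"
    have z: "0 < z" using x that by (simp add: z_def)
    have "ln z \<le> z - 1" using z by (rule ln_le_minus_one)
    moreover have "ln z = 2 * ln x - ln (r / (2 * b))"
      using x that by (simp add: z_def ln_div ln_mult ln_realpow)
    moreover have "ln (r / (2 * b * exp 1)) = ln (r / (2 * b)) - 1" using that by (simp add: ln_div ln_mult)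
    ultimately have "2 * ln x \<le> ln (r / (2 * b * exp 1)) + z" by simp
    then have "r / 2 * (2 * ln x) \<le> r / 2 * (ln (r / (2 * b * exp 1)) + z)" using that by (intro mult_left_mono) auto
    then have "r * ln x \<le> r / 2 * ln (r / (2 * b * exp 1)) + b * x\<^sup>2" using that by (simp add: z_def distrib_left)
    then have "exp (r * ln x) \<le> exp (r / 2 * ln (r / (2 * b * exp 1)) + b * x\<^sup>2)" by simp
    then show ?thesis using x that by (simp add: powr_def exp_add)
  qed simp
  have int: "integrable M (\<lambda>\<omega>. X \<omega> powr r)" if "0 < r" for r
  proof (rule Bochner_Integration.integrable_bound)
    show "integrable M (\<lambda>\<omega>. (r / (2 * (a / 2) * exp 1)) powr (r / 2) * exp (a / 2 * (X \<omega>)\<^sup>2))"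
      using exp_square_integrable[of "a / 2"] a_pos by simp
    show "AE \<omega> in M. norm (X \<omega> powr r) \<le> norm ((r / (2 * (a / 2) * exp 1)) powr (r / 2) * exp (a / 2 * (X \<omega>)\<^sup>2))"
      using powr_le[of _ "a / 2" r] X_nonneg a_pos that by (intro AE_I2) auto
  qed measurable
  have root: "((r / (2 * b * exp 1)) powr (r / 2)) powr (1 / r) = sqrt (1 / (2 * b * exp 1)) * r powr (1 / 2)"
    if "0 < b" "0 < r" for b r :: real
  proof -
    have "((r / (2 * b * exp 1)) powr (r / 2)) powr (1 / r) = (1 / (2 * b * exp 1) * r) powr (1 / 2)"
      using that by (simp add: powr_powr)
    also have "\<dots> = (1 / (2 * b * exp 1)) powr (1 / 2) * r powr (1 / 2)"
      using that by (intro powr_mult)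
    finally show ?thesis using that by (simp add: powr_half_sqrt)
  qed
  show ?thesis
  proof (rule asymp_equiv_of_bounds)
    show "\<forall>\<^sub>F r in at_top. 0 < sqrt (1 / (2 * a * exp 1)) * r powr (1 / 2)"
      using eventually_gt_at_top[of "0::real"] by eventually_elim (use a_pos in simp)
  next
    fix l :: real assume l: "0 < l" "l < 1"
    define \<rho> where "\<rho> = a / l\<^sup>2"
    have "l\<^sup>2 < 1" using l by (simp add: power_less_one_iff)
    then have \<rho>: "a < \<rho>" "0 < \<rho>" using l a_pos by (simp_all add: \<rho>_def less_divide_eq)
    have "filterlim (\<lambda>r. sqrt (r / (2 * \<rho>))) at_top at_top" using \<rho>(2) by real_asymp
    with tail_ge[OF \<rho>(1)] have "\<forall>\<^sub>F r in at_top. exp (- (\<rho> * (sqrt (r / (2 * \<rho>)))\<^sup>2)) \<le> prob {\<omega>\<in>space M. X \<omega> > sqrt (r / (2 * \<rho>))}"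
      by (rule eventually_compose_filterlim)
    then show "\<forall>\<^sub>F r in at_top. l * (sqrt (1 / (2 * a * exp 1)) * r powr (1 / 2)) \<le> (\<integral>\<omega>. X \<omega> powr r \<partial>M) powr (1 / r)"
      using eventually_gt_at_top[of 0]
    proof eventually_elim
      case (elim r)
      let ?x = "sqrt (r / (2 * \<rho>))"
      have x: "0 < ?x" "?x\<^sup>2 = r / (2 * \<rho>)" using elim(2) \<rho> by simp_all
      have "(r / (2 * \<rho> * exp 1)) powr (r / 2) = ?x powr r * exp (- (\<rho> * ?x\<^sup>2))"
      proof -
        have l1: "ln ?x = ln (r / (2 * \<rho>)) / 2" using elim(2) \<rho> by (simp add: ln_sqrt)
        have l2: "ln (r / (2 * \<rho> * exp 1)) = ln (r / (2 * \<rho>)) - 1" using elim(2) \<rho> by (simp add: ln_div ln_mult)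
        have l3: "\<rho> * ?x\<^sup>2 = r / 2" unfolding x(2) using \<rho> by simp
        have "r / 2 * ln (r / (2 * \<rho> * exp 1)) = r * ln ?x + - (\<rho> * ?x\<^sup>2)"
          unfolding l1 l2 l3 by (simp add: right_diff_distrib)
        then have "exp (r / 2 * ln (r / (2 * \<rho> * exp 1))) = exp (r * ln ?x) * exp (- (\<rho> * ?x\<^sup>2))" by (simp only: exp_add)
        then show ?thesis using x(1) elim(2) \<rho> by (simp add: powr_def)
      qed
      also have "\<dots> \<le> ?x powr r * prob {\<omega>\<in>space M. X \<omega> > ?x}" using elim(1) by (intro mult_left_mono) auto
      also have "\<dots> \<le> (\<integral>\<omega>. X \<omega> powr r \<partial>M)"
        using elim(2) x(1) by (intro Markov_lower int powr_mono2) auto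
      finally have "((r / (2 * \<rho> * exp 1)) powr (r / 2)) powr (1 / r) \<le> (\<integral>\<omega>. X \<omega> powr r \<partial>M) powr (1 / r)"
        using elim(2) by (intro powr_mono2) auto
      moreover have "sqrt (1 / (2 * \<rho> * exp 1)) = l * sqrt (1 / (2 * a * exp 1))"
      proof -
        have "1 / (2 * \<rho> * exp 1) = l\<^sup>2 * (1 / (2 * a * exp 1))" using l a_pos by (simp add: \<rho>_def)
        then show ?thesis using l by (simp only: real_sqrt_mult) simp
      qed
      ultimately show ?case using root[OF \<rho>(2) elim(2)] by (simp only: mult.assoc)
    qed
  next
    fix u :: real assume u: "1 < u"
    define w where "w = sqrt u"
    have w: "1 < w" "w * w = u" using u by (simp_all add: w_def)
    define b where "b = a / w\<^sup>2"
    have "1 < w\<^sup>2" using w by (simp add: power2_eq_square u)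
    then have b: "0 < b" "b < a" using a_pos w by (simp_all add: b_def divide_less_eq)
    define C where "C = (\<integral>\<omega>. exp (b * (X \<omega>)\<^sup>2) \<partial>M)"
    have C: "1 \<le> C" unfolding C_def by (rule exp_square_integral_ge_1[OF b])
    have "((\<lambda>r. C powr (1 / r)) \<longlongrightarrow> 1) at_top" using C by real_asymp
    then have "\<forall>\<^sub>F r in at_top. C powr (1 / r) < w" using w(1) by (rule order_tendstoD)
    then show "\<forall>\<^sub>F r in at_top. (\<integral>\<omega>. X \<omega> powr r \<partial>M) powr (1 / r) \<le> u * (sqrt (1 / (2 * a * exp 1)) * r powr (1 / 2))"
      using eventually_gt_at_top[of 0]
    proof eventually_elim
      case (elim r)
      have "(\<integral>\<omega>. X \<omega> powr r \<partial>M) \<le> (\<integral>\<omega>. (r / (2 * b * exp 1)) powr (r / 2) * exp (b * (X \<omega>)\<^sup>2) \<partial>M)"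
        using int[OF elim(2)] exp_square_integrable[OF b] powr_le[OF X_nonneg b(1) elim(2)]
        by (intro integral_mono) auto
      then have "(\<integral>\<omega>. X \<omega> powr r \<partial>M) \<le> (r / (2 * b * exp 1)) powr (r / 2) * C" by (simp add: C_def)
      then have "(\<integral>\<omega>. X \<omega> powr r \<partial>M) powr (1 / r) \<le> ((r / (2 * b * exp 1)) powr (r / 2) * C) powr (1 / r)"
        using elim(2) by (intro powr_mono2) (auto intro: Bochner_Integration.integral_nonneg)
      also have "\<dots> = sqrt (1 / (2 * b * exp 1)) * r powr (1 / 2) * C powr (1 / r)"
        using root[OF b(1) elim(2)] C by (simp add: powr_mult)
      also have "sqrt (1 / (2 * b * exp 1)) = w * sqrt (1 / (2 * a * exp 1))"
      proof -
        have "1 / (2 * b * exp 1) = w\<^sup>2 * (1 / (2 * a * exp 1))" using w(1) a_pos by (simp add: b_def)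
        then show ?thesis using w(1) by (simp only: real_sqrt_mult) simp
      qed
      also have "w * sqrt (1 / (2 * a * exp 1)) * r powr (1 / 2) * C powr (1 / r) \<le>
          w * sqrt (1 / (2 * a * exp 1)) * r powr (1 / 2) * w"
        using elim(1) w(1) a_pos by (intro mult_left_mono) auto
      also have "\<dots> = u * (sqrt (1 / (2 * a * exp 1)) * r powr (1 / 2))" using w(2) by (simp add: mult_ac)
      finally show ?case .
    qed
  qed
qed

end

section \<open>Asymptotics for functionals of the Brownian excursion\<close>

theorem theorem2p1:
  fixes M :: "'w measure" and B :: "'w \<Rightarrow> real \<Rightarrow> real"
    and \<Phi> :: "(real \<Rightarrow> real) \<Rightarrow> real" and X :: "'w \<Rightarrow> real" and \<gamma> :: real
  assumes "brownian_excursion M B"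
    and "continuous_map (mtopology_of Cex) euclidean \<Phi>"
    and "\<forall>f\<in>mspace Cex. 0 \<le> \<Phi> f"
    and "\<forall>f\<in>mspace Cex. \<forall>t\<ge>0. \<Phi> (\<lambda>s\<in>{0..1}. t * f s) = t * \<Phi> f"
    and "\<exists>f\<in>mspace Cex. \<Phi> f \<noteq> 0"
  defines "X \<equiv> \<lambda>\<omega>. \<Phi> (B \<omega>)"
    and "\<gamma> \<equiv> (SUP f\<in>Kex. \<Phi> f)"
  shows "(\<exists>f\<in>Kex. \<Phi> f = \<gamma>) \<and> (\<forall>f\<in>Kex. \<Phi> f \<le> \<gamma>) \<and> 0 < \<gamma> \<and>
    (\<lambda>x. - ln (measure M {\<omega>\<in>space M. X \<omega> > x})) \<sim>[at_top] (\<lambda>x. x\<^sup>2 / (2 * \<gamma>\<^sup>2)) \<and>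
    (\<lambda>t. ln (\<integral>\<omega>. exp (t * X \<omega>) \<partial>M)) \<sim>[at_top] (\<lambda>t. \<gamma>\<^sup>2 / 2 * t\<^sup>2) \<and>
    (\<lambda>r. (\<integral>\<omega>. X \<omega> powr r \<partial>M) powr (1 / r)) \<sim>[at_top] (\<lambda>r. \<gamma> / sqrt (exp 1) * r powr (1/2))"
proof -
  interpret H: homogeneous_functional \<Phi> by standard (use assms(2-5) in auto)
  have \<gamma>: "H.\<gamma> = \<gamma>" by (simp add: H.\<gamma>_def \<gamma>_def)
  have pos: "0 < \<gamma>" using H.gamma_pos by (simp add: \<gamma>)
  interpret prob_space M using assms(1) by (simp add: brownian_excursion_def)
  interpret gaussian_tail M X "1 / (2 * \<gamma>\<^sup>2)"
  proof
    show "X \<in> borel_measurable M" unfolding X_def by (rule H.Phi_measurable[OF assms(1)])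
    show "0 \<le> X \<omega>" if "\<omega> \<in> space M" for \<omega>
      unfolding X_def by (rule H.nonneg[OF brownian_excursion_path[OF assms(1) that]])
    show "0 < 1 / (2 * \<gamma>\<^sup>2)" using pos by simp
    show "\<forall>\<^sub>F x in at_top. prob {\<omega>\<in>space M. X \<omega> > x} \<le> exp (- (\<rho> * x\<^sup>2))" if "0 < \<rho>" "\<rho> < 1 / (2 * \<gamma>\<^sup>2)" for \<rho>
      unfolding X_def using H.tail_upper[OF assms(1), of \<rho>] that by (simp add: \<gamma>)
    show "\<forall>\<^sub>F x in at_top. exp (- (\<rho> * x\<^sup>2)) \<le> prob {\<omega>\<in>space M. X \<omega> > x}" if "1 / (2 * \<gamma>\<^sup>2) < \<rho>" for \<rho>
      unfolding X_def using H.tail_lower[OF assms(1), of \<rho>] that by (simp add: \<gamma>)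
  qed
  have "sqrt (1 / (2 * (1 / (2 * \<gamma>\<^sup>2)) * exp 1)) = \<gamma> / sqrt (exp 1)"
    using pos by (simp add: real_sqrt_divide)
  then show ?thesis
    using H.gamma_attained H.gamma_upper pos neg_ln_tail_asymp ln_mgf_asymp moment_asymp by (simp add: \<gamma> mult.commute)
qed

end
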